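(* Let $X^n$ be a compact two-strata pseudomanifold with connected singular stratum $\Sigma=B$, whose link bundle $p:\partial M\to B$ with fiber $F^m$ is flat and has structure group contained in the isometries of the closed, oriented Riemannian manifold $F$. For every perversity $\bar p$, the DGA structure $(\Omega^\bullet(N),d,\wedge)$ restricts to a DGA structure $(\Omega I^\bullet_{\bar p}(N),d,\wedge)$. In particular, the wedge product of forms induces a cup product $$\cup:HI^r_{\bar p}(X)\otimes HI^s_{\bar p}(X)\longrightarrow HI^{r+s}_{\bar p}(X).$$
   Context: **Spaces.** $X$ is a compact Hausdorff, second-countable space, $\Sigma\subset X$ is a closed subspace which is a closed, connected, smooth $b$-manifold, and $X-\Sigma$ is a smooth $n$-manifold dense in $X$. There are an open neighborhood $T$ of $\Sigma$, a continuous retraction $\pi_T:T\to\Sigma$ and a continuous function $\rho:T\to[0,2)$ with $\rho^{-1}(0)=\Sigma$, both smooth on $T-\Sigma$, such that $\pi_T$ is a locally trivial bundle with fiber the cone $cF=(F\times[0,2))/(F\times 0)$ on a closed smooth manifold $F$ (the link, of dimension $m=n-1-b\ge1$), with structure group given by homeomorphisms of the form $c(\phi)$, $\phi$ a diffeomorphism of $F$ varying smoothly with points in charts of $\Sigma$, and such that $\rho$ is the cone coordinate in local trivializations. Put $M=X-\rho^{-1}([0,1))$, a compact smooth manifold with boundary $\partial M=\rho^{-1}(1)$; $B=\Sigma$; the link bundle is $p=\pi_T|:\partial M\to B$. $N$ is the interior of $M$ ($N\cong X-\Sigma$). **Flatness, isometric structure.** $F$ is oriented and carries a Riemannian metric.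 There are a finite good open cover $\{U_\alpha\}$ of $B$ (all nonempty finite intersections are diffeomorphic to $\mathbb{R}^b$) and local trivializations $\phi_\alpha:p^{-1}(U_\alpha)\cong U_\alpha\times F$ over $U_\alpha$ with transition functions $\phi_\beta\phi_\alpha^{-1}(t,x)=(t,g_{\beta\alpha}(x))$, where $g_{\beta\alpha}$ is an isometry of $F$ not depending on $t$. These data are fixed. **Collar.** Fix a smooth collar $(-2,1]\times\partial M\cong U\subset M$, $(1,x)\mapsto x$. Let $E=(-1,1)\times\partial M\subset N$, $j:E\hookrightarrow N$ the inclusion, $\pi:E\to\partial M$ the second-factor projection. **Forms.** For the closed oriented Riemannian $m$-manifold $F$ with Hodge star $*$, $d^*=(-1)^{m(r+1)+1}*d*:\Omega^r(F)\to\Omega^{r-1}(F)$. For an integer $k\ge0$, $\tau_{\ge k}\Omega^\bullet(F)\subset\Omega^\bullet(F)$ is the subcomplex equal to $0$ in degrees $<k$, to $\ker(d^*:\Omega^k(F)\to\Omega^{k-1}(F))$ in degree $k$, and to $\Omega^r(F)$ in degrees $r>k$. Let $\pi_1,\pi_2$ be the projections of $U_\alpha\times F$. $\mathrm{ft}_{\ge k}\Omega^\bullet_{\mathcal{MS}}(B)\subset\Omega^\bullet(\partial M)$ consists of all $\omega$ such that for every $\alpha$, $\omega|_{p^{-1}U_\alpha}=\phi_\alpha^*\sum_j\pi_1^*\eta_j\wedge\pi_2^*\gamma_j$ (finite sum) with $\eta_j\in\Omega^\bullet(U_\alpha)$, $\gamma_j\in\tau_{\ge k}\Omega^\bullet(F)$.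 **Perversities and $HI$.** A perversity is a function $\bar p:\{2,3,\dots\}\to\mathbb{Z}_{\ge0}$ with $\bar p(2)=0$, $\bar p(k)\le\bar p(k+1)\le\bar p(k)+1$. Put $K=m-\bar p(m+1)$ and $$\Omega I^\bullet_{\bar p}(N)=\{\omega\in\Omega^\bullet(N)\mid j^*\omega=\pi^*\eta\text{ for some }\eta\in\mathrm{ft}_{\ge K}\Omega^\bullet_{\mathcal{MS}}(B)\},\qquad HI^r_{\bar p}(X)=H^r(\Omega I^\bullet_{\bar p}(N)).$$ Here a DGA is not required to be unital: the assertion is that $\Omega I^\bullet_{\bar p}(N)$ is a graded subspace of $\Omega^\bullet(N)$ closed under $d$ and $\wedge$. *)

theory Defs
  imports
    "HOL-Analysis.Analysis"
    "HOL-Library.Function_Algebras"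
    "HOL-Library.Set_Algebras"
begin

section \<open>Model spaces and smooth functions between them\<close>

text \<open>
  Finite-dimensional real inner product spaces. In contrast to the class \<^class>\<open>euclidean_space\<close>,
  dimension 0 is allowed; this is needed because the singular stratum may be a point. Finite
  dimension is expressed by a finite set with trivial orthogonal complement, because \<^const>\<open>span\<close>
  cannot be used in a class specification; see \<open>finite_spanning_set\<close> below.
\<close>

class fin_dim_inner = real_inner +
  assumes finite_separating_set: "\<exists>S. finite S \<and> (\<forall>x. (\<forall>v\<in>S. inner x v = 0) \<longrightarrow> x = 0)"

lemma ex_orthogonal_projection:
  fixes S :: "'a::real_inner set"
  assumes "finite S"
  shows "\<exists>y\<in>span S. \<forall>v\<in>S. inner (x - y) v = 0"
  using assms
proof (induction S arbitrary: x)
  case empty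
  then show ?case by auto
next
  case (insert a S)
  obtain b where b: "b \<in> span S" "\<And>v. v \<in> S \<Longrightarrow> inner (a - b) v = 0"
    using insert.IH[of a] by blast
  obtain y where y: "y \<in> span S" "\<And>v. v \<in> S \<Longrightarrow> inner (x - y) v = 0"
    using insert.IH[of x] by blast
  define a' where "a' = a - b"
  define t where "t = inner (x - y) a' / inner a' a'"
  have orth: "inner w u = 0" if w: "\<And>v. v \<in> S \<Longrightarrow> inner w v = 0" and u: "u \<in> span S" for w u
    using u by (induction rule: span_induct_alt) (auto simp: inner_add_right w)
  have sub: "span S \<subseteq> span (insert a S)"
    by (rule span_mono) auto
  have "a \<in> span (insert a S)"
    by (simp add: span_base)
  then have a': "a' \<in> span (insert a S)"
    unfolding a'_def using b sub by (auto intro: span_diff)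
  have 1: "y + t *\<^sub>R a' \<in> span (insert a S)"
    using y sub a' by (auto intro: span_add span_scale)
  have 2: "inner (x - (y + t *\<^sub>R a')) v = 0" if "v \<in> S" for v
    using y(2)[OF that] b(2)[OF that] by (simp add: a'_def algebra_simps inner_diff_left inner_add_left)
  have "inner (x - (y + t *\<^sub>R a')) a' = 0"
    by (cases "a' = 0") (auto simp: t_def inner_diff_left inner_add_left)
  moreover have "inner (x - (y + t *\<^sub>R a')) b = 0"
    by (rule orth[OF 2 b(1)])
  ultimately have 3: "inner (x - (y + t *\<^sub>R a')) a = 0"
    by (simp add: a'_def inner_diff_right)
  show ?case
    using 1 2 3 by blast
qed

lemma finite_spanning_set: "\<exists>S :: 'a::fin_dim_inner set. finite S \<and> span S = UNIV"
proof -
  obtain S :: "'a set" where S: "finite S" "\<And>x. (\<forall>v\<in>S. inner x v = 0) \<Longrightarrow> x = 0"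
    using finite_separating_set by blast
  have "x \<in> span S" for x
  proof -
    obtain y where "y \<in> span S" "\<forall>v\<in>S. inner (x - y) v = 0"
      using ex_orthogonal_projection[OF S(1)] by blast
    with S(2)[of "x - y"] show ?thesis by simp
  qed
  then show ?thesis using S(1) by blast
qed

instance euclidean_space \<subseteq> fin_dim_inner
  by standard (meson finite_Basis euclidean_all_zero_iff)

instance prod :: (fin_dim_inner, fin_dim_inner) fin_dim_inner
proof
  obtain S :: "'a set" where S: "finite S" "\<And>x. (\<forall>v\<in>S. inner x v = 0) \<Longrightarrow> x = 0"
    using finite_separating_set by blast
  obtain S' :: "'b set" where S': "finite S'" "\<And>x. (\<forall>v\<in>S'. inner x v = 0) \<Longrightarrow> x = 0"
    using finite_separating_set by blast
  let ?Q = "(\<lambda>x. (x, 0)) ` S \<union> (\<lambda>y. (0, y)) ` S'"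
  have "x = 0" if "\<forall>v\<in>?Q. inner x v = 0" for x
  proof -
    have "inner (fst x) v = 0" if "v \<in> S" for v
      using \<open>\<forall>v\<in>?Q. inner x v = 0\<close> that by (force simp: inner_prod_def)
    moreover have "inner (snd x) v = 0" if "v \<in> S'" for v
      using \<open>\<forall>v\<in>?Q. inner x v = 0\<close> that by (force simp: inner_prod_def)
    ultimately show ?thesis
      using S(2)[of "fst x"] S'(2)[of "snd x"] by (simp add: prod_eq_iff)
  qed
  then show "\<exists>S :: ('a \<times> 'b) set. finite S \<and> (\<forall>x. (\<forall>v\<in>S. inner x v = 0) \<longrightarrow> x = 0)"
    using S(1) S'(1) by (intro exI[of _ ?Q]) auto
qed

text \<open>\<open>C\<^sup>k\<close> and \<open>C\<^sup>\<infinity>\<close> functions on an open subset of a finite-dimensional space.\<close>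

fun Ck_on :: "nat \<Rightarrow> 'a set \<Rightarrow> ('a::fin_dim_inner \<Rightarrow> 'b::real_normed_vector) \<Rightarrow> bool" where
  "Ck_on 0 S f \<longleftrightarrow> continuous_on S f"
| "Ck_on (Suc k) S f \<longleftrightarrow>
     (\<forall>x\<in>S. f differentiable (at x)) \<and> (\<forall>v. Ck_on k S (\<lambda>x. frechet_derivative f (at x) v))"

definition smooth_on :: "'a set \<Rightarrow> ('a::fin_dim_inner \<Rightarrow> 'b::real_normed_vector) \<Rightarrow> bool" where
  "smooth_on S f \<longleftrightarrow> (\<forall>k. Ck_on k S f)"

section \<open>Smooth manifolds\<close>

text \<open>
  A chart is a pair of a domain and a map; the values of the map outside the domain are irrelevant.
  The underlying set of a manifold is the union of the chart domains, topologised as a subspace of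
  the ambient type.
\<close>

type_synonym ('p, 'e) chart = "'p set \<times> ('p \<Rightarrow> 'e)"
type_synonym ('p, 'e) atlas = "('p, 'e) chart set"

definition carrier_of :: "('p, 'e) atlas \<Rightarrow> 'p set" where
  "carrier_of A = \<Union> (fst ` A)"

definition chart_image :: "('p, 'e) chart \<Rightarrow> 'e set" where
  "chart_image c = snd c ` fst c"

definition chart_inv :: "('p, 'e) chart \<Rightarrow> 'e \<Rightarrow> 'p" where
  "chart_inv c = inv_into (fst c) (snd c)"

definition in_charts :: "('p, 'e) chart \<Rightarrow> ('q, 'h) chart \<Rightarrow> ('p \<Rightarrow> 'q) \<Rightarrow> 'e \<Rightarrow> 'h" where
  "in_charts c c' f = snd c' \<circ> f \<circ> chart_inv c"

definition chart_deriv ::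
  "('p, 'e::real_normed_vector) chart \<Rightarrow> ('q, 'h::real_normed_vector) chart \<Rightarrow> ('p \<Rightarrow> 'q) \<Rightarrow> 'e \<Rightarrow> 'e \<Rightarrow> 'h" where
  "chart_deriv c c' f y = frechet_derivative (in_charts c c' f) (at y)"

definition smooth_manifold ::
  "('p::{t2_space, second_countable_topology}, 'e::fin_dim_inner) atlas \<Rightarrow> bool" where
  "smooth_manifold A \<longleftrightarrow>
     (\<forall>c\<in>A. openin (top_of_set (carrier_of A)) (fst c) \<and> open (chart_image c) \<and>
            homeomorphism (fst c) (chart_image c) (snd c) (chart_inv c)) \<and>
     (\<forall>c\<in>A. \<forall>c'\<in>A. smooth_on (snd c ` (fst c \<inter> fst c')) (in_charts c c' id))"

definition euclidean_atlas :: "('e, 'e) atlas" where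
  "euclidean_atlas = {(UNIV, id)}"

definition restrict_atlas :: "'p set \<Rightarrow> ('p, 'e) atlas \<Rightarrow> ('p, 'e) atlas" where
  "restrict_atlas W A = (\<lambda>(U, \<phi>). (U \<inter> W, \<phi>)) ` A"

definition prod_atlas :: "('p, 'e) atlas \<Rightarrow> ('q, 'h) atlas \<Rightarrow> ('p \<times> 'q, 'e \<times> 'h) atlas" where
  "prod_atlas A A' = (\<lambda>((U, \<phi>), (V, \<psi>)). (U \<times> V, map_prod \<phi> \<psi>)) ` (A \<times> A')"

definition smooth_on_open ::
  "('p::topological_space, 'e::fin_dim_inner) atlas \<Rightarrow> ('q::topological_space, 'h::fin_dim_inner) atlas
     \<Rightarrow> 'p set \<Rightarrow> ('p \<Rightarrow> 'q) \<Rightarrow> bool" where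
  "smooth_on_open A A' W f \<longleftrightarrow>
     openin (top_of_set (carrier_of A)) W \<and> continuous_on W f \<and> f ` W \<subseteq> carrier_of A' \<and>
     (\<forall>c\<in>A. \<forall>c'\<in>A'. smooth_on (snd c ` {z \<in> fst c \<inter> W. f z \<in> fst c'}) (in_charts c c' f))"

text \<open>
  Smoothness of a map defined on an arbitrary subset \<open>S\<close> of a manifold means local extendability to
  smooth maps on open sets. On open \<open>S\<close> this is ordinary smoothness; on a codimension 0 submanifold
  with boundary it is smoothness in the sense of manifolds with boundary.
\<close>

definition smooth_map ::
  "('p::topological_space, 'e::fin_dim_inner) atlas \<Rightarrow> ('q::topological_space, 'h::fin_dim_inner) atlas
     \<Rightarrow> 'p set \<Rightarrow> ('p \<Rightarrow> 'q) \<Rightarrow> bool" where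
  "smooth_map A A' S f \<longleftrightarrow> S \<subseteq> carrier_of A \<and> f ` S \<subseteq> carrier_of A' \<and>
     (\<forall>z\<in>S. \<exists>W g. z \<in> W \<and> smooth_on_open A A' W g \<and> (\<forall>w\<in>S \<inter> W. g w = f w))"

definition diffeomorphism ::
  "('p::topological_space, 'e::fin_dim_inner) atlas \<Rightarrow> 'p set
     \<Rightarrow> ('q::topological_space, 'h::fin_dim_inner) atlas \<Rightarrow> 'q set \<Rightarrow> ('p \<Rightarrow> 'q) \<Rightarrow> bool" where
  "diffeomorphism A S A' S' f \<longleftrightarrow>
     bij_betw f S S' \<and> smooth_map A A' S f \<and> smooth_map A' A S' (inv_into S f)"

text \<open>
  The smooth structure induced on a subset \<open>S\<close> of a manifold: all diffeomorphisms from relatively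
  open subsets of \<open>S\<close> to open subsets of the model space. If \<open>S\<close> is an embedded submanifold of the
  dimension of the model space, this is its maximal atlas.
\<close>

definition submanifold_atlas ::
  "('p::topological_space, 'e::fin_dim_inner) atlas \<Rightarrow> 'p set \<Rightarrow> ('p, 'h::fin_dim_inner) atlas" where
  "submanifold_atlas A S = {c. openin (top_of_set S) (fst c) \<and> open (chart_image c) \<and>
     diffeomorphism A (fst c) euclidean_atlas (chart_image c) (snd c)}"

text \<open>\<open>M\<close> is a codimension 0 smooth submanifold with boundary \<open>D\<close>.\<close>

definition submanifold_with_boundary ::
  "('p::topological_space, 'e::fin_dim_inner) atlas \<Rightarrow> 'p set \<Rightarrow> 'p set \<Rightarrow> bool" where
  "submanifold_with_boundary A M D \<longleftrightarrow> D \<subseteq> M \<and> M \<subseteq> carrier_of A \<and>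
     (\<forall>z\<in>M - D. \<exists>W. openin (top_of_set (carrier_of A)) W \<and> z \<in> W \<and> W \<subseteq> M) \<and>
     (\<forall>z\<in>D. \<exists>(c :: ('p, 'e) chart) e. z \<in> fst c \<and> openin (top_of_set (carrier_of A)) (fst c) \<and>
        open (chart_image c) \<and> diffeomorphism A (fst c) euclidean_atlas (chart_image c) (snd c) \<and>
        e \<noteq> 0 \<and>
        snd c ` (fst c \<inter> M) = chart_image c \<inter> {y. 0 \<le> inner e y} \<and>
        snd c ` (fst c \<inter> D) = chart_image c \<inter> {y. inner e y = 0})"

section \<open>Differential forms\<close>

text \<open>
  A form is a family of forms on the chart images, compatible with the coordinate changes.
  Forms of all degrees are treated together: the value of a (possibly inhomogeneous) form at a point
  is a function on lists of vectors, whose restriction to lists of length \<open>r\<close> is the component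
  of degree \<open>r\<close>. Components of degree larger than the dimension vanish automatically.
  Forms are normalised to be 0 outside of the chart images, so that equality is equality of functions.
\<close>

type_synonym ('p, 'e) form = "('p, 'e) chart \<Rightarrow> 'e \<Rightarrow> 'e list \<Rightarrow> real"

definition alternating :: "('e::real_vector list \<Rightarrow> real) \<Rightarrow> bool" where
  "alternating a \<longleftrightarrow> (\<forall>us ws. linear (\<lambda>v. a (us @ v # ws))) \<and> (\<forall>vs. \<not> distinct vs \<longrightarrow> a vs = 0)"

definition forms :: "('p, 'e::fin_dim_inner) atlas \<Rightarrow> ('p, 'e) form set" where
  "forms A = {\<omega>.
     (\<forall>c y vs. \<not> (c \<in> A \<and> y \<in> chart_image c) \<longrightarrow> \<omega> c y vs = 0) \<and>
     (\<forall>c\<in>A. \<forall>y\<in>chart_image c. alternating (\<omega> c y)) \<and>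
     (\<forall>c\<in>A. \<forall>vs. smooth_on (chart_image c) (\<lambda>y. \<omega> c y vs)) \<and>
     (\<forall>c\<in>A. \<forall>c'\<in>A. \<forall>z\<in>fst c \<inter> fst c'. \<forall>vs.
        \<omega> c (snd c z) vs = \<omega> c' (snd c' z) (map (chart_deriv c c' id (snd c z)) vs))}"

definition form_scale :: "real \<Rightarrow> ('p, 'e) form \<Rightarrow> ('p, 'e) form" where
  "form_scale a \<omega> = (\<lambda>c y vs. a * \<omega> c y vs)"

definition form_component :: "nat \<Rightarrow> ('p, 'e) form \<Rightarrow> ('p, 'e) form" where
  "form_component r \<omega> = (\<lambda>c y vs. if length vs = r then \<omega> c y vs else 0)"

definition homogeneous :: "nat \<Rightarrow> ('p, 'e) form \<Rightarrow> bool" where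
  "homogeneous r \<omega> \<longleftrightarrow> form_component r \<omega> = \<omega>"

text \<open>
  The wedge product as a sum over shuffles: \<open>S\<close> is the set of positions of the arguments
  that are passed to the first factor.
\<close>

definition shuffle_sign :: "nat \<Rightarrow> nat set \<Rightarrow> real" where
  "shuffle_sign k S = (-1) ^ card {(i, j). i \<in> S \<and> j \<in> {..<k} - S \<and> j < i}"

definition wedge :: "('p, 'e) form \<Rightarrow> ('p, 'e) form \<Rightarrow> ('p, 'e) form" where
  "wedge \<omega> \<eta> = (\<lambda>c y vs. \<Sum>S\<in>Pow {..<length vs}.
     shuffle_sign (length vs) S * \<omega> c y (nths vs S) * \<eta> c y (nths vs (- S)))"

text \<open>The exterior derivative \<open>d\<omega>(v\<^sub>0,\<dots>,v\<^sub>k) = \<Sum>\<^sub>i (-1)\<^sup>i D\<^bsub>v\<^sub>i\<^esub> \<omega>(v\<^sub>0,\<dots>,v\<^sub>i omitted,\<dots>,v\<^sub>k)\<close>, chart by chart.\<close>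

definition ext_d :: "('p, 'e::fin_dim_inner) atlas \<Rightarrow> ('p, 'e) form \<Rightarrow> ('p, 'e) form" where
  "ext_d A \<omega> = (\<lambda>c y vs. if c \<in> A \<and> y \<in> chart_image c then
       (\<Sum>i<length vs. (-1) ^ i *
          frechet_derivative (\<lambda>x. \<omega> c x (take i vs @ drop (Suc i) vs)) (at y) (vs ! i))
     else 0)"

text \<open>
  The pullback along \<open>f\<close> from the manifold \<open>A'\<close> to the manifold \<open>A\<close>. By compatibility of \<open>\<omega>\<close>, the
  choice of the chart around \<open>f z\<close> does not matter.
\<close>

definition pullback ::
  "('p, 'e::fin_dim_inner) atlas \<Rightarrow> ('q, 'h::fin_dim_inner) atlas \<Rightarrow> ('p \<Rightarrow> 'q) \<Rightarrow> ('q, 'h) form \<Rightarrow> ('p, 'e) form" where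
  "pullback A A' f \<omega> = (\<lambda>c y vs. if c \<in> A \<and> y \<in> chart_image c then
       (let z = chart_inv c y; c' = (SOME c'. c' \<in> A' \<and> f z \<in> fst c')
        in \<omega> c' (snd c' (f z)) (map (chart_deriv c c' f y) vs))
     else 0)"

definition sub_dga :: "('p, 'e::fin_dim_inner) atlas \<Rightarrow> ('p, 'e) form set \<Rightarrow> bool" where
  "sub_dga A C \<longleftrightarrow> C \<subseteq> forms A \<and>
     0 \<in> C \<and> (\<forall>\<omega>\<in>C. \<forall>\<eta>\<in>C. \<omega> + \<eta> \<in> C) \<and> (\<forall>a. \<forall>\<omega>\<in>C. form_scale a \<omega> \<in> C) \<and>
     (\<forall>\<omega>\<in>C. \<forall>r. form_component r \<omega> \<in> C) \<and>
     (\<forall>\<omega>\<in>C. ext_d A \<omega> \<in> C) \<and>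
     (\<forall>\<omega>\<in>C. \<forall>\<eta>\<in>C. wedge \<omega> \<eta> \<in> C)"

section \<open>Cohomology of complexes of forms\<close>

definition cocycles :: "('p, 'e::fin_dim_inner) atlas \<Rightarrow> ('p, 'e) form set \<Rightarrow> nat \<Rightarrow> ('p, 'e) form set" where
  "cocycles A C r = {\<omega> \<in> C. homogeneous r \<omega> \<and> ext_d A \<omega> = 0}"

definition coboundaries :: "('p, 'e::fin_dim_inner) atlas \<Rightarrow> ('p, 'e) form set \<Rightarrow> nat \<Rightarrow> ('p, 'e) form set" where
  "coboundaries A C r = (case r of 0 \<Rightarrow> {0} | Suc q \<Rightarrow> ext_d A ` {\<theta> \<in> C. homogeneous q \<theta>})"

definition coh_class ::
  "('p, 'e::fin_dim_inner) atlas \<Rightarrow> ('p, 'e) form set \<Rightarrow> nat \<Rightarrow> ('p, 'e) form \<Rightarrow> ('p, 'e) form set" where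
  "coh_class A C r \<omega> = \<omega> +o coboundaries A C r"

definition cohomology :: "('p, 'e::fin_dim_inner) atlas \<Rightarrow> ('p, 'e) form set \<Rightarrow> nat \<Rightarrow> ('p, 'e) form set set" where
  "cohomology A C r = coh_class A C r ` cocycles A C r"

text \<open>
  Vector space operations on the quotient: classes are cosets, the sum of classes is the
  elementwise sum, and \<open>a [\<omega>] = [a \<omega>]\<close>.
\<close>

definition coh_scale ::
  "('p, 'e::fin_dim_inner) atlas \<Rightarrow> ('p, 'e) form set \<Rightarrow> nat \<Rightarrow> real \<Rightarrow> ('p, 'e) form set \<Rightarrow> ('p, 'e) form set" where
  "coh_scale A C r a x = form_scale a ` x + coboundaries A C r"

definition coh_bilinear ::
  "('p, 'e::fin_dim_inner) atlas \<Rightarrow> ('p, 'e) form set \<Rightarrow> nat \<Rightarrow> nat \<Rightarrow> nat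
     \<Rightarrow> (('p, 'e) form set \<Rightarrow> ('p, 'e) form set \<Rightarrow> ('p, 'e) form set) \<Rightarrow> bool" where
  "coh_bilinear A C r s t f \<longleftrightarrow>
     (\<forall>x\<in>cohomology A C r. \<forall>y\<in>cohomology A C s. f x y \<in> cohomology A C t) \<and>
     (\<forall>x\<in>cohomology A C r. \<forall>x'\<in>cohomology A C r. \<forall>y\<in>cohomology A C s. f (x + x') y = f x y + f x' y) \<and>
     (\<forall>x\<in>cohomology A C r. \<forall>y\<in>cohomology A C s. \<forall>y'\<in>cohomology A C s. f x (y + y') = f x y + f x y') \<and>
     (\<forall>a. \<forall>x\<in>cohomology A C r. \<forall>y\<in>cohomology A C s.
        f (coh_scale A C r a x) y = coh_scale A C t a (f x y) \<and>
        f x (coh_scale A C s a y) = coh_scale A C t a (f x y))"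

section \<open>Oriented Riemannian manifolds\<close>

type_synonym ('p, 'e) metric = "('p, 'e) chart \<Rightarrow> 'e \<Rightarrow> 'e \<Rightarrow> 'e \<Rightarrow> real"

definition riemannian_metric :: "('p, 'e::fin_dim_inner) atlas \<Rightarrow> ('p, 'e) metric \<Rightarrow> bool" where
  "riemannian_metric A G \<longleftrightarrow>
     (\<forall>c\<in>A. \<forall>y\<in>chart_image c. (\<forall>v. linear (G c y v)) \<and> (\<forall>v w. G c y v w = G c y w v) \<and>
        (\<forall>v. v \<noteq> 0 \<longrightarrow> 0 < G c y v v)) \<and>
     (\<forall>c\<in>A. \<forall>v w. smooth_on (chart_image c) (\<lambda>y. G c y v w)) \<and>
     (\<forall>c\<in>A. \<forall>c'\<in>A. \<forall>z\<in>fst c \<inter> fst c'. \<forall>v w. G c (snd c z) v w =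
        G c' (snd c' z) (chart_deriv c c' id (snd c z) v) (chart_deriv c c' id (snd c z) w))"

definition isometry ::
  "('p::topological_space, 'e::fin_dim_inner) atlas \<Rightarrow> ('p, 'e) metric \<Rightarrow> ('p \<Rightarrow> 'p) \<Rightarrow> bool" where
  "isometry A G f \<longleftrightarrow> diffeomorphism A (carrier_of A) A (carrier_of A) f \<and>
     (\<forall>c\<in>A. \<forall>c'\<in>A. \<forall>z\<in>fst c. f z \<in> fst c' \<longrightarrow> (\<forall>v w. G c (snd c z) v w =
        G c' (snd c' (f z)) (chart_deriv c c' f (snd c z) v) (chart_deriv c c' f (snd c z) w)))"

text \<open>
  An orientation is given by an oriented atlas. The model space \<open>\<real>\<^sup>m\<close> is oriented by its standard
  basis, ordered by the linear order on the index type; accordingly, the frame \<open>es\<close> is compared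
  with the list of standard basis vectors in increasing order of the indices.
\<close>

definition oriented_atlas :: "('p, real^'m::finite) atlas \<Rightarrow> bool" where
  "oriented_atlas A \<longleftrightarrow>
     (\<forall>c\<in>A. \<forall>c'\<in>A. \<forall>z\<in>fst c \<inter> fst c'. 0 < det (matrix (chart_deriv c c' id (snd c z))))"

definition oriented_orthonormal_frame ::
  "(real^'m::{finite,linorder} \<Rightarrow> real^'m::{finite,linorder} \<Rightarrow> real) \<Rightarrow> (real^'m::{finite,linorder}) list \<Rightarrow> bool" where
  "oriented_orthonormal_frame g es \<longleftrightarrow> length es = CARD('m) \<and>
     (\<forall>i<CARD('m). \<forall>j<CARD('m). g (es ! i) (es ! j) = (if i = j then 1 else 0)) \<and>
     0 < det (\<chi> i. es ! card {..<i})"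

text \<open>
  The Hodge star. For a positively oriented orthonormal frame \<open>e\<^sub>1,\<dots>,e\<^sub>m\<close>, it sends the wedge product
  of the dual covectors with indices \<open>\<sigma>1,\<dots>,\<sigma>r\<close> to \<open>sign \<sigma>\<close> times the wedge product of those with
  indices \<open>\<sigma>(r+1),\<dots>,\<sigma>m\<close>, for every permutation \<open>\<sigma>\<close>. Hence for \<open>\<beta>\<close> of degree \<open>r\<close>
  \<open>(*\<beta>)(v\<^sub>1,\<dots>,v\<^bsub>m-r\<^esub>) = 1/r! \<Sum>\<^sub>\<sigma> sign \<sigma> \<beta>(e\<^bsub>\<sigma>1\<^esub>,\<dots>,e\<^bsub>\<sigma>r\<^esub>) \<Prod>\<^sub>j \<langle>e\<^bsub>\<sigma>(r+j)\<^esub>, v\<^sub>j\<rangle>\<close>,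
  where \<open>1/r!\<close> accounts for the reorderings of \<open>\<sigma>1,\<dots>,\<sigma>r\<close>. The result does not depend on the frame.
\<close>

definition hodge_star ::
  "('p, real^'m::{finite,linorder}) metric \<Rightarrow> ('p, real^'m::{finite,linorder}) form \<Rightarrow> ('p, real^'m::{finite,linorder}) form" where
  "hodge_star G \<beta> = (\<lambda>c y vs. if length vs \<le> CARD('m) then
       (let r = CARD('m) - length vs;
            es = (SOME es. oriented_orthonormal_frame (G c y) es)
        in (\<Sum>\<sigma> | \<sigma> permutes {..<CARD('m)}. of_int (sign \<sigma>) *
              \<beta> c y (map (\<lambda>i. es ! \<sigma> i) [0..<r]) *
              (\<Prod>j<length vs. G c y (es ! \<sigma> (r + j)) (vs ! j))) / fact r)
     else 0)"

text \<open>\<open>d\<^sup>*\<close> on forms of degree \<open>r\<close>.\<close>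

definition codifferential ::
  "('p, real^'m::{finite,linorder}) atlas \<Rightarrow> ('p, real^'m::{finite,linorder}) metric \<Rightarrow> nat \<Rightarrow> ('p, real^'m::{finite,linorder}) form \<Rightarrow> ('p, real^'m::{finite,linorder}) form" where
  "codifferential A G r \<beta> =
     form_scale ((-1) ^ (CARD('m) * (r + 1) + 1)) (hodge_star G (ext_d A (hodge_star G \<beta>)))"

text \<open>The cotruncation \<open>\<tau>\<^bsub>\<ge>k\<^esub>\<Omega>(F)\<close>.\<close>

definition cotruncation ::
  "('p, real^'m::{finite,linorder}) atlas \<Rightarrow> ('p, real^'m::{finite,linorder}) metric \<Rightarrow> nat \<Rightarrow> ('p, real^'m::{finite,linorder}) form set" where
  "cotruncation A G k = {\<gamma> \<in> forms A.
     (\<forall>r<k. form_component r \<gamma> = 0) \<and> codifferential A G k (form_component k \<gamma>) = 0}"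

section \<open>Two-strata pseudomanifolds\<close>

text \<open>
  The cone \<open>cF = (F \<times> [0,2)) / (F \<times> 0)\<close> with the quotient topology; its points are the
  equivalence classes.
\<close>

definition cone_point :: "'f set \<Rightarrow> 'f \<times> real \<Rightarrow> ('f \<times> real) set" where
  "cone_point F z = (if snd z = 0 then F \<times> {0} else {z})"

definition open_cone :: "'f::topological_space set \<Rightarrow> ('f \<times> real) set topology" where
  "open_cone F = topology (\<lambda>V. V \<subseteq> cone_point F ` (F \<times> {0..<2}) \<and>
     openin (top_of_set (F \<times> {0..<2})) {z \<in> F \<times> {0..<2}. cone_point F z \<in> V})"

text \<open>
  The space \<open>X\<close> is the type \<open>'x\<close>; \<open>\<Sigma>\<close> and the link \<open>F\<close> are the carriers of their atlases.
  The fields from \<open>link_metric\<close> on are the data of the flat isometric structure and of the collar.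
\<close>

record ('x, 'n, 'b, 'f, 'm, 'i) pseudomanifold =
  regular_atlas :: "('x, real^'n::finite) atlas"
  stratum_atlas :: "('x, 'b) atlas"
  link_atlas :: "('f, real^'m::finite) atlas"
  tube :: "'x set"
  tube_retraction :: "'x \<Rightarrow> 'x"
  radius :: "'x \<Rightarrow> real"
  link_metric :: "('f, real^'m::finite) metric"
  cover_index :: "'i set"
  cover :: "'i \<Rightarrow> 'x set"
  trivialization :: "'i \<Rightarrow> 'x \<Rightarrow> 'x \<times> 'f"
  collar :: "real \<times> 'x \<Rightarrow> 'x"

definition stratum :: "('x, 'n::finite, 'b, 'f, 'm::finite, 'i) pseudomanifold \<Rightarrow> 'x set" where
  "stratum X = carrier_of (stratum_atlas X)"

definition link :: "('x, 'n::finite, 'b, 'f, 'm::finite, 'i) pseudomanifold \<Rightarrow> 'f set" where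
  "link X = carrier_of (link_atlas X)"

text \<open>\<open>blowup\<close> is \<open>M = X - \<rho>\<^sup>-\<^sup>1([0,1))\<close>, and \<open>link_total\<close> is its boundary \<open>\<partial>M = \<rho>\<^sup>-\<^sup>1(1)\<close>.\<close>

definition blowup :: "('x, 'n::finite, 'b, 'f, 'm::finite, 'i) pseudomanifold \<Rightarrow> 'x set" where
  "blowup X = UNIV - {z \<in> tube X. radius X z \<in> {0..<1}}"

definition link_total :: "('x, 'n::finite, 'b, 'f, 'm::finite, 'i) pseudomanifold \<Rightarrow> 'x set" where
  "link_total X = {z \<in> tube X. radius X z = 1}"

definition link_preimage :: "('x, 'n::finite, 'b, 'f, 'm::finite, 'i) pseudomanifold \<Rightarrow> 'x set \<Rightarrow> 'x set" where
  "link_preimage X U = {z \<in> link_total X. tube_retraction X z \<in> U}"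

text \<open>\<open>\<partial>M\<close> has dimension \<open>b + m\<close>; its charts take values in \<open>\<real>\<^sup>b \<times> \<real>\<^sup>m\<close>.\<close>

definition link_total_atlas ::
  "('x::topological_space, 'n::finite, 'b::fin_dim_inner, 'f, 'm::finite, 'i) pseudomanifold
     \<Rightarrow> ('x, 'b \<times> (real^'m::finite)) atlas" where
  "link_total_atlas X = submanifold_atlas (regular_atlas X) (link_total X)"

definition interior_atlas ::
  "('x, 'n::finite, 'b, 'f, 'm::finite, 'i) pseudomanifold \<Rightarrow> ('x, real^'n::finite) atlas" where
  "interior_atlas X = restrict_atlas (blowup X - link_total X) (regular_atlas X)"

text \<open>
  \<open>H\<close> is a bundle atlas for \<open>\<pi>\<^sub>T\<close> with fibre \<open>cF\<close>, in which \<open>\<rho>\<close> is the cone coordinate and the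
  transition functions are \<open>(t, [x, s]) \<mapsto> (t, [g t x, s])\<close> for diffeomorphisms \<open>g t\<close> of \<open>F\<close>
  depending smoothly on \<open>t\<close>.
\<close>

definition cone_bundle ::
  "('x::topological_space, 'n::finite, 'b::fin_dim_inner, 'f::topological_space, 'm::finite, 'i) pseudomanifold
     \<Rightarrow> ('x set \<times> ('x \<Rightarrow> 'x \<times> ('f \<times> real) set)) set \<Rightarrow> bool" where
  "cone_bundle X H \<longleftrightarrow>
     \<Union> (fst ` H) = stratum X \<and>
     (\<forall>(V, h)\<in>H. openin (top_of_set (stratum X)) V \<and>
        homeomorphic_map (top_of_set {z \<in> tube X. tube_retraction X z \<in> V})
          (prod_topology (top_of_set V) (open_cone (link X))) h \<and>
        (\<forall>z\<in>tube X. tube_retraction X z \<in> V \<longrightarrow> fst (h z) = tube_retraction X z \<and>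
           (\<exists>x\<in>link X. snd (h z) = cone_point (link X) (x, radius X z)))) \<and>
     (\<forall>(V, h)\<in>H. \<forall>(V', h')\<in>H. \<exists>g.
        smooth_map (prod_atlas (stratum_atlas X) (link_atlas X)) (link_atlas X)
          ((V \<inter> V') \<times> link X) (\<lambda>(t, x). g t x) \<and>
        (\<forall>t\<in>V \<inter> V'. diffeomorphism (link_atlas X) (link X) (link_atlas X) (link X) (g t)) \<and>
        (\<forall>z\<in>tube X. \<forall>t\<in>V \<inter> V'. \<forall>x\<in>link X. \<forall>s\<in>{0..<2}.
           h z = (t, cone_point (link X) (x, s)) \<and> tube_retraction X z = t \<longrightarrow>
           h' z = (t, cone_point (link X) (g t x, s))))"

text \<open>
  The last conjunct says that \<open>M\<close> is a smooth manifold with boundary \<open>\<rho>\<^sup>-\<^sup>1(1)\<close>; the cone bundle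
  charts are only required to be homeomorphisms. The dimension of the link is positive, since
  \<open>'m\<close> is nonempty.
\<close>

definition two_strata_pseudomanifold ::
  "('x::{t2_space,second_countable_topology}, 'n::finite, 'b::fin_dim_inner,
    'f::{t2_space,second_countable_topology}, 'm::finite, 'i) pseudomanifold \<Rightarrow> bool" where
  "two_strata_pseudomanifold X \<longleftrightarrow>
     CARD('n) = dim (UNIV :: 'b set) + CARD('m) + 1 \<and>
     compact (UNIV :: 'x set) \<and>
     closed (stratum X) \<and> connected (stratum X) \<and> smooth_manifold (stratum_atlas X) \<and>
     carrier_of (regular_atlas X) = - stratum X \<and> smooth_manifold (regular_atlas X) \<and>
     closure (- stratum X) = UNIV \<and>
     smooth_manifold (link_atlas X) \<and> compact (link X) \<and>
     open (tube X) \<and> stratum X \<subseteq> tube X \<and>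
     retraction (tube X) (stratum X) (tube_retraction X) \<and>
     continuous_on (tube X) (radius X) \<and> radius X ` tube X \<subseteq> {0..<2} \<and>
     {z \<in> tube X. radius X z = 0} = stratum X \<and>
     smooth_map (regular_atlas X) (stratum_atlas X) (tube X - stratum X) (tube_retraction X) \<and>
     smooth_map (regular_atlas X) euclidean_atlas (tube X - stratum X) (radius X) \<and>
     (\<exists>H. cone_bundle X H) \<and>
     submanifold_with_boundary (regular_atlas X) (blowup X) (link_total X)"

definition flat_isometric_link_bundle ::
  "('x::topological_space, 'n::finite, 'b::fin_dim_inner, 'f::topological_space, 'm::finite, 'i) pseudomanifold
     \<Rightarrow> bool" where
  "flat_isometric_link_bundle X \<longleftrightarrow>
     oriented_atlas (link_atlas X) \<and> riemannian_metric (link_atlas X) (link_metric X) \<and>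
     finite (cover_index X) \<and> (\<Union>\<alpha>\<in>cover_index X. cover X \<alpha>) = stratum X \<and>
     (\<forall>\<alpha>\<in>cover_index X. openin (top_of_set (stratum X)) (cover X \<alpha>)) \<and>
     (\<forall>J. J \<subseteq> cover_index X \<and> J \<noteq> {} \<and> (\<Inter>\<alpha>\<in>J. cover X \<alpha>) \<noteq> {} \<longrightarrow>
        (\<exists>f. diffeomorphism (stratum_atlas X) (\<Inter>\<alpha>\<in>J. cover X \<alpha>)
               (euclidean_atlas :: ('b, 'b) atlas) UNIV f)) \<and>
     (\<forall>\<alpha>\<in>cover_index X.
        diffeomorphism (link_total_atlas X) (link_preimage X (cover X \<alpha>))
          (prod_atlas (stratum_atlas X) (link_atlas X)) (cover X \<alpha> \<times> link X) (trivialization X \<alpha>) \<and>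
        (\<forall>z\<in>link_preimage X (cover X \<alpha>). fst (trivialization X \<alpha> z) = tube_retraction X z)) \<and>
     (\<forall>\<alpha>\<in>cover_index X. \<forall>\<beta>\<in>cover_index X. \<exists>g. isometry (link_atlas X) (link_metric X) g \<and>
        (\<forall>t\<in>cover X \<alpha> \<inter> cover X \<beta>. \<forall>x\<in>link X.
           trivialization X \<beta> (inv_into (link_preimage X (cover X \<alpha>)) (trivialization X \<alpha>) (t, x))
             = (t, g x)))"

definition smooth_collar ::
  "('x::topological_space, 'n::finite, 'b::fin_dim_inner, 'f, 'm::finite, 'i) pseudomanifold \<Rightarrow> bool" where
  "smooth_collar X \<longleftrightarrow> (\<exists>U. openin (top_of_set (blowup X)) U \<and>
     diffeomorphism (prod_atlas euclidean_atlas (link_total_atlas X)) ({-2<..1} \<times> link_total X)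
       (regular_atlas X) U (collar X)) \<and>
     (\<forall>x\<in>link_total X. collar X (1, x) = x)"

section \<open>Forms defining intersection space cohomology\<close>

definition ft_forms ::
  "('x::topological_space, 'n::finite, 'b::fin_dim_inner, 'f, 'm::{finite,linorder}, 'i) pseudomanifold
     \<Rightarrow> nat \<Rightarrow> ('x, 'b \<times> (real^'m::{finite,linorder})) form set" where
  "ft_forms X k = {\<omega> \<in> forms (link_total_atlas X). \<forall>\<alpha>\<in>cover_index X.
     (let U = restrict_atlas (cover X \<alpha>) (stratum_atlas X);
          P = restrict_atlas (link_preimage X (cover X \<alpha>)) (link_total_atlas X);
          Q = prod_atlas U (link_atlas X)
      in \<exists>(l::nat) \<eta> \<gamma>. (\<forall>j<l. \<eta> j \<in> forms U \<and> \<gamma> j \<in> cotruncation (link_atlas X) (link_metric X) k) \<and>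
           pullback P (link_total_atlas X) id \<omega> =
           pullback P Q (trivialization X \<alpha>)
             (\<Sum>j<l. wedge (pullback Q U fst (\<eta> j)) (pullback Q (link_atlas X) snd (\<gamma> j))))}"

definition perversity :: "(nat \<Rightarrow> nat) \<Rightarrow> bool" where
  "perversity p \<longleftrightarrow> p 2 = 0 \<and> (\<forall>k\<ge>2. p k \<le> p (k + 1) \<and> p (k + 1) \<le> p k + 1)"

text \<open>
  \<open>\<Omega>I\<^bsub>p\<^esub>(N)\<close>; \<open>HI\<^bsub>p\<^esub>\<^sup>r(X)\<close> is \<open>cohomology (interior_atlas X) (OmegaI X p) r\<close>.
  The subtraction of natural numbers does not truncate, since \<open>p (m + 1) \<le> m - 1\<close> for a perversity.
\<close>

definition OmegaI ::
  "('x::topological_space, 'n::finite, 'b::fin_dim_inner, 'f, 'm::{finite,linorder}, 'i) pseudomanifold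
     \<Rightarrow> (nat \<Rightarrow> nat) \<Rightarrow> ('x, real^'n::finite) form set" where
  "OmegaI X p = {\<omega> \<in> forms (interior_atlas X).
     (let E = prod_atlas (restrict_atlas {-1<..<1} euclidean_atlas) (link_total_atlas X)
      in \<exists>\<eta>\<in>ft_forms X (CARD('m) - p (CARD('m) + 1)).
           pullback E (interior_atlas X) (collar X) \<omega> = pullback E (link_total_atlas X) snd \<eta>)}"

end

theory Submission
  imports Defs
begin

text \<open>
  Pullback, \<open>d\<close> and \<open>\<and>\<close> are compatible, so the preimage under a pullback of the pullback of a
  sub-DGA is a sub-DGA. Both \<open>\<Omega>I\<close> and the multiplicatively structured forms are of this type; it
  remains to treat the sums of \<open>\<pi>\<^sub>1\<^sup>*\<eta> \<and> \<pi>\<^sub>2\<^sup>*\<gamma>\<close> with \<open>\<gamma> \<in> \<tau>\<^bsub>\<ge>K\<^esub>\<Omega>(F)\<close>. A perversity satisfies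
  \<open>p (m + 1) \<le> m - 1\<close>, hence \<open>K \<ge> 1\<close>. Therefore \<open>\<gamma> \<and> \<gamma>'\<close> has no components of degree \<open>\<le> K\<close>, and
  the component of degree \<open>K\<close> of \<open>d\<gamma>\<close> vanishes because \<open>\<gamma>\<close> has none of degree \<open>K - 1\<close>: the
  coclosedness condition in degree \<open>K\<close> holds trivially for products and differentials, and no
  Hodge theory is needed. The cup product exists by the Leibniz rule.
\<close>


subsection \<open>Calculus on finite-dimensional spaces\<close>

text \<open>Forms carry no fixed degree, so signs (-1)^deg cannot appear as scalars. They are
  carried by an involution on functions of argument lists (\<open>twist\<close>,
  \<open>form_twist\<close>), and graded commutativity is used only after one factor has been split
  into its even and odd parts. This matters when (\<eta> \<and> \<gamma>) \<and> (\<eta>' \<and>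
  \<gamma>') is regrouped into base forms and fibre forms.

  Pointwise identities are inductions on the argument list: one contracts with the first vector,
  using that the interior product is an antiderivation and Cartan's formula for constant vector
  fields. Coordinate changes are treated as chart expressions of \<open>id\<close>, so one local
  computation shows both that d\<omega> is a form and that d commutes with pullback.

  Membership in the subcomplexes is a relation between two pullbacks to a third manifold. Every
  operation is performed on the witness as well, and no pullback is inverted. The bound on p (m + 1)
  comes from p 2 = 0 and growth by at most one per step.\<close>

lemma ex_orthogonal_basis:
  "\<exists>C :: 'a::fin_dim_inner set. finite C \<and> (\<forall>x. x = (\<Sum>c\<in>C. (inner x c / inner c c) *\<^sub>R c))"
proof -
  obtain S :: "'a set" where S: "finite S" "span S = UNIV"
    using finite_spanning_set by blast
  obtain C :: "'a set" where C: "finite C" "span C = UNIV" "pairwise orthogonal C"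
    using basis_orthogonal[OF S(1)] S(2) by metis
  have "x = (\<Sum>c\<in>C. (inner x c / inner c c) *\<^sub>R c)" for x
  proof -
    have "x \<in> span C" using C by simp
    then show ?thesis
    proof (induction rule: span_induct_alt)
      case base
      then show ?case by simp
    next
      case (step a u y)
      \<comment> \<open>A zero vector may occur in \<open>C\<close>; its summand is
        \<open>0\<close>, so the quotient by \<open>inner c c = 0\<close> does no harm.\<close>
      have "(\<Sum>c\<in>C. (inner u c / inner c c) *\<^sub>R c) = (\<Sum>c\<in>C. if c = u then u else 0)"
      proof (rule sum.cong)
        fix c assume "c \<in> C"
        then show "(inner u c / inner c c) *\<^sub>R c = (if c = u then u else 0)"
          using C(3) step(1) by (auto simp: pairwise_def orthogonal_def)
      qed simp
      also have "\<dots> = u" using C(1) step(1) by simp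
      finally have u: "(\<Sum>c\<in>C. (inner u c / inner c c) *\<^sub>R c) = u" .
      have "(\<Sum>c\<in>C. (inner (a *\<^sub>R u + y) c / inner c c) *\<^sub>R c) =
          a *\<^sub>R (\<Sum>c\<in>C. (inner u c / inner c c) *\<^sub>R c) + (\<Sum>c\<in>C. (inner y c / inner c c) *\<^sub>R c)"
        by (simp add: inner_add_left add_divide_distrib scaleR_left_distrib sum.distrib scaleR_right.sum)
      then show ?case using u step(2) by simp
    qed
  qed
  then show ?thesis using C(1) by blast
qed

text \<open>A finite set in which linear maps are expanded below. It is not normalised and may
  contain \<open>0\<close>; all that is used is finiteness and the expansion formula.\<close>

definition basis :: "'a::fin_dim_inner set" where
  "basis = (SOME C. finite C \<and> (\<forall>x. x = (\<Sum>c\<in>C. (inner x c / inner c c) *\<^sub>R c)))"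

definition coord :: "'a::fin_dim_inner \<Rightarrow> 'a \<Rightarrow> real" where
  "coord b x = inner x b / inner b b"

lemma finite_basis [simp]: "finite (basis :: 'a::fin_dim_inner set)"
  and basis_expansion: "(x :: 'a) = (\<Sum>b\<in>basis. coord b x *\<^sub>R b)"
  using someI_ex[OF ex_orthogonal_basis[where 'a='a]] unfolding basis_def coord_def by blast+

lemma coord_eqI:
  assumes "\<And>b. coord b x = coord b y"
  shows "x = y"
  using basis_expansion[of x] basis_expansion[of y] assms by (metis (no_types, lifting) sum.cong)

lemma bounded_linear_coord: "bounded_linear (coord b)"
  unfolding coord_def
  by (rule bounded_linear_compose[OF bounded_linear_divide bounded_linear_inner_left])

text \<open>The device for arguments that vary with a point: a linear expression in a moving vector
  becomes a finite sum of scalar functions times values at fixed vectors.\<close>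

lemma linear_basis_expansion:
  fixes f :: "'a::fin_dim_inner \<Rightarrow> 'b::real_vector"
  assumes "linear f"
  shows "f x = (\<Sum>b\<in>basis. coord b x *\<^sub>R f b)"
proof -
  have "f x = f (\<Sum>b\<in>basis. coord b x *\<^sub>R b)" using basis_expansion[of x] by simp
  also have "\<dots> = (\<Sum>b\<in>basis. coord b x *\<^sub>R f b)"
    using assms by (simp add: linear_sum linear_scale)
  finally show ?thesis .
qed

lemma has_frechet_derivative:
  "f differentiable (at x) \<Longrightarrow> (f has_derivative frechet_derivative f (at x)) (at x)"
  by (simp add: frechet_derivative_works)

lemma frechet_derivative_eqI:
  "(f has_derivative f') (at x) \<Longrightarrow> frechet_derivative f (at x) = f'"
  by (rule frechet_derivative_at[symmetric])

lemma has_derivative_cong_open: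
  assumes "open S" "x \<in> S" "\<And>y. y \<in> S \<Longrightarrow> f y = g y"
  shows "(f has_derivative f') (at x) \<longleftrightarrow> (g has_derivative f') (at x)"
  using assms by (metis has_derivative_transform_within_open)

lemma differentiable_cong_open:
  assumes "open S" "x \<in> S" "\<And>y. y \<in> S \<Longrightarrow> f y = g y"
  shows "f differentiable (at x) \<longleftrightarrow> g differentiable (at x)"
  using has_derivative_cong_open[OF assms] by (auto simp: differentiable_def)

lemma frechet_derivative_cong_open:
  assumes "open S" "x \<in> S" "\<And>y. y \<in> S \<Longrightarrow> f y = g y"
  shows "frechet_derivative f (at x) = frechet_derivative g (at x)"
  using has_derivative_cong_open[OF assms] by (simp add: frechet_derivative_def)

section \<open>Closure properties of \<open>Ck_on\<close> and \<open>smooth_on\<close>\<close>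

lemma Ck_on_cong:
  assumes "open S" "\<And>y. y \<in> S \<Longrightarrow> f y = g y"
  shows "Ck_on k S f \<longleftrightarrow> Ck_on k S g"
  using assms
proof (induction k arbitrary: f g)
  case 0
  then show ?case by (auto cong: continuous_on_cong)
next
  case (Suc k)
  have "Ck_on k S (\<lambda>x. frechet_derivative f (at x) v) \<longleftrightarrow> Ck_on k S (\<lambda>x. frechet_derivative g (at x) v)" for v
    by (rule Suc.IH[OF Suc.prems(1)]) (metis frechet_derivative_cong_open Suc.prems)
  moreover have "f differentiable (at x) \<longleftrightarrow> g differentiable (at x)" if "x \<in> S" for x
    by (rule differentiable_cong_open[OF Suc.prems(1) that Suc.prems(2)])
  ultimately show ?case by simp
qed

lemma Ck_on_subset: "Ck_on k T f \<Longrightarrow> S \<subseteq> T \<Longrightarrow> Ck_on k S f"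
proof (induction k arbitrary: f)
  case 0
  then show ?case by (auto intro: continuous_on_subset)
next
  case (Suc k)
  then show ?case by auto
qed

lemma Ck_on_SucD: "Ck_on (Suc k) S f \<Longrightarrow> Ck_on k S f"
proof (induction k arbitrary: f)
  case 0
  then show ?case
    by (auto intro!: continuous_at_imp_continuous_on differentiable_imp_continuous_within)
next
  case (Suc k)
  then show ?case by (metis Ck_on.simps(2))
qed

lemma Ck_on_const: "Ck_on k S (\<lambda>x. c)"
  by (induction k arbitrary: c) auto

lemma Ck_on_add: "open S \<Longrightarrow> Ck_on k S f \<Longrightarrow> Ck_on k S g \<Longrightarrow> Ck_on k S (\<lambda>x. f x + g x)"
proof (induction k arbitrary: f g)
  case 0
  then show ?case by (auto intro: continuous_intros)
next
  case (Suc k)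
  have "Ck_on k S (\<lambda>x. frechet_derivative (\<lambda>x. f x + g x) (at x) v)" for v
  proof (subst Ck_on_cong[OF Suc.prems(1)])
    fix x assume "x \<in> S"
    then show "frechet_derivative (\<lambda>x. f x + g x) (at x) v
        = frechet_derivative f (at x) v + frechet_derivative g (at x) v"
      using Suc.prems by (subst frechet_derivative_eqI[OF has_derivative_add]) (auto intro: has_frechet_derivative)
  qed (use Suc in auto)
  then show ?case using Suc.prems by (auto intro: differentiable_add)
qed

lemma Ck_on_linear:
  assumes "open S" "bounded_linear L" "Ck_on k S f"
  shows "Ck_on k S (\<lambda>x. L (f x))"
  using assms(3)
proof (induction k arbitrary: f)
  case 0
  then show ?case using assms(2) by (auto intro: linear_continuous_on_compose bounded_linear.continuous_on)
next
  case (Suc k)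
  have D: "((\<lambda>x. L (f x)) has_derivative (\<lambda>v. L (frechet_derivative f (at x) v))) (at x)" if "x \<in> S" for x
    using that Suc.prems by (intro bounded_linear.has_derivative[OF assms(2)] has_frechet_derivative) auto
  have "Ck_on k S (\<lambda>x. frechet_derivative (\<lambda>x. L (f x)) (at x) v)" for v
    by (subst Ck_on_cong[OF assms(1)]) (use Suc frechet_derivative_eqI[OF D] in auto)
  then show ?case using D by (auto simp: differentiable_def)
qed

text \<open>Differentiating a product leaves one factor undifferentiated, so the induction also uses
  the factors at one order lower; \<open>Ck_on_SucD\<close> provides this.\<close>

lemma Ck_on_scaleR:
  "open S \<Longrightarrow> Ck_on k S f \<Longrightarrow> Ck_on k S g \<Longrightarrow> Ck_on k S (\<lambda>x. f x *\<^sub>R g x)"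
proof (induction k arbitrary: f g)
  case 0
  then show ?case by (auto intro: continuous_intros)
next
  case (Suc k)
  have D: "((\<lambda>x. f x *\<^sub>R g x) has_derivative
      (\<lambda>v. f x *\<^sub>R frechet_derivative g (at x) v + frechet_derivative f (at x) v *\<^sub>R g x)) (at x)"
    if "x \<in> S" for x
    using that Suc.prems by (intro has_derivative_scaleR has_frechet_derivative) auto
  have "Ck_on k S (\<lambda>x. frechet_derivative (\<lambda>x. f x *\<^sub>R g x) (at x) v)" for v
  proof (subst Ck_on_cong[OF Suc.prems(1)])
    have "Ck_on k S f" "Ck_on k S g" using Suc.prems Ck_on_SucD by blast+
    then show "Ck_on k S (\<lambda>x. f x *\<^sub>R frechet_derivative g (at x) v + frechet_derivative f (at x) v *\<^sub>R g x)"
      using Suc.prems by (intro Ck_on_add Suc.IH) auto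
  qed (use frechet_derivative_eqI[OF D] in auto)
  then show ?case using D by (auto simp: differentiable_def)
qed

lemma Ck_on_sum:
  "open S \<Longrightarrow> (\<And>i. i \<in> I \<Longrightarrow> Ck_on k S (f i)) \<Longrightarrow> Ck_on k S (\<lambda>x. \<Sum>i\<in>I. f i x)"
  by (induction I rule: infinite_finite_induct) (auto intro: Ck_on_add Ck_on_const)

text \<open>The derivative of the composition is Dg(f x) applied to the moving vector Df(x) v, while
  the induction hypothesis covers y \<mapsto> Dg(y) b for fixed b. Expanding the moving vector in
  \<open>basis\<close> reduces one to the other.\<close>

lemma Ck_on_compose:
  fixes g :: "'b::fin_dim_inner \<Rightarrow> 'c::real_normed_vector"
  assumes "open S" "f ` S \<subseteq> T" "Ck_on k T g" "Ck_on k S f"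
  shows "Ck_on k S (\<lambda>x. g (f x))"
  using assms(3,4)
proof (induction k arbitrary: g)
  case 0
  then show ?case using assms by (auto intro: continuous_on_compose2)
next
  case (Suc k)
  have g: "g differentiable (at (f x))" if "x \<in> S" for x
    using that assms Suc.prems by auto
  have D: "((\<lambda>x. g (f x)) has_derivative
      (\<lambda>v. frechet_derivative g (at (f x)) (frechet_derivative f (at x) v))) (at x)"
    if "x \<in> S" for x
    by (rule has_derivative_compose; rule has_frechet_derivative) (use that Suc.prems g in auto)
  have E: "frechet_derivative g (at (f x)) w
      = (\<Sum>b\<in>basis. coord b w *\<^sub>R frechet_derivative g (at (f x)) b)" if "x \<in> S" for x w
    by (rule linear_basis_expansion[OF linear_frechet_derivative[OF g[OF that]]])
  have "Ck_on k S (\<lambda>x. frechet_derivative (\<lambda>x. g (f x)) (at x) v)" for v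
  proof (subst Ck_on_cong[OF assms(1)])
    show "Ck_on k S (\<lambda>x. \<Sum>b\<in>basis. coord b (frechet_derivative f (at x) v) *\<^sub>R
        frechet_derivative g (at (f x)) b)"
    proof (intro Ck_on_sum Ck_on_scaleR assms(1))
      fix b
      show "Ck_on k S (\<lambda>x. coord b (frechet_derivative f (at x) v))"
        by (rule Ck_on_linear[OF assms(1) bounded_linear_coord]) (use Suc.prems in auto)
      show "Ck_on k S (\<lambda>x. frechet_derivative g (at (f x)) b)"
        using Suc.prems(1) Ck_on_SucD[OF Suc.prems(2)]
        by (intro Suc.IH[of "\<lambda>y. frechet_derivative g (at y) b"]) auto
    qed
    show "frechet_derivative (\<lambda>x. g (f x)) (at x) v = (\<Sum>b\<in>basis. coord b (frechet_derivative f (at x) v) *\<^sub>R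
        frechet_derivative g (at (f x)) b)" if "x \<in> S" for x
      unfolding frechet_derivative_eqI[OF D[OF that]] by (rule E[OF that])
  qed
  then show ?case using D by (auto simp: differentiable_def)
qed

lemma Ck_on_local:
  "(\<And>x. x \<in> S \<Longrightarrow> \<exists>T. open T \<and> x \<in> T \<and> Ck_on k T f) \<Longrightarrow> Ck_on k S f"
proof (induction k arbitrary: f)
  case 0
  have "continuous (at x) f" if x: "x \<in> S" for x
  proof -
    obtain T where "open T" "x \<in> T" "Ck_on 0 T f" using 0[OF x] by blast
    then show ?thesis by (auto simp: continuous_on_eq_continuous_at)
  qed
  then show ?case by (auto intro: continuous_at_imp_continuous_on)
next
  case (Suc k)
  have "Ck_on k S (\<lambda>x. frechet_derivative f (at x) v)" for v
    by (rule Suc.IH) (metis Suc.prems Ck_on.simps(2))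
  moreover have "f differentiable (at x)" if "x \<in> S" for x
    using Suc.prems[OF that] by auto
  ultimately show ?case by simp
qed

lemma Ck_on_id: "Ck_on k S (\<lambda>x. x)"
  by (cases k) (auto intro: Ck_on_const)

lemma smooth_on_cong:
  "open S \<Longrightarrow> (\<And>y. y \<in> S \<Longrightarrow> f y = g y) \<Longrightarrow> smooth_on S f \<longleftrightarrow> smooth_on S g"
  unfolding smooth_on_def using Ck_on_cong by blast

lemma smooth_on_subset: "smooth_on T f \<Longrightarrow> S \<subseteq> T \<Longrightarrow> smooth_on S f"
  unfolding smooth_on_def using Ck_on_subset by blast

lemma smooth_on_const [simp]: "smooth_on S (\<lambda>x. c)"
  unfolding smooth_on_def by (simp add: Ck_on_const)

lemma smooth_on_id: "smooth_on S (\<lambda>x. x)"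
  unfolding smooth_on_def by (simp add: Ck_on_id)

lemma smooth_on_add:
  "open S \<Longrightarrow> smooth_on S f \<Longrightarrow> smooth_on S g \<Longrightarrow> smooth_on S (\<lambda>x. f x + g x)"
  unfolding smooth_on_def by (simp add: Ck_on_add)

lemma smooth_on_sum:
  "open S \<Longrightarrow> (\<And>i. i \<in> I \<Longrightarrow> smooth_on S (f i)) \<Longrightarrow> smooth_on S (\<lambda>x. \<Sum>i\<in>I. f i x)"
  unfolding smooth_on_def by (simp add: Ck_on_sum)

lemma smooth_on_scaleR:
  "open S \<Longrightarrow> smooth_on S f \<Longrightarrow> smooth_on S g \<Longrightarrow> smooth_on S (\<lambda>x. f x *\<^sub>R g x)"
  unfolding smooth_on_def by (simp add: Ck_on_scaleR)

lemma smooth_on_mult: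
  fixes f g :: "'a::fin_dim_inner \<Rightarrow> real"
  shows "open S \<Longrightarrow> smooth_on S f \<Longrightarrow> smooth_on S g \<Longrightarrow> smooth_on S (\<lambda>x. f x * g x)"
  using smooth_on_scaleR[of S f g] by simp

lemma smooth_on_linear:
  "open S \<Longrightarrow> bounded_linear L \<Longrightarrow> smooth_on S f \<Longrightarrow> smooth_on S (\<lambda>x. L (f x))"
  unfolding smooth_on_def by (simp add: Ck_on_linear)

lemma smooth_on_compose:
  "open S \<Longrightarrow> f ` S \<subseteq> T \<Longrightarrow> smooth_on T g \<Longrightarrow> smooth_on S f \<Longrightarrow> smooth_on S (\<lambda>x. g (f x))"
  unfolding smooth_on_def using Ck_on_compose by blast

lemma smooth_on_local:
  assumes "\<And>x. x \<in> S \<Longrightarrow> \<exists>T. open T \<and> x \<in> T \<and> smooth_on T f"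
  shows "smooth_on S f"
  unfolding smooth_on_def
proof (intro allI Ck_on_local)
  fix k x assume "x \<in> S"
  then show "\<exists>T. open T \<and> x \<in> T \<and> Ck_on k T f"
    using assms unfolding smooth_on_def by blast
qed

lemma smooth_on_Pair:
  fixes f :: "'a::fin_dim_inner \<Rightarrow> 'b::real_normed_vector" and g :: "'a \<Rightarrow> 'c::real_normed_vector"
  assumes "open S" "smooth_on S f" "smooth_on S g"
  shows "smooth_on S (\<lambda>x. (f x, g x))"
proof -
  have 1: "bounded_linear (\<lambda>x::'b. (x, 0::'c))" "bounded_linear (\<lambda>x::'c. (0::'b, x))"
    by (auto intro!: bounded_linear_Pair bounded_linear_ident bounded_linear_zero)
  have "smooth_on S (\<lambda>x. (f x, 0) + (0, g x))"
    by (intro smooth_on_add smooth_on_linear[OF _ 1(1)] smooth_on_linear[OF _ 1(2)] assms)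
  then show ?thesis by simp
qed

lemma smooth_on_fst: "open S \<Longrightarrow> smooth_on S f \<Longrightarrow> smooth_on S (\<lambda>x. fst (f x))"
  and smooth_on_snd: "open S \<Longrightarrow> smooth_on S f \<Longrightarrow> smooth_on S (\<lambda>x. snd (f x))"
  by (auto intro: smooth_on_linear bounded_linear_fst bounded_linear_snd)

lemma smooth_on_continuous: "smooth_on S f \<Longrightarrow> continuous_on S f"
  unfolding smooth_on_def by (metis Ck_on.simps(1))

lemma smooth_on_differentiable: "smooth_on S f \<Longrightarrow> x \<in> S \<Longrightarrow> f differentiable (at x)"
  unfolding smooth_on_def by (metis Ck_on.simps(2))

lemma smooth_on_has_derivative:
  "smooth_on S f \<Longrightarrow> x \<in> S \<Longrightarrow> (f has_derivative frechet_derivative f (at x)) (at x)"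
  by (simp add: smooth_on_differentiable has_frechet_derivative)

lemma smooth_on_derivative: "smooth_on S f \<Longrightarrow> smooth_on S (\<lambda>x. frechet_derivative f (at x) v)"
  unfolding smooth_on_def by (metis Ck_on.simps(2))

section \<open>Symmetry of second derivatives\<close>

text \<open>The mean value theorem is applied twice: to the difference of f along two parallel
  segments in direction v, then to the derivative of f in direction v along a segment in direction
  w. The left-hand side is symmetric in v and w, the right-hand side is a mixed derivative at a
  nearby point.\<close>

lemma second_difference:
  fixes f :: "'a::fin_dim_inner \<Rightarrow> real"
  assumes f: "smooth_on S f" and h: "h > 0"
    and S: "\<And>s t. 0 \<le> s \<Longrightarrow> s \<le> h \<Longrightarrow> 0 \<le> t \<Longrightarrow> t \<le> h \<Longrightarrow> y + s *\<^sub>R v + t *\<^sub>R w \<in> S"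
  shows "\<exists>s t. 0 < s \<and> s < h \<and> 0 < t \<and> t < h \<and>
    f (y + h *\<^sub>R v + h *\<^sub>R w) - f (y + h *\<^sub>R v) - f (y + h *\<^sub>R w) + f y =
    h * h * frechet_derivative (\<lambda>x. frechet_derivative f (at x) v) (at (y + s *\<^sub>R v + t *\<^sub>R w)) w"
proof -
  let ?Dv = "\<lambda>x. frechet_derivative f (at x) v"
  have along: "((\<lambda>s. g (z + s *\<^sub>R u)) has_real_derivative frechet_derivative g (at (z + s *\<^sub>R u)) u) (at s)"
    if "smooth_on S g" "z + s *\<^sub>R u \<in> S" for g :: "'a \<Rightarrow> real" and z u s
  proof -
    have "((\<lambda>s. g (z + s *\<^sub>R u)) has_derivative
        (\<lambda>r. frechet_derivative g (at (z + s *\<^sub>R u)) (r *\<^sub>R u))) (at s)"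
      by (rule has_derivative_compose[of "\<lambda>s. z + s *\<^sub>R u"])
        (use that in \<open>auto intro!: derivative_eq_intros smooth_on_has_derivative\<close>)
    moreover have "(\<lambda>r. frechet_derivative g (at (z + s *\<^sub>R u)) (r *\<^sub>R u)) = (*) (frechet_derivative g (at (z + s *\<^sub>R u)) u)"
      using linear_frechet_derivative[OF smooth_on_differentiable[OF that]]
      by (simp add: linear_scale fun_eq_iff mult.commute)
    ultimately show ?thesis by (simp add: has_field_derivative_def)
  qed
  have "\<exists>s. 0 < s \<and> s < h \<and> (f (y + h *\<^sub>R w + h *\<^sub>R v) - f (y + h *\<^sub>R v)) - (f (y + h *\<^sub>R w + 0 *\<^sub>R v) - f (y + 0 *\<^sub>R v)) =
     (h - 0) * (?Dv (y + h *\<^sub>R w + s *\<^sub>R v) - ?Dv (y + s *\<^sub>R v))"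
  proof (rule MVT2[OF h])
    fix s assume s: "0 \<le> s" "s \<le> h"
    have "y + h *\<^sub>R w + s *\<^sub>R v \<in> S" "y + s *\<^sub>R v \<in> S"
      using S[OF s, of h] S[OF s, of 0] h by (auto simp: algebra_simps)
    then show "((\<lambda>s. f (y + h *\<^sub>R w + s *\<^sub>R v) - f (y + s *\<^sub>R v)) has_real_derivative
       ?Dv (y + h *\<^sub>R w + s *\<^sub>R v) - ?Dv (y + s *\<^sub>R v)) (at s)"
      by (intro derivative_intros along f)
  qed
  then obtain s where s: "0 < s" "s < h"
    "f (y + h *\<^sub>R v + h *\<^sub>R w) - f (y + h *\<^sub>R v) - f (y + h *\<^sub>R w) + f y =
     h * (?Dv (y + s *\<^sub>R v + h *\<^sub>R w) - ?Dv (y + s *\<^sub>R v))"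
    by (auto simp: algebra_simps)
  have "\<exists>t. 0 < t \<and> t < h \<and> ?Dv (y + s *\<^sub>R v + h *\<^sub>R w) - ?Dv (y + s *\<^sub>R v + 0 *\<^sub>R w) =
     (h - 0) * frechet_derivative ?Dv (at (y + s *\<^sub>R v + t *\<^sub>R w)) w"
    by (rule MVT2[OF h]) (intro along smooth_on_derivative f S, use s in auto)
  then show ?thesis using s by (force simp: algebra_simps)
qed

text \<open>Up to the factor h * h, the same second difference is a value of either mixed derivative
  at some point near y. If the two differed at y, continuity would keep them apart for small
  h.\<close>

lemma symmetric_second_derivative_real:
  fixes f :: "'a::fin_dim_inner \<Rightarrow> real"
  assumes "open S" "smooth_on S f" "y \<in> S"
  shows "frechet_derivative (\<lambda>x. frechet_derivative f (at x) v) (at y) w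
       = frechet_derivative (\<lambda>x. frechet_derivative f (at x) w) (at y) v"
proof (rule ccontr)
  define F where "F x = frechet_derivative (\<lambda>x. frechet_derivative f (at x) v) (at x) w" for x
  define G where "G x = frechet_derivative (\<lambda>x. frechet_derivative f (at x) w) (at x) v" for x
  assume "\<not> ?thesis"
  then have "F y \<noteq> G y" by (simp add: F_def G_def)
  \<comment> \<open>Half the gap: two deviations smaller than \<open>\<epsilon>\<close> cannot
    bridge it.\<close>
  define \<epsilon> where "\<epsilon> = \<bar>F y - G y\<bar> / 2"
  have e: "\<epsilon> > 0" using \<open>F y \<noteq> G y\<close> by (simp add: \<epsilon>_def)
  have "continuous_on S F" "continuous_on S G"
    unfolding F_def G_def by (intro smooth_on_continuous smooth_on_derivative assms(2))+
  then have "isCont F y" "isCont G y"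
    using assms by (auto simp: continuous_on_eq_continuous_at)
  then have "\<forall>\<^sub>F x in nhds y. dist (F x) (F y) < \<epsilon>" "\<forall>\<^sub>F x in nhds y. dist (G x) (G y) < \<epsilon>"
    using e unfolding isCont_def tendsto_at_iff_tendsto_nhds by (auto simp: tendsto_iff)
  moreover have "\<forall>\<^sub>F x in nhds y. x \<in> S" using assms by (simp add: eventually_nhds_in_open)
  ultimately have "\<forall>\<^sub>F x in nhds y. dist (F x) (F y) < \<epsilon> \<and> dist (G x) (G y) < \<epsilon> \<and> x \<in> S"
    by (intro eventually_conj)
  then obtain d where d: "d > 0" "\<And>x. dist x y < d \<Longrightarrow> dist (F x) (F y) < \<epsilon> \<and> dist (G x) (G y) < \<epsilon> \<and> x \<in> S"
    by (auto simp: eventually_nhds_metric)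
  \<comment> \<open>Keeps the parallelogram with sides \<open>h *\<^sub>R v\<close> and
    \<open>h *\<^sub>R w\<close> within distance d / 2 of y; the summand 1 makes the denominator
    positive even if v and w are 0.\<close>
  define h where "h = d / (norm v + norm w + 1) / 2"
  have h: "h > 0" unfolding h_def using d(1) by (simp add: add_nonneg_pos)
  have near: "dist (y + s *\<^sub>R v + t *\<^sub>R w) y < d" if "0 \<le> s" "s \<le> h" "0 \<le> t" "t \<le> h" for s t
  proof -
    have "dist (y + s *\<^sub>R v + t *\<^sub>R w) y = norm (s *\<^sub>R v + t *\<^sub>R w)" by (simp add: dist_norm algebra_simps)
    also have "\<dots> \<le> s * norm v + t * norm w"
      using norm_triangle_ineq[of "s *\<^sub>R v" "t *\<^sub>R w"] that by simp
    also have "\<dots> \<le> h * norm v + h * norm w" using that by (intro add_mono mult_right_mono) auto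
    also have "\<dots> \<le> h * (norm v + norm w + 1)" using h by (simp add: algebra_simps)
    also have "\<dots> = d / 2"
    proof -
      have "norm v + norm w + 1 \<noteq> 0" using norm_ge_zero[of v] norm_ge_zero[of w] by linarith
      moreover have "d / N / 2 * N = d / 2" if "N \<noteq> 0" for N using that by simp
      ultimately show ?thesis unfolding h_def by blast
    qed
    finally show ?thesis using d(1) by simp
  qed
  obtain s t where st: "0 < s" "s < h" "0 < t" "t < h"
    "f (y + h *\<^sub>R v + h *\<^sub>R w) - f (y + h *\<^sub>R v) - f (y + h *\<^sub>R w) + f y = h * h * F (y + s *\<^sub>R v + t *\<^sub>R w)"
    using second_difference[OF assms(2) h, of y v w] near d(2) unfolding F_def by blast
  have near': "dist (y + s *\<^sub>R w + t *\<^sub>R v) y < d" if "0 \<le> s" "s \<le> h" "0 \<le> t" "t \<le> h" for s t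
    using near[of t s] that by (simp add: algebra_simps)
  obtain s' t' where st': "0 < s'" "s' < h" "0 < t'" "t' < h"
    "f (y + h *\<^sub>R w + h *\<^sub>R v) - f (y + h *\<^sub>R w) - f (y + h *\<^sub>R v) + f y = h * h * G (y + s' *\<^sub>R w + t' *\<^sub>R v)"
    using second_difference[OF assms(2) h, of y w v] near' d(2) unfolding G_def by blast
  have "f (y + h *\<^sub>R w + h *\<^sub>R v) = f (y + h *\<^sub>R v + h *\<^sub>R w)" by (simp add: algebra_simps)
  then have "F (y + s *\<^sub>R v + t *\<^sub>R w) = G (y + s' *\<^sub>R w + t' *\<^sub>R v)"
  proof -
    have "h * h * F (y + s *\<^sub>R v + t *\<^sub>R w) = h * h * G (y + s' *\<^sub>R w + t' *\<^sub>R v)"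
      using st(5) st'(5) \<open>f (y + h *\<^sub>R w + h *\<^sub>R v) = _\<close> by linarith
    then show ?thesis using h by simp
  qed
  moreover have "dist (F (y + s *\<^sub>R v + t *\<^sub>R w)) (F y) < \<epsilon>" using d(2) near st by simp
  moreover have "dist (G (y + s' *\<^sub>R w + t' *\<^sub>R v)) (G y) < \<epsilon>" using d(2) near' st' by simp
  ultimately have "dist (F y) (G y) < 2 * \<epsilon>"
    unfolding dist_real_def by linarith
  then show False by (simp add: \<epsilon>_def dist_real_def)
qed

text \<open>Coordinates commute with differentiation, so the real case applies to each of
  them.\<close>

lemma symmetric_second_derivative:
  fixes f :: "'a::fin_dim_inner \<Rightarrow> 'b::fin_dim_inner"
  assumes "open S" "smooth_on S f" "y \<in> S"
  shows "frechet_derivative (\<lambda>x. frechet_derivative f (at x) v) (at y) w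
       = frechet_derivative (\<lambda>x. frechet_derivative f (at x) w) (at y) v"
proof -
  have D: "frechet_derivative (\<lambda>x. coord b (g x)) (at x) u = coord b (frechet_derivative g (at x) u)"
    if "smooth_on S g" "x \<in> S" for g :: "'a \<Rightarrow> 'b" and b x u
    by (subst frechet_derivative_eqI[OF bounded_linear.has_derivative[OF bounded_linear_coord]])
      (use that in \<open>auto intro: smooth_on_has_derivative\<close>)
  have DD: "frechet_derivative (\<lambda>x. frechet_derivative (\<lambda>x. coord b (f x)) (at x) v) (at y) w
      = coord b (frechet_derivative (\<lambda>x. frechet_derivative f (at x) v) (at y) w)" for b v w
    by (subst frechet_derivative_cong_open[OF assms(1,3) D[OF assms(2)]])
      (simp, rule D[OF smooth_on_derivative[OF assms(2)] assms(3)])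
  have "coord b (frechet_derivative (\<lambda>x. frechet_derivative f (at x) v) (at y) w)
      = coord b (frechet_derivative (\<lambda>x. frechet_derivative f (at x) w) (at y) v)" for b
    unfolding DD[symmetric]
    by (rule symmetric_second_derivative_real[OF assms(1)
          smooth_on_linear[OF assms(1) bounded_linear_coord assms(2)] assms(3)])
  then show ?thesis by (rule coord_eqI)
qed


subsection \<open>Algebra of functions on lists of vectors\<close>

text \<open>The interior product.\<close>

definition contract :: "'e \<Rightarrow> ('e list \<Rightarrow> real) \<Rightarrow> 'e list \<Rightarrow> real" where
  "contract v a = (\<lambda>ws. a (v # ws))"

text \<open>The grading involution. It supplies the Koszul sign for lists of all lengths at
  once.\<close>

definition twist :: "('e list \<Rightarrow> real) \<Rightarrow> 'e list \<Rightarrow> real" where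
  "twist a = (\<lambda>ws. (-1) ^ length ws * a ws)"

definition list_wedge :: "('e list \<Rightarrow> real) \<Rightarrow> ('e list \<Rightarrow> real) \<Rightarrow> 'e list \<Rightarrow> real" where
  "list_wedge a b = (\<lambda>vs. \<Sum>S\<in>Pow {..<length vs}.
     shuffle_sign (length vs) S * a (nths vs S) * b (nths vs (- S)))"

lemma wedge_eq_list_wedge: "wedge \<omega> \<eta> c y = list_wedge (\<omega> c y) (\<eta> c y)"
  by (simp add: wedge_def list_wedge_def)

text \<open>Nothing precedes position 0, so putting it into the first block creates no
  inversion.\<close>

lemma shuffle_sign_insert_0: "shuffle_sign (Suc n) (insert 0 (Suc ` S)) = shuffle_sign n S"
proof -
  have "{(i, j). i \<in> insert 0 (Suc ` S) \<and> j \<in> {..<Suc n} - insert 0 (Suc ` S) \<and> j < i} =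
      map_prod Suc Suc ` {(i, j). i \<in> S \<and> j \<in> {..<n} - S \<and> j < i}" (is "?A = _ ` ?B")
  proof (intro equalityI subsetI)
    fix z assume "z \<in> ?A"
    then obtain i j where z: "z = (i, j)" "i \<in> insert 0 (Suc ` S)" "j \<in> {..<Suc n} - insert 0 (Suc ` S)" "j < i"
      by auto
    from z obtain i' j' where "i = Suc i'" "j = Suc j'" by (cases i; cases j) auto
    with z show "z \<in> map_prod Suc Suc ` ?B" by (intro image_eqI[of _ _ "(i', j')"]) auto
  qed auto
  then show ?thesis
    by (simp add: shuffle_sign_def card_image[OF inj_on_subset[OF prod.inj_map[OF inj_Suc inj_Suc]]])
qed

text \<open>Position 0 now belongs to the second block and precedes every element of the first one,
  which adds \<open>card S\<close> inversions.\<close>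

lemma shuffle_sign_image_Suc:
  assumes "S \<subseteq> {..<n}"
  shows "shuffle_sign (Suc n) (Suc ` S) = (-1) ^ card S * shuffle_sign n S"
proof -
  have fin: "finite S" using assms finite_subset by blast
  let ?B = "{(i, j). i \<in> S \<and> j \<in> {..<n} - S \<and> j < i}"
  have finB: "finite ?B" by (rule finite_subset[of _ "S \<times> {..<n}"]) (use fin in auto)
  have "{(i, j). i \<in> Suc ` S \<and> j \<in> {..<Suc n} - Suc ` S \<and> j < i} =
      (\<lambda>i. (Suc i, 0)) ` S \<union> map_prod Suc Suc ` ?B" (is "?A = ?C \<union> ?D")
  proof (intro equalityI subsetI)
    fix z assume "z \<in> ?A"
    then obtain i j where z: "z = (i, j)" "i \<in> Suc ` S" "j \<in> {..<Suc n} - Suc ` S" "j < i"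
      by auto
    then obtain i' where i: "i = Suc i'" by (cases i) auto
    show "z \<in> ?C \<union> ?D"
    proof (cases j)
      case 0
      then show ?thesis using z i by auto
    next
      case (Suc j')
      then have "(i', j') \<in> ?B" using z i by auto
      then show ?thesis using z i Suc by (intro UnI2 image_eqI[of _ _ "(i', j')"]) auto
    qed
  qed auto
  moreover have "card (?C \<union> ?D) = card ?C + card ?D"
    by (rule card_Un_disjoint) (use fin finB in auto)
  moreover have "card ?C = card S" by (rule card_image) (auto simp: inj_on_def)
  moreover have "card ?D = card ?B"
    by (rule card_image[OF inj_on_subset[OF prod.inj_map[OF inj_Suc inj_Suc]]]) simp
  ultimately show ?thesis by (simp add: shuffle_sign_def power_add)
qed

lemma length_nths_subset: "S \<subseteq> {..<length vs} \<Longrightarrow> length (nths vs S) = card S"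
  unfolding length_nths by (rule arg_cong[of _ _ card]) auto

lemma list_wedge_Nil: "list_wedge a b [] = a [] * b []"
  by (simp add: list_wedge_def shuffle_sign_def)

lemma Pow_lessThan_Suc:
  "Pow {..<Suc n} = image Suc ` Pow {..<n} \<union> (\<lambda>S. insert 0 (Suc ` S)) ` Pow {..<n}"
proof -
  have "{..<Suc n} = insert 0 (Suc ` {..<n})" by (auto simp: lessThan_Suc_eq_insert_0)
  then have "Pow {..<Suc n} = Pow (Suc ` {..<n}) \<union> insert 0 ` Pow (Suc ` {..<n})"
    by (simp add: Pow_insert)
  also have "Pow (Suc ` {..<n}) = image Suc ` Pow {..<n}" by (simp add: image_Pow_surj)
  finally show ?thesis by (simp add: image_image)
qed

text \<open>
  All identities for the wedge product are proved by induction with this recursion, which says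
  that contraction is an antiderivation.
\<close>

lemma list_wedge_Cons:
  "list_wedge a b (v # vs) = list_wedge (contract v a) b vs + list_wedge (twist a) (contract v b) vs"
proof -
  let ?n = "length vs"
  define f where "f S = shuffle_sign (Suc ?n) S * a (nths (v # vs) S) * b (nths (v # vs) (- S))" for S
  have inj: "inj_on (image Suc) (Pow {..<?n})" by (auto intro!: inj_onI simp: inj_image_eq_iff)
  have inj0: "inj_on (\<lambda>S. insert 0 (Suc ` S)) (Pow {..<?n})"
  proof (rule inj_onI)
    fix S T assume "insert 0 (Suc ` S) = insert 0 (Suc ` T)"
    moreover have "0 \<notin> Suc ` S" "0 \<notin> Suc ` T" by auto
    ultimately have "Suc ` S = Suc ` T" by (simp add: insert_ident)
    then show "S = T" by (simp add: inj_image_eq_iff)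
  qed
  have disj: "image Suc ` Pow {..<?n} \<inter> (\<lambda>S. insert 0 (Suc ` S)) ` Pow {..<?n} = {}" by auto
  have 1: "f (insert 0 (Suc ` S)) = shuffle_sign ?n S * contract v a (nths vs S) * b (nths vs (- S))" for S
  proof -
    have "{j. Suc j \<in> insert 0 (Suc ` S)} = S" "{j. Suc j \<in> - insert 0 (Suc ` S)} = - S" by auto
    then show ?thesis by (simp add: f_def nths_Cons shuffle_sign_insert_0 contract_def)
  qed
  have 2: "f (Suc ` S) = shuffle_sign ?n S * twist a (nths vs S) * contract v b (nths vs (- S))"
    if "S \<subseteq> {..<?n}" for S
  proof -
    have "{j. Suc j \<in> Suc ` S} = S" "{j. Suc j \<in> - Suc ` S} = - S" "0 \<notin> Suc ` S" by auto
    then show ?thesis using that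
      by (simp add: f_def nths_Cons shuffle_sign_image_Suc contract_def twist_def length_nths_subset)
  qed
  have "list_wedge a b (v # vs) = sum f (Pow {..<Suc ?n})"
    by (simp add: list_wedge_def f_def)
  also have "\<dots> = (\<Sum>S\<in>Pow {..<?n}. f (Suc ` S)) + (\<Sum>S\<in>Pow {..<?n}. f (insert 0 (Suc ` S)))"
    unfolding Pow_lessThan_Suc
    by (subst sum.union_disjoint[OF _ _ disj]) (simp_all add: sum.reindex[OF inj] sum.reindex[OF inj0])
  also have "(\<Sum>S\<in>Pow {..<?n}. f (Suc ` S)) = list_wedge (twist a) (contract v b) vs"
    unfolding list_wedge_def by (rule sum.cong) (use 2 in auto)
  also have "(\<Sum>S\<in>Pow {..<?n}. f (insert 0 (Suc ` S))) = list_wedge (contract v a) b vs"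
    unfolding list_wedge_def by (rule sum.cong) (use 1 in auto)
  finally show ?thesis by simp
qed

lemma list_wedge_add_left: "list_wedge (\<lambda>ws. a ws + a' ws) b vs = list_wedge a b vs + list_wedge a' b vs"
  and list_wedge_add_right: "list_wedge a (\<lambda>ws. b ws + b' ws) vs = list_wedge a b vs + list_wedge a b' vs"
  and list_wedge_scale_left: "list_wedge (\<lambda>ws. r * a ws) b vs = r * list_wedge a b vs"
  and list_wedge_scale_right: "list_wedge a (\<lambda>ws. r * b ws) vs = r * list_wedge a b vs"
  and list_wedge_zero_left: "list_wedge (\<lambda>ws. 0) b vs = 0"
  and list_wedge_zero_right: "list_wedge a (\<lambda>ws. 0) vs = 0"
  and list_wedge_minus_left: "list_wedge (\<lambda>ws. - a ws) b vs = - list_wedge a b vs"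
  and list_wedge_minus_right: "list_wedge a (\<lambda>ws. - b ws) vs = - list_wedge a b vs"
  and list_wedge_diff_left: "list_wedge (\<lambda>ws. a ws - a' ws) b vs = list_wedge a b vs - list_wedge a' b vs"
  and list_wedge_diff_right: "list_wedge a (\<lambda>ws. b ws - b' ws) vs = list_wedge a b vs - list_wedge a b' vs"
  for a b :: "'e list \<Rightarrow> real"
  by (simp_all add: list_wedge_def algebra_simps sum.distrib sum_distrib_left sum_negf sum_subtractf)

lemma twist_twist [simp]: "twist (twist a) = a"
  by (auto simp: twist_def power_mult_distrib[symmetric] mult.assoc[symmetric])

text \<open>Contraction evaluates on a list that is longer by one, hence the sign.\<close>

lemma contract_twist: "contract v (twist a) = (\<lambda>ws. - twist (contract v a) ws)"
  by (auto simp: twist_def contract_def)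

lemma contract_list_wedge:
  "contract v (list_wedge a b) =
     (\<lambda>ws. list_wedge (contract v a) b ws + list_wedge (twist a) (contract v b) ws)"
  by (rule ext) (simp add: contract_def[of v "list_wedge a b"] list_wedge_Cons)

lemma length_nths_Compl: "length (nths vs S) + length (nths vs (- S)) = length vs"
proof -
  have "{..<length vs} = {i. i < length vs \<and> i \<in> S} \<union> {i. i < length vs \<and> i \<in> - S}" by auto
  then have "length vs = card ({i. i < length vs \<and> i \<in> S} \<union> {i. i < length vs \<and> i \<in> - S})"
    by (metis card_lessThan)
  also have "\<dots> = card {i. i < length vs \<and> i \<in> S} + card {i. i < length vs \<and> i \<in> - S}"
    by (rule card_Un_disjoint) auto
  finally show ?thesis by (simp add: length_nths)
qed

lemma twist_list_wedge: "twist (list_wedge a b) = list_wedge (twist a) (twist b)"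
proof
  fix vs
  have "(-1) ^ length vs * (shuffle_sign (length vs) S * a (nths vs S) * b (nths vs (- S))) =
      shuffle_sign (length vs) S * twist a (nths vs S) * twist b (nths vs (- S))" for S
  proof -
    have "(-1 :: real) ^ length vs = (-1) ^ length (nths vs S) * (-1) ^ length (nths vs (- S))"
      by (simp only: power_add[symmetric] length_nths_Compl)
    then show ?thesis by (simp add: twist_def)
  qed
  then show "twist (list_wedge a b) vs = list_wedge (twist a) (twist b) vs"
    unfolding twist_def[of "list_wedge a b"] unfolding list_wedge_def sum_distrib_left by (intro sum.cong) auto
qed

text \<open>Both sides contract to the same three terms, in which the vector goes to a, b or c and
  the factors before it are twisted. Since these terms contain altered factors, the induction keeps
  a, b and c arbitrary.\<close>

lemma list_wedge_assoc: "list_wedge (list_wedge a b) c = list_wedge a (list_wedge b c)"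
proof
  fix vs show "list_wedge (list_wedge a b) c vs = list_wedge a (list_wedge b c) vs"
    by (induction vs arbitrary: a b c)
      (simp_all add: list_wedge_Nil list_wedge_Cons contract_list_wedge twist_list_wedge
        list_wedge_add_left list_wedge_add_right)
qed

text \<open>Contraction changes the parity of b, so both statements are proved in one induction.
  Only b has a parity; the signs for an arbitrary a are absorbed by \<open>twist\<close>.\<close>

lemma list_wedge_commute_even:
    "(\<And>ws. odd (length ws) \<Longrightarrow> b ws = 0) \<Longrightarrow> list_wedge a b vs = list_wedge b a vs"
  and list_wedge_commute_odd:
    "(\<And>ws. even (length ws) \<Longrightarrow> b ws = 0) \<Longrightarrow> list_wedge a b vs = list_wedge b (twist a) vs"
proof (induction vs arbitrary: a b)
  case Nil
  { case 1 show ?case by (simp add: list_wedge_Nil) }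
  { case 2 then show ?case by (simp add: list_wedge_Nil) }
next
  case (Cons v vs)
  { case 1
    have "twist b ws = b ws" for ws using 1 by (cases "even (length ws)") (auto simp: twist_def)
    then have "twist b = b" by (rule ext)
    moreover have "list_wedge (contract v a) b vs = list_wedge b (contract v a) vs"
      by (rule Cons.IH(1)) (use 1 in auto)
    moreover have "list_wedge (twist a) (contract v b) vs = list_wedge (contract v b) (twist (twist a)) vs"
      by (rule Cons.IH(2)) (use 1 in \<open>auto simp: contract_def\<close>)
    ultimately show ?case by (simp add: list_wedge_Cons) }
  { case 2
    have "twist b ws = - b ws" for ws using 2 by (cases "even (length ws)") (auto simp: twist_def)
    then have "twist b = (\<lambda>ws. - b ws)" by (rule ext)
    moreover have "list_wedge (contract v a) b vs = list_wedge b (twist (contract v a)) vs"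
      by (rule Cons.IH(2)) (use 2 in auto)
    moreover have "list_wedge (twist a) (contract v b) vs = list_wedge (contract v b) (twist a) vs"
      by (rule Cons.IH(1)) (use 2 in \<open>auto simp: contract_def\<close>)
    ultimately show ?case by (simp add: list_wedge_Cons contract_twist list_wedge_minus_left list_wedge_minus_right) }
qed

section \<open>Multilinear and alternating functions\<close>

definition multilinear :: "('e::real_vector list \<Rightarrow> real) \<Rightarrow> bool" where
  "multilinear a \<longleftrightarrow> (\<forall>us ws. linear (\<lambda>v. a (us @ v # ws)))"

lemma multilinearD: "multilinear a \<Longrightarrow> linear (\<lambda>v. a (us @ v # ws))"
  by (simp add: multilinear_def)

lemma multilinear_Cons: "multilinear a \<Longrightarrow> linear (\<lambda>v. a (v # ws))"
  using multilinearD[of a "[]"] by simp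

lemma multilinear_contract: "multilinear a \<Longrightarrow> multilinear (contract v a)"
  using multilinearD[of a "v # us" for us] by (simp add: multilinear_def contract_def)

lemma linear_mult_left: "linear f \<Longrightarrow> linear (\<lambda>x. r * f x)" for f :: "'a::real_vector \<Rightarrow> real"
  by (simp add: linear_iff algebra_simps)

lemma multilinear_twist: "multilinear a \<Longrightarrow> multilinear (twist a)"
  unfolding multilinear_def twist_def length_append list.size by (intro allI linear_mult_left) simp

lemma contract_add:
  "multilinear a \<Longrightarrow> contract (v + w) a = (\<lambda>ws. contract v a ws + contract w a ws)"
  and contract_scale:
  "multilinear a \<Longrightarrow> contract (r *\<^sub>R v) a = (\<lambda>ws. r * contract v a ws)"
  using multilinear_Cons[of a] by (auto simp: contract_def linear_iff)

lemma alternating_imp_multilinear: "alternating a \<Longrightarrow> multilinear a"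
  by (simp add: alternating_def multilinear_def)

lemma alternating_contract: "alternating a \<Longrightarrow> alternating (contract v a)"
  using multilinear_contract[OF alternating_imp_multilinear, of a v]
  by (simp add: alternating_def multilinear_def contract_def)

text \<open>Polarisation: expand the vanishing value at the adjacent pair v + w, v + w.\<close>

lemma adjacent_swap:
  assumes "multilinear a" "\<And>us v ws. a (us @ v # v # ws) = 0"
  shows "a (us @ v # w # ws) = - a (us @ w # v # ws)"
proof -
  have 1: "a (us @ (v + w) # x # ws) = a (us @ v # x # ws) + a (us @ w # x # ws)" for x
    using multilinearD[OF assms(1), of us "x # ws"] by (simp add: linear_iff)
  have 2: "a (us @ x # (v + w) # ws) = a (us @ x # v # ws) + a (us @ x # w # ws)" for x
    using multilinearD[OF assms(1), of "us @ [x]" ws] by (simp add: linear_iff)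
  show ?thesis
    using assms(2)[of us "v + w" ws] assms(2)[of us v ws] assms(2)[of us w ws] 1 2 by simp
qed

lemma adjacent_move:
  assumes "multilinear a" "\<And>us v ws. a (us @ v # v # ws) = 0"
  shows "a (us @ xs @ v # ws) = (-1) ^ length xs * a (us @ v # xs @ ws)"
proof (induction xs arbitrary: us)
  case (Cons x xs)
  have "a (us @ (x # xs) @ v # ws) = a ((us @ [x]) @ xs @ v # ws)" by simp
  also have "\<dots> = (-1) ^ length xs * a (us @ x # v # xs @ ws)" by (subst Cons.IH) simp
  finally show ?case using adjacent_swap[OF assms, of us x v "xs @ ws"] by simp
qed simp

text \<open>Moving an argument past a block only changes the sign, so equal arguments may be assumed
  adjacent. The adjacent test suits inductions on the argument list, where two contractions with the
  same vector then follow each other.\<close>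

lemma alternatingI:
  assumes "multilinear a" "\<And>us v ws. a (us @ v # v # ws) = 0"
  shows "alternating a"
  unfolding alternating_def
proof (intro conjI allI impI)
  show "linear (\<lambda>v. a (us @ v # ws))" for us ws using assms(1) by (rule multilinearD)
  fix vs :: "'a list" assume "\<not> distinct vs"
  then obtain us v xs ws where "vs = us @ [v] @ xs @ [v] @ ws"
    using not_distinct_decomp by blast
  then have "a vs = a ((us @ [v]) @ xs @ v # ws)" by simp
  also have "\<dots> = (-1) ^ length xs * a ((us @ [v]) @ v # xs @ ws)" by (rule adjacent_move[OF assms])
  also have "\<dots> = 0" by (simp add: assms(2))
  finally show "a vs = 0" .
qed

lemma alternating_adjacent: "alternating a \<Longrightarrow> a (us @ v # v # ws) = 0"
  by (simp add: alternating_def)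

lemma alternating_move:
  assumes "alternating a"
  shows "a (xs @ v # ws) = (-1) ^ length xs * a (v # xs @ ws)"
  using adjacent_move[OF alternating_imp_multilinear[OF assms] alternating_adjacent[OF assms], of "[]"] by simp

lemma alternating_twist: "alternating a \<Longrightarrow> alternating (twist a)"
  using multilinear_twist[of a] by (auto simp: alternating_def multilinear_def twist_def)

text \<open>Contraction strips off the arguments in front of the varying slot; in the first slot the
  recursion makes linearity explicit.\<close>

lemma multilinear_list_wedge:
  assumes "multilinear a" "multilinear b"
  shows "multilinear (list_wedge a b)"
proof -
  have "linear (\<lambda>v. list_wedge a b (us @ v # ws))" for us ws
    using assms
  proof (induction us arbitrary: a b)
    case Nil
    then show ?case
      by (simp add: linear_iff list_wedge_Cons contract_add contract_scale multilinear_twist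
          list_wedge_add_left list_wedge_add_right list_wedge_scale_left list_wedge_scale_right algebra_simps)
  next
    case (Cons u us)
    then show ?case unfolding append_Cons list_wedge_Cons
      by (intro linear_compose_add Cons.IH multilinear_contract multilinear_twist)
  qed
  then show ?thesis by (simp add: multilinear_def)
qed

lemma alternating_list_wedge:
  assumes "alternating a" "alternating b"
  shows "alternating (list_wedge a b)"
proof (rule alternatingI)
  show "multilinear (list_wedge a b)"
    using assms by (intro multilinear_list_wedge alternating_imp_multilinear)
  show "list_wedge a b (us @ v # v # ws) = 0" for us v ws
    using assms
  proof (induction us arbitrary: a b)
    \<comment> \<open>Contracting twice with v: the terms where both copies meet the same factor
      vanish, and the two mixed terms cancel by \<open>contract_twist\<close>.\<close>
    case Nil
    have zero: "contract v (contract v a) = (\<lambda>ws. 0)" if "alternating a" for a :: "'a list \<Rightarrow> real"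
      using that alternating_adjacent[of a "[]" v] by (auto simp: contract_def)
    show ?case using zero[OF Nil(1)] zero[OF Nil(2)]
      by (simp add: list_wedge_Cons contract_twist list_wedge_minus_left list_wedge_zero_left list_wedge_zero_right)
  next
    case (Cons u us)
    then show ?case by (simp add: list_wedge_Cons alternating_contract alternating_twist)
  qed
qed

subsection \<open>The exterior derivative in a chart\<close>

text \<open>The arguments range over a space of their own: for pullbacks the base point lies in the
  source chart, while the arguments of the form lie in the target.\<close>

definition partial :: "('e::real_normed_vector \<Rightarrow> 'h list \<Rightarrow> real) \<Rightarrow> 'e \<Rightarrow> 'e \<Rightarrow> 'h list \<Rightarrow> real" where
  "partial \<alpha> y v = (\<lambda>vs. frechet_derivative (\<lambda>x. \<alpha> x vs) (at y) v)"

definition family_differentiable :: "('e::real_normed_vector \<Rightarrow> 'h list \<Rightarrow> real) \<Rightarrow> 'e \<Rightarrow> bool" where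
  "family_differentiable \<alpha> y \<longleftrightarrow> (\<forall>vs. (\<lambda>x. \<alpha> x vs) differentiable (at y))"

definition list_d :: "('e::real_normed_vector \<Rightarrow> 'e list \<Rightarrow> real) \<Rightarrow> 'e \<Rightarrow> 'e list \<Rightarrow> real" where
  "list_d \<alpha> y vs = (\<Sum>i<length vs. (-1) ^ i * partial \<alpha> y (vs ! i) (take i vs @ drop (Suc i) vs))"

lemma ext_d_eq_list_d: "c \<in> A \<Longrightarrow> y \<in> chart_image c \<Longrightarrow> ext_d A \<omega> c y = list_d (\<omega> c) y"
  by (auto simp: ext_d_def list_d_def partial_def)

lemma list_d_Nil: "list_d \<alpha> y [] = 0"
  by (simp add: list_d_def)

text \<open>Cartan's formula for the constant vector field v: the contraction of d\<alpha> is the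
  Lie derivative, here a directional derivative, minus d of the contraction.\<close>

lemma list_d_Cons: "list_d \<alpha> y (v # vs) = partial \<alpha> y v vs - list_d (\<lambda>x. contract v (\<alpha> x)) y vs"
  by (simp add: list_d_def partial_def contract_def sum.lessThan_Suc_shift sum_negf del: sum.lessThan_Suc)

lemma partial_has_derivative:
  "family_differentiable \<alpha> y \<Longrightarrow> ((\<lambda>x. \<alpha> x vs) has_derivative (\<lambda>v. partial \<alpha> y v vs)) (at y)"
  unfolding partial_def family_differentiable_def by (simp add: has_frechet_derivative)

lemma partial_eqI: "((\<lambda>x. \<alpha> x vs) has_derivative f') (at y) \<Longrightarrow> partial \<alpha> y v vs = f' v"
  unfolding partial_def by (simp add: frechet_derivative_eqI)

lemma family_differentiable_contract:
  "family_differentiable \<alpha> y \<Longrightarrow> family_differentiable (\<lambda>x. contract v (\<alpha> x)) y"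
  by (simp add: family_differentiable_def contract_def)

lemma family_differentiable_scale:
  "family_differentiable \<alpha> y \<Longrightarrow> family_differentiable (\<lambda>x ws. r ws * \<alpha> x ws) y"
  unfolding family_differentiable_def by (auto intro!: differentiable_mult)

lemma family_differentiable_twist:
  "family_differentiable \<alpha> y \<Longrightarrow> family_differentiable (\<lambda>x. twist (\<alpha> x)) y"
  unfolding twist_def by (rule family_differentiable_scale)

lemma partial_scale:
  "family_differentiable \<alpha> y \<Longrightarrow> partial (\<lambda>x ws. r ws * \<alpha> x ws) y v = (\<lambda>ws. r ws * partial \<alpha> y v ws)"
  by (rule ext, rule partial_eqI, rule has_derivative_mult_right, rule partial_has_derivative)

lemma partial_twist:
  "family_differentiable \<alpha> y \<Longrightarrow> partial (\<lambda>x. twist (\<alpha> x)) y v = twist (partial \<alpha> y v)"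
  unfolding twist_def by (rule partial_scale)

lemma partial_add:
  "family_differentiable \<alpha> y \<Longrightarrow> family_differentiable \<beta> y \<Longrightarrow>
   partial (\<lambda>x ws. \<alpha> x ws + \<beta> x ws) y v = (\<lambda>ws. partial \<alpha> y v ws + partial \<beta> y v ws)"
  by (rule ext, rule partial_eqI, rule has_derivative_add; rule partial_has_derivative)

lemma partial_contract: "partial (\<lambda>x. contract w (\<alpha> x)) y v = contract w (partial \<alpha> y v)"
  by (simp add: partial_def contract_def)

lemma list_d_add:
  "family_differentiable \<alpha> y \<Longrightarrow> family_differentiable \<beta> y \<Longrightarrow>
   list_d (\<lambda>x ws. \<alpha> x ws + \<beta> x ws) y vs = list_d \<alpha> y vs + list_d \<beta> y vs"
  by (simp add: list_d_def partial_add algebra_simps sum.distrib)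

lemma list_d_scale:
  "family_differentiable \<alpha> y \<Longrightarrow> list_d (\<lambda>x ws. r * \<alpha> x ws) y vs = r * list_d \<alpha> y vs"
  by (simp add: list_d_def partial_scale algebra_simps sum_distrib_left)

lemma list_d_minus:
  "family_differentiable \<alpha> y \<Longrightarrow> list_d (\<lambda>x ws. - \<alpha> x ws) y vs = - list_d \<alpha> y vs"
  using list_d_scale[of \<alpha> y "-1"] by simp

text \<open>d raises the degree by one and therefore anticommutes with the grading
  involution.\<close>

lemma list_d_twist:
  "family_differentiable \<alpha> y \<Longrightarrow> list_d (\<lambda>x. twist (\<alpha> x)) y vs = - twist (list_d \<alpha> y) vs"
proof (induction vs arbitrary: \<alpha>)
  case Nil
  then show ?case by (simp add: list_d_Nil twist_def)
next
  case (Cons v vs)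
  have "list_d (\<lambda>x. twist (\<alpha> x)) y (v # vs) =
      twist (partial \<alpha> y v) vs - twist (list_d (\<lambda>x. contract v (\<alpha> x)) y) vs"
    using Cons by (simp add: list_d_Cons contract_twist partial_twist list_d_minus family_differentiable_contract
        family_differentiable_twist)
  also have "\<dots> = - twist (list_d \<alpha> y) (v # vs)"
    by (simp add: twist_def list_d_Cons algebra_simps)
  finally show ?case .
qed

text \<open>By the recursion for \<open>list_wedge\<close>, everything reduces to the empty list,
  where the wedge is a product of two scalar functions.\<close>

lemma list_wedge_has_derivative:
  assumes "family_differentiable \<alpha> y" "family_differentiable \<beta> y"
  shows "((\<lambda>x. list_wedge (\<alpha> x) (\<beta> x) vs) has_derivative
    (\<lambda>v. list_wedge (partial \<alpha> y v) (\<beta> y) vs + list_wedge (\<alpha> y) (partial \<beta> y v) vs)) (at y)"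
  using assms
proof (induction vs arbitrary: \<alpha> \<beta>)
  case Nil
  show ?case unfolding list_wedge_Nil
    by (rule has_derivative_eq_rhs, rule has_derivative_mult; (rule partial_has_derivative)?)
      (use Nil in \<open>auto simp: algebra_simps\<close>)
next
  case (Cons w ws)
  show ?case unfolding list_wedge_Cons
    by (rule has_derivative_eq_rhs[OF has_derivative_add[OF Cons.IH Cons.IH]])
      (use Cons.prems in \<open>auto simp: family_differentiable_contract family_differentiable_twist partial_contract partial_twist\<close>)
qed

lemma family_differentiable_list_wedge:
  "family_differentiable \<alpha> y \<Longrightarrow> family_differentiable \<beta> y \<Longrightarrow> family_differentiable (\<lambda>x. list_wedge (\<alpha> x) (\<beta> x)) y"
  unfolding family_differentiable_def[of "\<lambda>x. list_wedge (\<alpha> x) (\<beta> x)"] differentiable_def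
  using list_wedge_has_derivative by blast

lemma partial_list_wedge:
  "family_differentiable \<alpha> y \<Longrightarrow> family_differentiable \<beta> y \<Longrightarrow> partial (\<lambda>x. list_wedge (\<alpha> x) (\<beta> x)) y v =
   (\<lambda>vs. list_wedge (partial \<alpha> y v) (\<beta> y) vs + list_wedge (\<alpha> y) (partial \<beta> y v) vs)"
  by (rule ext, rule partial_eqI) (rule list_wedge_has_derivative)

lemma contract_list_d:
  "contract v (list_d \<gamma> y) = (\<lambda>ws. partial \<gamma> y v ws - list_d (\<lambda>x. contract v (\<gamma> x)) y ws)"
  by (rule ext) (simp add: contract_def[of v "list_d _ _"] list_d_Cons)

text \<open>The graded Leibniz rule with \<open>twist\<close> in place of a sign. Contracting both
  sides with the first vector, by Cartan's formula for d and the antiderivation property for the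
  wedge, leaves the product rule for directional derivatives and the same statement for contracted
  factors.\<close>

lemma list_d_list_wedge:
  assumes "family_differentiable \<alpha> y" "family_differentiable \<beta> y"
  shows "list_d (\<lambda>x. list_wedge (\<alpha> x) (\<beta> x)) y vs =
    list_wedge (list_d \<alpha> y) (\<beta> y) vs + list_wedge (twist (\<alpha> y)) (list_d \<beta> y) vs"
  using assms
proof (induction vs arbitrary: \<alpha> \<beta>)
  case Nil
  then show ?case by (simp add: list_d_Nil list_wedge_Nil)
next
  case (Cons v vs)
  note diff = Cons.prems Cons.prems[THEN family_differentiable_contract] Cons.prems[THEN family_differentiable_twist]
  have tw: "list_d (\<lambda>x. twist (\<alpha> x)) y = (\<lambda>ws. - twist (list_d \<alpha> y) ws)"
    using list_d_twist[OF diff(1)] by auto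
  show ?case
    by (simp add: list_d_Cons list_wedge_Cons contract_list_wedge partial_list_wedge list_d_add
        family_differentiable_list_wedge diff Cons.IH contract_list_d list_wedge_diff_left
        list_wedge_diff_right tw list_wedge_minus_left contract_twist)
qed


lemma list_d_cong_open:
  assumes "open S" "y \<in> S" "\<And>x. x \<in> S \<Longrightarrow> \<alpha> x = \<beta> x"
  shows "list_d \<alpha> y = list_d \<beta> y"
proof -
  have "partial \<alpha> y = partial \<beta> y"
    unfolding partial_def by (intro ext fun_cong[OF frechet_derivative_cong_open[OF assms(1,2)]]) (simp add: assms(3))
  then show ?thesis by (intro ext) (simp add: list_d_def)
qed

text \<open>Linearity holds at all points near y, and identities on an open set may be
  differentiated.\<close>

lemma multilinear_partial:
  assumes "open S" "y \<in> S" "\<And>x. x \<in> S \<Longrightarrow> multilinear (\<alpha> x)" "family_differentiable \<alpha> y"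
  shows "multilinear (partial \<alpha> y v)"
  unfolding multilinear_def linear_iff
proof (intro allI conjI)
  fix us ws u w and r :: real
  have "((\<lambda>x. \<alpha> x (us @ u # ws) + \<alpha> x (us @ w # ws)) has_derivative
      (\<lambda>v. partial \<alpha> y v (us @ u # ws) + partial \<alpha> y v (us @ w # ws))) (at y)"
    by (rule has_derivative_add; rule partial_has_derivative[OF assms(4)])
  then have "((\<lambda>x. \<alpha> x (us @ (u + w) # ws)) has_derivative
      (\<lambda>v. partial \<alpha> y v (us @ u # ws) + partial \<alpha> y v (us @ w # ws))) (at y)"
    by (subst has_derivative_cong_open[OF assms(1,2)])
      (use multilinearD[OF assms(3)] in \<open>auto simp: linear_iff\<close>)
  then show "partial \<alpha> y v (us @ (u + w) # ws) = partial \<alpha> y v (us @ u # ws) + partial \<alpha> y v (us @ w # ws)"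
    by (rule partial_eqI)
  have "((\<lambda>x. r * \<alpha> x (us @ u # ws)) has_derivative (\<lambda>v. r * partial \<alpha> y v (us @ u # ws))) (at y)"
    by (rule has_derivative_mult_right; rule partial_has_derivative[OF assms(4)])
  then have "((\<lambda>x. \<alpha> x (us @ (r *\<^sub>R u) # ws)) has_derivative (\<lambda>v. r * partial \<alpha> y v (us @ u # ws))) (at y)"
    by (subst has_derivative_cong_open[OF assms(1,2)])
      (use multilinearD[OF assms(3)] in \<open>auto simp: linear_iff\<close>)
  then show "partial \<alpha> y v (us @ r *\<^sub>R u # ws) = r *\<^sub>R partial \<alpha> y v (us @ u # ws)"
    by (simp add: partial_eqI)
qed

lemma linear_partial:
  "family_differentiable \<alpha> y \<Longrightarrow> linear (\<lambda>v. partial \<alpha> y v ws)"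
  unfolding partial_def family_differentiable_def by (simp add: linear_frechet_derivative)

lemma multilinear_list_d:
  assumes S: "open S" "y \<in> S" and "\<And>x. x \<in> S \<Longrightarrow> multilinear (\<alpha> x)" "family_differentiable \<alpha> y"
  shows "multilinear (list_d \<alpha> y)"
proof -
  have "linear (\<lambda>v. list_d \<alpha> y (us @ v # ws))" for us ws
    using assms(3,4)
  proof (induction us arbitrary: \<alpha>)
    case Nil
    have "list_d (\<lambda>x. contract (v + w) (\<alpha> x)) y ws =
        list_d (\<lambda>x. contract v (\<alpha> x)) y ws + list_d (\<lambda>x. contract w (\<alpha> x)) y ws" for v w
      by (subst list_d_cong_open[OF S contract_add[OF Nil(1)]])
        (simp_all add: list_d_add family_differentiable_contract Nil(2))
    moreover have "list_d (\<lambda>x. contract (r *\<^sub>R v) (\<alpha> x)) y ws = r * list_d (\<lambda>x. contract v (\<alpha> x)) y ws" for r v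
      by (subst list_d_cong_open[OF S contract_scale[OF Nil(1)]])
        (simp_all add: list_d_scale family_differentiable_contract Nil(2))
    ultimately have "linear (\<lambda>v. list_d (\<lambda>x. contract v (\<alpha> x)) y ws)" by (simp add: linear_iff)
    then show ?case unfolding append_Nil list_d_Cons
      by (intro linear_compose_sub linear_partial Nil(2))
  next
    case (Cons u us)
    show ?case unfolding append_Cons list_d_Cons
      by (intro linear_compose_sub multilinearD[OF multilinear_partial[OF S]] Cons.IH multilinear_contract
          family_differentiable_contract Cons.prems)
  qed
  then show ?thesis by (simp add: multilinear_def)
qed

lemma alternating_list_d:
  assumes S: "open S" "y \<in> S" and "\<And>x. x \<in> S \<Longrightarrow> alternating (\<alpha> x)" "family_differentiable \<alpha> y"
  shows "alternating (list_d \<alpha> y)"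
proof (rule alternatingI)
  show "multilinear (list_d \<alpha> y)"
    using assms by (intro multilinear_list_d alternating_imp_multilinear)
  show "list_d \<alpha> y (us @ v # v # ws) = 0" for us v ws
    using assms(3,4)
  proof (induction us arbitrary: \<alpha>)
    case Nil
    \<comment> \<open>Applying Cartan's formula twice, the two directional derivatives cancel and d
      of the double contraction with v remains; that contraction is 0 on all of S.\<close>
    have "list_d (\<lambda>x. contract v (contract v (\<alpha> x))) y ws = list_d (\<lambda>x vs. 0) y ws"
      by (subst list_d_cong_open[OF S])
        (use alternating_adjacent[OF Nil(1), of _ "[]" v] in \<open>auto simp: contract_def\<close>)
    also have "\<dots> = 0" by (simp add: list_d_def partial_def)
    finally show ?case by (simp add: list_d_Cons partial_contract) (simp add: contract_def)
  next
    case (Cons u us)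
    have "partial \<alpha> y u (us @ v # v # ws) = 0"
      unfolding partial_def
      by (subst frechet_derivative_cong_open[OF S, of _ "\<lambda>x. 0"])
        (use alternating_adjacent[OF Cons.prems(1)] in auto)
    moreover have "list_d (\<lambda>x. contract u (\<alpha> x)) y (us @ v # v # ws) = 0"
      by (intro Cons.IH alternating_contract family_differentiable_contract Cons.prems)
    ultimately show ?case by (simp add: list_d_Cons)
  qed
qed

section \<open>Smooth families and their pullback between model spaces\<close>

text \<open>The conditions that \<open>forms\<close> imposes within one chart, together with
  openness of the domain, which differentiation requires.\<close>

definition smooth_family :: "'e::fin_dim_inner set \<Rightarrow> ('e \<Rightarrow> 'h::real_vector list \<Rightarrow> real) \<Rightarrow> bool" where
  "smooth_family S \<alpha> \<longleftrightarrow> open S \<and> (\<forall>x\<in>S. alternating (\<alpha> x)) \<and> (\<forall>vs. smooth_on S (\<lambda>x. \<alpha> x vs))"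

lemma smooth_family_differentiable: "smooth_family S \<alpha> \<Longrightarrow> y \<in> S \<Longrightarrow> family_differentiable \<alpha> y"
  unfolding smooth_family_def family_differentiable_def using smooth_on_differentiable by blast

lemma smooth_family_wedge:
  assumes "smooth_family S \<alpha>" "smooth_family S \<beta>"
  shows "smooth_family S (\<lambda>x. list_wedge (\<alpha> x) (\<beta> x))"
  using assms unfolding smooth_family_def
proof (safe intro!: alternating_list_wedge)
  fix vs assume "open S" "\<forall>vs. smooth_on S (\<lambda>x. \<alpha> x vs)" "\<forall>vs. smooth_on S (\<lambda>x. \<beta> x vs)"
  then show "smooth_on S (\<lambda>x. list_wedge (\<alpha> x) (\<beta> x) vs)"
    unfolding list_wedge_def by (intro smooth_on_sum smooth_on_mult smooth_on_const) auto
qed auto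

lemma smooth_family_list_d:
  assumes "smooth_family S \<alpha>"
  shows "smooth_family S (list_d \<alpha>)"
  unfolding smooth_family_def
proof (intro conjI ballI allI)
  show S: "open S" using assms by (simp add: smooth_family_def)
  show "alternating (list_d \<alpha> y)" if "y \<in> S" for y
    by (rule alternating_list_d[OF S that _ smooth_family_differentiable[OF assms that]])
      (use assms in \<open>auto simp: smooth_family_def\<close>)
  have "smooth_on S (\<lambda>x. \<alpha> x vs)" for vs using assms by (simp add: smooth_family_def)
  then show "smooth_on S (\<lambda>y. list_d \<alpha> y vs)" for vs
    unfolding list_d_def partial_def
    by (intro smooth_on_sum smooth_on_mult smooth_on_const smooth_on_derivative S)
qed

text \<open>For multilinear a, the derivative of the value of a as its arguments ws move in the
  directions hs: each summand replaces one argument by its direction.\<close>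

fun slot_sum :: "('h list \<Rightarrow> real) \<Rightarrow> 'h list \<Rightarrow> 'h list \<Rightarrow> real" where
  "slot_sum a (w # ws) (h # hs) = a (h # ws) + slot_sum (contract w a) ws hs"
| "slot_sum a _ _ = 0"

lemma slot_sum_add: "slot_sum (\<lambda>ws. a ws + b ws) ws hs = slot_sum a ws hs + slot_sum b ws hs"
proof (induction ws hs arbitrary: a b rule: list_induct2')
  case (4 w ws h hs)
  have "contract w (\<lambda>ws. a ws + b ws) = (\<lambda>ws. contract w a ws + contract w b ws)"
    by (simp add: contract_def)
  then show ?case by (simp add: 4)
qed auto

lemma slot_sum_scale: "slot_sum (\<lambda>ws. r * a ws) ws hs = r * slot_sum a ws hs"
proof (induction ws hs arbitrary: a rule: list_induct2')
  case (4 w ws h hs)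
  have "contract w (\<lambda>ws. r * a ws) = (\<lambda>ws. r * contract w a ws)"
    by (simp add: contract_def)
  then show ?case by (simp add: 4 algebra_simps)
qed auto

lemma linear_slot_sum_contract:
  "multilinear a \<Longrightarrow> linear (\<lambda>w. slot_sum (contract w a) ws hs)"
  by (simp add: linear_iff contract_add contract_scale slot_sum_add slot_sum_scale)

text \<open>
  The product rule for a multilinear expression with varying arguments: the first argument is
  expanded in a basis, so that the remaining expression has one varying argument less.
\<close>

lemma family_has_derivative:
  fixes \<alpha> :: "'a::fin_dim_inner \<Rightarrow> 'h::fin_dim_inner list \<Rightarrow> real"
  assumes S: "open S" "y \<in> S" and "\<And>x. x \<in> S \<Longrightarrow> multilinear (\<alpha> x)" "family_differentiable \<alpha> y"
    and us: "list_all2 (\<lambda>u u'. (u has_derivative u') (at y)) us us'"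
  shows "((\<lambda>x. \<alpha> x (map (\<lambda>u. u x) us)) has_derivative
    (\<lambda>v. partial \<alpha> y v (map (\<lambda>u. u y) us) +
      slot_sum (\<alpha> y) (map (\<lambda>u. u y) us) (map (\<lambda>u'. u' v) us'))) (at y)"
  using us assms(3,4)
proof (induction arbitrary: \<alpha> rule: list_all2_induct)
  case Nil
  then show ?case by (simp add: partial_has_derivative)
next
  case (Cons u us u' us')
  note mult = Cons.prems(1)
  let ?us = "\<lambda>x. map (\<lambda>u. u x) us" and ?us' = "\<lambda>v. map (\<lambda>u'. u' v) us'"
  have "((\<lambda>x. \<Sum>b\<in>basis. coord b (u x) * contract b (\<alpha> x) (?us x)) has_derivative
      (\<lambda>v. \<Sum>b\<in>basis. coord b (u y) * (partial (\<lambda>x. contract b (\<alpha> x)) y v (?us y) +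
         slot_sum (contract b (\<alpha> y)) (?us y) (?us' v)) +
         coord b (u' v) * contract b (\<alpha> y) (?us y))) (at y)"
    by (intro has_derivative_sum has_derivative_mult Cons.IH multilinear_contract
        family_differentiable_contract Cons.prems)
      (rule bounded_linear.has_derivative[OF bounded_linear_coord Cons.hyps(1)])
  then have "((\<lambda>x. \<alpha> x (u x # ?us x)) has_derivative
      (\<lambda>v. \<Sum>b\<in>basis. coord b (u y) * (partial (\<lambda>x. contract b (\<alpha> x)) y v (?us y) +
         slot_sum (contract b (\<alpha> y)) (?us y) (?us' v)) +
         coord b (u' v) * contract b (\<alpha> y) (?us y))) (at y)"
    by (subst has_derivative_cong_open[OF S])
      (use linear_basis_expansion[OF multilinear_Cons[OF mult]] in \<open>auto simp: contract_def\<close>)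
  moreover have "(\<Sum>b\<in>basis. coord b (u y) * (partial (\<lambda>x. contract b (\<alpha> x)) y v (?us y) +
         slot_sum (contract b (\<alpha> y)) (?us y) (?us' v)) +
         coord b (u' v) * contract b (\<alpha> y) (?us y)) =
       partial \<alpha> y v (u y # ?us y) + (\<alpha> y (u' v # ?us y) +
       slot_sum (contract (u y) (\<alpha> y)) (?us y) (?us' v))" for v
  proof -
    have "partial \<alpha> y v (u y # ?us y) =
        (\<Sum>b\<in>basis. coord b (u y) *\<^sub>R partial \<alpha> y v (b # ?us y))"
      by (rule linear_basis_expansion[OF multilinear_Cons[OF multilinear_partial[OF S mult Cons.prems(2)]]])
    moreover have "\<alpha> y (u' v # ?us y) = (\<Sum>b\<in>basis. coord b (u' v) *\<^sub>R \<alpha> y (b # ?us y))"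
      by (rule linear_basis_expansion[OF multilinear_Cons[OF mult[OF S(2)]]])
    moreover have "slot_sum (contract (u y) (\<alpha> y)) (?us y) (?us' v) =
        (\<Sum>b\<in>basis. coord b (u y) *\<^sub>R slot_sum (contract b (\<alpha> y)) (?us y) (?us' v))"
      by (rule linear_basis_expansion[OF linear_slot_sum_contract[OF mult[OF S(2)]]])
    moreover have "partial (\<lambda>x. contract b (\<alpha> x)) y v ws = partial \<alpha> y v (b # ws)"
      "contract b (\<alpha> y) ws = \<alpha> y (b # ws)" for b ws
      by (simp_all add: partial_contract) (simp_all add: contract_def)
    ultimately show ?thesis
      by (simp only: real_scaleR_def distrib_left sum.distrib add.assoc add.commute add.left_commute)
  qed
  ultimately show ?case by simp
qed

text \<open>The counterpart of \<open>family_has_derivative\<close> for smoothness, by the same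
  expansion of the first argument. A pulled back form is of this kind: it evaluates a form at the
  moving vectors D\<phi>(x) w.\<close>

lemma smooth_on_family:
  fixes \<alpha> :: "'a::fin_dim_inner \<Rightarrow> 'h::fin_dim_inner list \<Rightarrow> real"
  assumes S: "open S" and "\<And>x. x \<in> S \<Longrightarrow> multilinear (\<alpha> x)" "\<And>vs. smooth_on S (\<lambda>x. \<alpha> x vs)"
    and us: "\<And>u. u \<in> set us \<Longrightarrow> smooth_on S u"
  shows "smooth_on S (\<lambda>x. \<alpha> x (map (\<lambda>u. u x) us))"
  using us assms(2,3)
proof (induction us arbitrary: \<alpha>)
  case Nil
  then show ?case by simp
next
  case (Cons u us)
  have "smooth_on S (\<lambda>x. \<Sum>b\<in>basis. coord b (u x) * contract b (\<alpha> x) (map (\<lambda>u. u x) us))"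
  proof (intro smooth_on_sum smooth_on_mult S)
    fix b :: 'h
    show "smooth_on S (\<lambda>x. coord b (u x))"
      by (rule smooth_on_linear[OF S bounded_linear_coord]) (simp add: Cons.prems)
    show "smooth_on S (\<lambda>x. contract b (\<alpha> x) (map (\<lambda>u. u x) us))"
    proof (rule Cons.IH)
      show "smooth_on S (\<lambda>x. contract b (\<alpha> x) vs)" for vs
        using Cons.prems(3) by (simp add: contract_def)
    qed (simp_all add: Cons.prems multilinear_contract)
  qed
  then show ?case
    by (subst smooth_on_cong[OF S])
      (use linear_basis_expansion[OF multilinear_Cons[OF Cons.prems(2)]] in \<open>auto simp: contract_def\<close>)
qed

text \<open>The coordinate expression of a pullback, free of the domain condition and of the choice
  of a target chart that are built into \<open>pullback\<close>.\<close>

definition pull :: "('a::real_normed_vector \<Rightarrow> 'h::real_normed_vector) \<Rightarrow> ('h \<Rightarrow> 'h list \<Rightarrow> real) \<Rightarrow> 'a \<Rightarrow> 'a list \<Rightarrow> real" where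
  "pull \<phi> \<alpha> x ws = \<alpha> (\<phi> x) (map (frechet_derivative \<phi> (at x)) ws)"

definition omit :: "nat \<Rightarrow> 'a list \<Rightarrow> 'a list" where
  "omit i vs = take i vs @ drop (Suc i) vs"

lemma omit_0_Cons [simp]: "omit 0 (v # vs) = vs"
  and omit_Suc_Cons [simp]: "omit (Suc i) (v # vs) = v # omit i vs"
  by (simp_all add: omit_def)

lemma map_omit: "map f (omit i vs) = omit i (map f vs)"
  by (simp add: omit_def take_map drop_map)

text \<open>The replaced argument is moved to the front past the j arguments before it.\<close>

lemma slot_sum_alternating:
  assumes "alternating a" "length hs = length ws"
  shows "slot_sum a ws hs = (\<Sum>j<length ws. (-1) ^ j * a (hs ! j # omit j ws))"
  using assms
proof (induction ws arbitrary: a hs)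
  case (Cons w ws)
  then obtain h hs' where hs: "hs = h # hs'" by (cases hs) auto
  have swap: "a (w # u # us) = - a (u # w # us)" for u us
    using alternating_move[OF Cons.prems(1), of "[w]" u us] by simp
  have "slot_sum (contract w a) ws hs' = (\<Sum>j<length ws. (-1) ^ j * contract w a (hs' ! j # omit j ws))"
    using Cons hs by (simp add: alternating_contract)
  also have "\<dots> = - (\<Sum>j<length ws. (-1) ^ j * a (hs' ! j # w # omit j ws))"
    by (simp add: contract_def swap sum_negf)
  finally show ?case
    unfolding hs by (simp add: sum.lessThan_Suc_shift sum_negf del: sum.lessThan_Suc)
qed simp

text \<open>Here h stands for the second derivative of the map and L for the first. The
  contributions of (i, j) and (j, i) are opposite. The induction cancels the pairs containing the
  first vector and leaves the others to the contracted function.\<close>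

lemma slot_sum_cancel:
  assumes "alternating a" and sym: "\<And>v w. h v w = h w v"
  shows "(\<Sum>i<length vs. (-1) ^ i * slot_sum a (map L (omit i vs)) (map (h (vs ! i)) (omit i vs))) = 0"
  using assms(1)
proof (induction vs arbitrary: a)
  case (Cons v vs)
  have "slot_sum a (map L vs) (map (h v) vs) = (\<Sum>j<length vs. (-1) ^ j * a (h v (vs ! j) # map L (omit j vs)))"
    by (subst slot_sum_alternating[OF Cons.prems]) (simp_all add: map_omit)
  moreover have "(\<Sum>i<length vs. (-1) ^ i * slot_sum (contract (L v) a) (map L (omit i vs)) (map (h (vs ! i)) (omit i vs))) = 0"
    by (rule Cons.IH[OF alternating_contract[OF Cons.prems]])
  ultimately show ?case
    by (simp add: sum.lessThan_Suc_shift sum_negf sum_subtractf sum.distrib distrib_left sym[of _ v] del: sum.lessThan_Suc)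
qed simp

lemma multilinear_map:
  assumes "linear L" "multilinear a"
  shows "multilinear (\<lambda>ws. a (map L ws))"
  using linear_compose[OF assms(1) multilinearD[OF assms(2)]] by (simp add: multilinear_def o_def)

lemma alternating_map:
  assumes "linear L" "alternating a"
  shows "alternating (\<lambda>ws. a (map L ws))"
  by (rule alternatingI)
    (simp_all add: multilinear_map alternating_imp_multilinear alternating_adjacent assms)

lemma family_differentiable_compose:
  assumes "family_differentiable \<alpha> (\<phi> y)" "(\<phi> has_derivative \<phi>') (at y)"
  shows "family_differentiable (\<lambda>x. \<alpha> (\<phi> x)) y"
    and "partial (\<lambda>x. \<alpha> (\<phi> x)) y v = partial \<alpha> (\<phi> y) (\<phi>' v)"
proof -
  have D: "((\<lambda>x. \<alpha> (\<phi> x) vs) has_derivative (\<lambda>v. partial \<alpha> (\<phi> y) (\<phi>' v) vs)) (at y)" for vs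
    by (rule has_derivative_compose[OF assms(2) partial_has_derivative[OF assms(1)]])
  then show "family_differentiable (\<lambda>x. \<alpha> (\<phi> x)) y"
    unfolding family_differentiable_def differentiable_def by blast
  show "partial (\<lambda>x. \<alpha> (\<phi> x)) y v = partial \<alpha> (\<phi> y) (\<phi>' v)"
    by (rule ext) (rule partial_eqI[OF D])
qed

lemma smooth_family_pull:
  fixes \<phi> :: "'a::fin_dim_inner \<Rightarrow> 'h::fin_dim_inner"
  assumes \<alpha>: "smooth_family T \<alpha>" and S: "open S" and \<phi>: "smooth_on S \<phi>" "\<phi> ` S \<subseteq> T"
  shows "smooth_family S (pull \<phi> \<alpha>)"
  unfolding smooth_family_def
proof (intro conjI ballI allI S)
  have alt: "alternating (\<alpha> (\<phi> x))" if "x \<in> S" for x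
    using that \<alpha> \<phi> by (auto simp: smooth_family_def)
  show "alternating (pull \<phi> \<alpha> x)" if "x \<in> S" for x
    using alternating_map[OF linear_frechet_derivative[OF smooth_on_differentiable[OF \<phi>(1) that]] alt[OF that]]
    unfolding pull_def .
  show "smooth_on S (\<lambda>x. pull \<phi> \<alpha> x ws)" for ws
  proof -
    have "smooth_on S (\<lambda>x. \<alpha> (\<phi> x) (map (\<lambda>u. u x) (map (\<lambda>w x. frechet_derivative \<phi> (at x) w) ws)))"
    proof (rule smooth_on_family[OF S])
      show "smooth_on S (\<lambda>x. \<alpha> (\<phi> x) vs)" for vs
        by (rule smooth_on_compose[OF S \<phi>(2) _ \<phi>(1)]) (use \<alpha> in \<open>auto simp: smooth_family_def\<close>)
    qed (auto intro: alternating_imp_multilinear alt smooth_on_derivative[OF \<phi>(1)])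
    then show ?thesis by (simp add: pull_def o_def)
  qed
qed

text \<open>
  The terms with second derivatives of \<open>\<phi>\<close> cancel, because the second derivative is symmetric
  and \<open>\<alpha>\<close> is alternating.
\<close>

lemma list_d_pull:
  fixes \<phi> :: "'a::fin_dim_inner \<Rightarrow> 'h::fin_dim_inner"
  assumes \<alpha>: "smooth_family T \<alpha>" and S: "open S" and \<phi>: "smooth_on S \<phi>" "\<phi> ` S \<subseteq> T" and y: "y \<in> S"
  shows "list_d (pull \<phi> \<alpha>) y vs = pull \<phi> (list_d \<alpha>) y vs"
proof -
  let ?L = "frechet_derivative \<phi> (at y)"
  define h where "h v w = frechet_derivative (\<lambda>x. frechet_derivative \<phi> (at x) w) (at y) v" for v w
  have alt: "alternating (\<alpha> (\<phi> x))" if "x \<in> S" for x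
    using that \<alpha> \<phi> by (auto simp: smooth_family_def)
  have diff: "family_differentiable \<alpha> (\<phi> y)"
    using smooth_family_differentiable[OF \<alpha>] \<phi>(2) y by blast
  note comp = family_differentiable_compose[OF diff smooth_on_has_derivative[OF \<phi>(1) y]]
  have part: "partial (pull \<phi> \<alpha>) y v ws =
      partial \<alpha> (\<phi> y) (?L v) (map ?L ws) + slot_sum (\<alpha> (\<phi> y)) (map ?L ws) (map (h v) ws)" for v ws
  proof -
    let ?us = "map (\<lambda>w x. frechet_derivative \<phi> (at x) w) ws" and ?us' = "map (\<lambda>w v. h v w) ws"
    have "((\<lambda>x. \<alpha> (\<phi> x) (map (\<lambda>u. u x) ?us)) has_derivative
      (\<lambda>v. partial (\<lambda>x. \<alpha> (\<phi> x)) y v (map (\<lambda>u. u y) ?us) +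
        slot_sum (\<alpha> (\<phi> y)) (map (\<lambda>u. u y) ?us) (map (\<lambda>u'. u' v) ?us'))) (at y)"
    proof (rule family_has_derivative[OF S y alternating_imp_multilinear[OF alt] comp(1)])
      show "list_all2 (\<lambda>u u'. (u has_derivative u') (at y)) ?us ?us'"
        unfolding list_all2_conv_all_nth h_def
        using smooth_on_has_derivative[OF smooth_on_derivative[OF \<phi>(1)] y] by auto
    qed
    then have "((\<lambda>x. pull \<phi> \<alpha> x ws) has_derivative
      (\<lambda>v. partial \<alpha> (\<phi> y) (?L v) (map ?L ws) + slot_sum (\<alpha> (\<phi> y)) (map ?L ws) (map (h v) ws))) (at y)"
      by (simp add: pull_def o_def comp(2))
    then show ?thesis by (rule partial_eqI)
  qed
  have "h v w = h w v" for v w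
    unfolding h_def by (rule symmetric_second_derivative[OF S \<phi>(1) y])
  then have "(\<Sum>i<length vs. (-1) ^ i *
      slot_sum (\<alpha> (\<phi> y)) (map ?L (omit i vs)) (map (h (vs ! i)) (omit i vs))) = 0"
    by (rule slot_sum_cancel[OF alt[OF y]])
  then show ?thesis
    by (simp add: list_d_def pull_def part flip: omit_def) (simp add: distrib_left sum.distrib map_omit)
qed


subsection \<open>Forms and smooth maps in charts\<close>

lemma smooth_manifold_chart:
  assumes "smooth_manifold A" "c \<in> A"
  shows chart_openin: "openin (top_of_set (carrier_of A)) (fst c)"
    and open_chart_image: "open (chart_image c)"
    and chart_homeomorphism: "homeomorphism (fst c) (chart_image c) (snd c) (chart_inv c)"
  using assms by (auto simp: smooth_manifold_def)

lemma chart_subset_carrier: "c \<in> A \<Longrightarrow> fst c \<subseteq> carrier_of A"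
  by (auto simp: carrier_of_def)

lemma carrier_ofE:
  assumes "z \<in> carrier_of A"
  obtains c where "c \<in> A" "z \<in> fst c"
  using assms by (auto simp: carrier_of_def)

lemma chart_inv_snd [simp]:
  "smooth_manifold A \<Longrightarrow> c \<in> A \<Longrightarrow> z \<in> fst c \<Longrightarrow> chart_inv c (snd c z) = z"
  using chart_homeomorphism by (metis homeomorphism_apply1)

lemma chart_inv_into: "y \<in> chart_image c \<Longrightarrow> chart_inv c y \<in> fst c"
  by (simp add: chart_image_def chart_inv_def inv_into_into)

lemma snd_chart_inv: "y \<in> chart_image c \<Longrightarrow> snd c (chart_inv c y) = y"
  by (simp add: chart_image_def chart_inv_def f_inv_into_f)

lemma snd_in_chart_image: "z \<in> fst c \<Longrightarrow> snd c z \<in> chart_image c"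
  by (simp add: chart_image_def)

lemma open_chart_image_Int:
  assumes "smooth_manifold A" "c \<in> A" "openin (top_of_set (carrier_of A)) W"
  shows "open (snd c ` (fst c \<inter> W))"
proof -
  have "openin (top_of_set (fst c)) (fst c \<inter> W)"
    using assms(3) chart_subset_carrier[OF assms(2)] by (auto simp: openin_open)
  then have "openin (top_of_set (chart_image c)) (snd c ` (fst c \<inter> W))"
    by (rule homeomorphism_imp_open_map[OF chart_homeomorphism[OF assms(1,2)]])
  then show ?thesis using open_chart_image[OF assms(1,2)] by (simp add: openin_open_eq)
qed

definition chart_domain :: "('p, 'e) chart \<Rightarrow> ('q, 'h) chart \<Rightarrow> ('p \<Rightarrow> 'q) \<Rightarrow> 'e set" where
  "chart_domain c c' f = snd c ` {z \<in> fst c. f z \<in> fst c'}"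

text \<open>What pulling back forms requires, expressed in charts. In contrast to
  \<open>smooth_map\<close> it concerns the whole carrier and involves no local extensions.\<close>

definition manifold_map ::
  "('p, 'e::fin_dim_inner) atlas \<Rightarrow> ('q, 'h::fin_dim_inner) atlas \<Rightarrow> ('p \<Rightarrow> 'q) \<Rightarrow> bool" where
  "manifold_map A A' f \<longleftrightarrow> f ` carrier_of A \<subseteq> carrier_of A' \<and>
     (\<forall>c\<in>A. \<forall>c'\<in>A'. open (chart_domain c c' f) \<and> smooth_on (chart_domain c c' f) (in_charts c c' f))"

lemma manifold_mapD:
  assumes "manifold_map A A' f" "c \<in> A" "c' \<in> A'"
  shows "open (chart_domain c c' f)" "smooth_on (chart_domain c c' f) (in_charts c c' f)"
  using assms by (auto simp: manifold_map_def)

lemma chart_domain_subset: "chart_domain c c' f \<subseteq> chart_image c"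
  by (auto simp: chart_domain_def chart_image_def)

lemma in_chart_domain_iff:
  assumes "smooth_manifold A" "c \<in> A"
  shows "y \<in> chart_domain c c' f \<longleftrightarrow> y \<in> chart_image c \<and> f (chart_inv c y) \<in> fst c'"
proof
  assume "y \<in> chart_domain c c' f"
  then show "y \<in> chart_image c \<and> f (chart_inv c y) \<in> fst c'"
    using assms by (auto simp: chart_domain_def chart_image_def)
next
  assume y: "y \<in> chart_image c \<and> f (chart_inv c y) \<in> fst c'"
  then have "y = snd c (chart_inv c y)" "chart_inv c y \<in> fst c"
    by (auto simp: snd_chart_inv chart_inv_into)
  then show "y \<in> chart_domain c c' f" using y unfolding chart_domain_def by blast
qed

lemma in_charts_chart_domain:
  assumes "smooth_manifold A" "c \<in> A" "smooth_manifold A'" "c' \<in> A'" "y \<in> chart_domain c c' f"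
  shows "in_charts c c' f y \<in> chart_image c'" "chart_inv c' (in_charts c c' f y) = f (chart_inv c y)"
  using assms by (auto simp: in_chart_domain_iff[OF assms(1,2)] in_charts_def snd_in_chart_image)

text \<open>The chart expressions of \<open>id\<close> are the coordinate changes. Thus the
  compatibility condition in \<open>forms\<close> becomes a statement about pulling back along a
  map.\<close>

lemma manifold_map_id:
  assumes "smooth_manifold A"
  shows "manifold_map A A id"
proof -
  have "chart_domain c c' id = snd c ` (fst c \<inter> fst c')" for c c' :: "('a, 'b) chart"
    by (auto simp: chart_domain_def)
  then show ?thesis
    using assms open_chart_image_Int[OF assms _ chart_openin[OF assms]]
    by (auto simp: manifold_map_def smooth_manifold_def)
qed

text \<open>Functoriality at one point: near y the chart expression of g \<circ> f is the composite
  of the chart expressions, so the chain rule applies.\<close>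

lemma pull_in_charts_compose:
  assumes A: "smooth_manifold A" "c \<in> A" and A': "smooth_manifold A'" "c' \<in> A'" and c'': "c'' \<in> A''"
    and f: "manifold_map A A' f" and g: "manifold_map A' A'' g"
    and y: "y \<in> chart_image c" "f (chart_inv c y) \<in> fst c'" "g (f (chart_inv c y)) \<in> fst c''"
  shows "pull (in_charts c c'' (g \<circ> f)) \<alpha> y = pull (in_charts c c' f) (pull (in_charts c' c'' g) \<alpha>) y"
proof -
  let ?F = "in_charts c c' f" and ?G = "in_charts c' c'' g"
  have yF: "y \<in> chart_domain c c' f" using y by (simp add: in_chart_domain_iff[OF A])
  have eq: "in_charts c c'' (g \<circ> f) x = ?G (?F x)" if "x \<in> chart_domain c c' f" for x
    using in_charts_chart_domain(2)[OF A A' that] by (simp add: in_charts_def)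
  have "?F y \<in> chart_domain c' c'' g"
    using in_charts_chart_domain[OF A A' yF] y by (simp add: in_chart_domain_iff[OF A'])
  then have "((\<lambda>x. ?G (?F x)) has_derivative
      (\<lambda>v. frechet_derivative ?G (at (?F y)) (frechet_derivative ?F (at y) v))) (at y)"
    by (intro has_derivative_compose[OF smooth_on_has_derivative[OF manifold_mapD(2)[OF f A(2) A'(2)] yF]
          smooth_on_has_derivative[OF manifold_mapD(2)[OF g A'(2) c'']]])
  then have D: "(in_charts c c'' (g \<circ> f) has_derivative
      (\<lambda>v. frechet_derivative ?G (at (?F y)) (frechet_derivative ?F (at y) v))) (at y)"
    by (subst has_derivative_cong_open[OF manifold_mapD(1)[OF f A(2) A'(2)] yF eq])
  show ?thesis
    by (intro ext) (simp only: pull_def frechet_derivative_eqI[OF D] eq[OF yF] map_map, simp add: o_def)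
qed

lemma formsD:
  assumes "\<omega> \<in> forms A" "smooth_manifold A" "c \<in> A"
  shows forms_smooth_family: "smooth_family (chart_image c) (\<omega> c)"
    and forms_compatible: "c' \<in> A \<Longrightarrow> y \<in> chart_domain c c' id \<Longrightarrow> \<omega> c y = pull (in_charts c c' id) (\<omega> c') y"
proof -
  show "smooth_family (chart_image c) (\<omega> c)"
    using assms open_chart_image[OF assms(2,3)] by (simp add: forms_def smooth_family_def)
  assume c': "c' \<in> A" "y \<in> chart_domain c c' id"
  then obtain z where z: "z \<in> fst c \<inter> fst c'" "y = snd c z" by (auto simp: chart_domain_def)
  then have "\<omega> c (snd c z) vs = \<omega> c' (snd c' z) (map (chart_deriv c c' id (snd c z)) vs)" for vs
    using assms c' unfolding forms_def by blast
  then show "\<omega> c y = pull (in_charts c c' id) (\<omega> c') y"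
    using assms z by (intro ext) (simp add: pull_def in_charts_def[of c c' id] chart_deriv_def)
qed

lemma forms_outside: "\<omega> \<in> forms A \<Longrightarrow> \<not> (c \<in> A \<and> y \<in> chart_image c) \<Longrightarrow> \<omega> c y = (\<lambda>_. 0)"
  by (rule ext) (unfold forms_def mem_Collect_eq, blast)

lemma formsI:
  assumes A: "smooth_manifold A"
    and "\<And>c y. \<not> (c \<in> A \<and> y \<in> chart_image c) \<Longrightarrow> \<omega> c y = (\<lambda>_. 0)"
    and "\<And>c. c \<in> A \<Longrightarrow> smooth_family (chart_image c) (\<omega> c)"
    and "\<And>c c' y. c \<in> A \<Longrightarrow> c' \<in> A \<Longrightarrow> y \<in> chart_domain c c' id \<Longrightarrow> \<omega> c y = pull (in_charts c c' id) (\<omega> c') y"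
  shows "\<omega> \<in> forms A"
  unfolding forms_def
proof (intro CollectI conjI allI ballI impI)
  show "\<omega> c y vs = 0" if "\<not> (c \<in> A \<and> y \<in> chart_image c)" for c y vs
    using assms(2)[OF that] by simp
  fix c assume c: "c \<in> A"
  then show "alternating (\<omega> c y)" if "y \<in> chart_image c" for y
    using assms(3) that by (simp add: smooth_family_def)
  show "smooth_on (chart_image c) (\<lambda>y. \<omega> c y vs)" for vs
    using assms(3) c by (simp add: smooth_family_def)
  fix c' z vs assume c': "c' \<in> A" and z: "z \<in> fst c \<inter> fst c'"
  have "snd c z \<in> chart_domain c c' id" using z by (auto simp: chart_domain_def)
  from assms(4)[OF c c' this]
  show "\<omega> c (snd c z) vs = \<omega> c' (snd c' z) (map (chart_deriv c c' id (snd c z)) vs)"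
    using A c z by (simp add: pull_def in_charts_def[of c c' id] chart_deriv_def)
qed

text \<open>\<open>pullback\<close> picks a chart around the image point by choice, possibly a
  different one for each point. Compatibility of \<omega> lets the fixed chart c' replace all of
  them, after which the pullback can be differentiated.\<close>

lemma pullback_eq_pull:
  assumes A: "smooth_manifold A" "c \<in> A" and A': "smooth_manifold A'" "c' \<in> A'"
    and f: "manifold_map A A' f" and \<omega>: "\<omega> \<in> forms A'"
    and y: "y \<in> chart_domain c c' f"
  shows "pullback A A' f \<omega> c y = pull (in_charts c c' f) (\<omega> c') y"
proof -
  have y': "y \<in> chart_image c" "f (chart_inv c y) \<in> fst c'"
    using y by (simp_all add: in_chart_domain_iff[OF A])
  define d where "d = (SOME c'. c' \<in> A' \<and> f (chart_inv c y) \<in> fst c')"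
  have d: "d \<in> A'" "f (chart_inv c y) \<in> fst d"
    using someI[of "\<lambda>c'. c' \<in> A' \<and> f (chart_inv c y) \<in> fst c'"] A' y' unfolding d_def by blast+
  have "y \<in> chart_domain c d f" using y' d by (simp add: in_chart_domain_iff[OF A])
  note F = in_charts_chart_domain[OF A A'(1) d(1) this]
  have "pullback A A' f \<omega> c y = pull (in_charts c d f) (\<omega> d) y"
    using A y' by (simp add: pullback_def pull_def Let_def chart_deriv_def in_charts_def d_def[symmetric] fun_eq_iff)
  also have "\<dots> = pull (in_charts c d f) (pull (in_charts d c' id) (\<omega> c')) y"
  proof -
    have "\<omega> d (in_charts c d f y) = pull (in_charts d c' id) (\<omega> c') (in_charts c d f y)"
      by (rule forms_compatible[OF \<omega> A'(1) d(1) A'(2)])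
        (use F y' in \<open>simp add: in_chart_domain_iff[OF A'(1) d(1)]\<close>)
    then show ?thesis by (simp add: pull_def fun_eq_iff)
  qed
  also have "\<dots> = pull (in_charts c c' (id \<circ> f)) (\<omega> c') y"
    by (rule pull_in_charts_compose[OF A A'(1) d(1) A'(2) f manifold_map_id[OF A'(1)], symmetric])
      (use y' d in auto)
  finally show ?thesis by simp
qed

text \<open>One target chart need not serve a whole source chart, so a pullback is given by
  different expressions near different points.\<close>

lemma smooth_family_local:
  assumes "open S" "\<And>y. y \<in> S \<Longrightarrow> \<exists>T \<beta>. y \<in> T \<and> smooth_family T \<beta> \<and> (\<forall>x\<in>T. \<alpha> x = \<beta> x)"
  shows "smooth_family S \<alpha>"
  unfolding smooth_family_def
proof (intro conjI ballI allI assms(1))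
  show "alternating (\<alpha> y)" if "y \<in> S" for y
    using assms(2)[OF that] by (metis smooth_family_def)
  show "smooth_on S (\<lambda>x. \<alpha> x vs)" for vs
  proof (rule smooth_on_local)
    fix y assume "y \<in> S"
    then obtain T \<beta> where T: "y \<in> T" "smooth_family T \<beta>" "\<forall>x\<in>T. \<alpha> x = \<beta> x"
      using assms(2) by blast
    then have "smooth_on T (\<lambda>x. \<alpha> x vs) \<longleftrightarrow> smooth_on T (\<lambda>x. \<beta> x vs)"
      by (intro smooth_on_cong) (auto simp: smooth_family_def)
    then show "\<exists>T. open T \<and> y \<in> T \<and> smooth_on T (\<lambda>x. \<alpha> x vs)"
      using T by (auto simp: smooth_family_def)
  qed
qed

lemma in_charts_image_subset:
  assumes "smooth_manifold A" "c \<in> A" "smooth_manifold A'" "c' \<in> A'"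
  shows "in_charts c c' f ` chart_domain c c' f \<subseteq> chart_image c'"
  using in_charts_chart_domain(1)[OF assms] by blast

lemma manifold_map_chart:
  assumes "manifold_map A A' f" "smooth_manifold A" "c \<in> A" "y \<in> chart_image c"
  obtains c' where "c' \<in> A'" "y \<in> chart_domain c c' f"
proof -
  have "f (chart_inv c y) \<in> carrier_of A'"
    using assms(1) chart_inv_into[OF assms(4)] chart_subset_carrier[OF assms(3)]
    unfolding manifold_map_def by blast
  then obtain c' where "c' \<in> A'" "f (chart_inv c y) \<in> fst c'" by (rule carrier_ofE)
  then show ?thesis using that assms by (simp add: in_chart_domain_iff[OF assms(2,3)])
qed

lemma pullback_forms:
  assumes A: "smooth_manifold A" and A': "smooth_manifold A'" and f: "manifold_map A A' f" and \<omega>: "\<omega> \<in> forms A'"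
  shows "pullback A A' f \<omega> \<in> forms A"
proof (rule formsI[OF A])
  show "pullback A A' f \<omega> c y = (\<lambda>_. 0)" if "\<not> (c \<in> A \<and> y \<in> chart_image c)" for c y
    using that by (auto simp: pullback_def)
  fix c assume c: "c \<in> A"
  show "smooth_family (chart_image c) (pullback A A' f \<omega> c)"
  proof (rule smooth_family_local[OF open_chart_image[OF A c]])
    fix y assume "y \<in> chart_image c"
    then obtain c' where c': "c' \<in> A'" "y \<in> chart_domain c c' f"
      by (rule manifold_map_chart[OF f A c])
    have "smooth_family (chart_domain c c' f) (pull (in_charts c c' f) (\<omega> c'))"
      by (rule smooth_family_pull[OF forms_smooth_family[OF \<omega> A' c'(1)] manifold_mapD[OF f c c'(1)]
            in_charts_image_subset[OF A c A' c'(1)]])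
    then show "\<exists>T \<beta>. y \<in> T \<and> smooth_family T \<beta> \<and> (\<forall>x\<in>T. pullback A A' f \<omega> c x = \<beta> x)"
      using c'(2) pullback_eq_pull[OF A c A' c'(1) f \<omega>] by blast
  qed
  fix c1 y assume c1: "c1 \<in> A" and y: "y \<in> chart_domain c c1 id"
  have y': "y \<in> chart_image c" "chart_inv c y \<in> fst c1"
    using y by (simp_all add: in_chart_domain_iff[OF A c])
  \<comment> \<open>The same target chart for both source charts; the two pullbacks are computed in
    it and compared by functoriality.\<close>
  then obtain c' where c': "c' \<in> A'" "y \<in> chart_domain c c' f"
    using manifold_map_chart[OF f A c] by metis
  have "in_charts c c1 id y \<in> chart_domain c1 c' f"
    using c'(2) in_charts_chart_domain[OF A c A c1 y]
    by (simp add: in_chart_domain_iff[OF A c] in_chart_domain_iff[OF A c1])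
  then have "pullback A A' f \<omega> c1 (in_charts c c1 id y) = pull (in_charts c1 c' f) (\<omega> c') (in_charts c c1 id y)"
    by (rule pullback_eq_pull[OF A c1 A' c'(1) f \<omega>])
  then have "pull (in_charts c c1 id) (pullback A A' f \<omega> c1) y = pull (in_charts c c1 id) (pull (in_charts c1 c' f) (\<omega> c')) y"
    by (simp add: pull_def fun_eq_iff)
  also have "\<dots> = pull (in_charts c c' (f \<circ> id)) (\<omega> c') y"
    by (rule pull_in_charts_compose[OF A c A c1 c'(1) manifold_map_id[OF A] f, symmetric])
      (use y' c' in \<open>auto simp: in_chart_domain_iff[OF A c]\<close>)
  also have "\<dots> = pullback A A' f \<omega> c y"
    using pullback_eq_pull[OF A c A' c'(1) f \<omega> c'(2)] by simp
  finally show "pullback A A' f \<omega> c y = pull (in_charts c c1 id) (pullback A A' f \<omega> c1) y" by simp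
qed

text \<open>Stated for any \<alpha> that agrees with the coordinate pullback, so as to serve twice:
  with f = id and the form itself it gives compatibility of d\<omega>, with a
  \<open>pullback\<close> it gives naturality of d.\<close>

lemma ext_d_in_charts:
  assumes A: "smooth_manifold A" "c \<in> A" and A': "smooth_manifold A'" "c' \<in> A'"
    and f: "manifold_map A A' f" and \<omega>: "\<omega> \<in> forms A'"
    and y: "y \<in> chart_domain c c' f"
    and \<alpha>: "\<And>x. x \<in> chart_domain c c' f \<Longrightarrow> \<alpha> x = pull (in_charts c c' f) (\<omega> c') x"
  shows "list_d \<alpha> y = pull (in_charts c c' f) (ext_d A' \<omega> c') y"
proof -
  note F = manifold_mapD[OF f A(2) A'(2)]
  have "list_d \<alpha> y = list_d (pull (in_charts c c' f) (\<omega> c')) y"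
    by (rule list_d_cong_open[OF F(1) y \<alpha>])
  also have "\<dots> = pull (in_charts c c' f) (list_d (\<omega> c')) y"
    using list_d_pull[OF forms_smooth_family[OF \<omega> A'] F in_charts_image_subset[OF A A'] y] by blast
  also have "\<dots> = pull (in_charts c c' f) (ext_d A' \<omega> c') y"
    using ext_d_eq_list_d[OF A'(2) in_charts_chart_domain(1)[OF A A' y]] by (simp add: pull_def fun_eq_iff)
  finally show ?thesis .
qed

lemma ext_d_forms:
  assumes A: "smooth_manifold A" and \<omega>: "\<omega> \<in> forms A"
  shows "ext_d A \<omega> \<in> forms A"
proof (rule formsI[OF A])
  show "ext_d A \<omega> c y = (\<lambda>_. 0)" if "\<not> (c \<in> A \<and> y \<in> chart_image c)" for c y
    using that by (auto simp: ext_d_def)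
  fix c assume c: "c \<in> A"
  show "smooth_family (chart_image c) (ext_d A \<omega> c)"
    by (rule smooth_family_local[OF open_chart_image[OF A c]])
      (use smooth_family_list_d[OF forms_smooth_family[OF \<omega> A c]] ext_d_eq_list_d[OF c] in blast)
  fix c' y assume c': "c' \<in> A" and y: "y \<in> chart_domain c c' id"
  then have "ext_d A \<omega> c y = list_d (\<omega> c) y"
    by (intro ext_d_eq_list_d[OF c] subsetD[OF chart_domain_subset])
  also have "\<dots> = pull (in_charts c c' id) (ext_d A \<omega> c') y"
    by (rule ext_d_in_charts[OF A c A c' manifold_map_id[OF A] \<omega> y]) (rule forms_compatible[OF \<omega> A c c'])
  finally show "ext_d A \<omega> c y = pull (in_charts c c' id) (ext_d A \<omega> c') y" .
qed

lemma ext_d_pullback: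
  assumes A: "smooth_manifold A" and A': "smooth_manifold A'" and f: "manifold_map A A' f" and \<omega>: "\<omega> \<in> forms A'"
  shows "ext_d A (pullback A A' f \<omega>) = pullback A A' f (ext_d A' \<omega>)"
proof (intro ext)
  fix c y vs
  show "ext_d A (pullback A A' f \<omega>) c y vs = pullback A A' f (ext_d A' \<omega>) c y vs"
  proof (cases "c \<in> A \<and> y \<in> chart_image c")
    case True
    then have c: "c \<in> A" by simp
    from True obtain c' where c': "c' \<in> A'" "y \<in> chart_domain c c' f"
      using manifold_map_chart[OF f A c] by metis
    have "list_d (pullback A A' f \<omega> c) y = pull (in_charts c c' f) (ext_d A' \<omega> c') y"
      by (rule ext_d_in_charts[OF A c A' c'(1) f \<omega> c'(2)]) (rule pullback_eq_pull[OF A c A' c'(1) f \<omega>])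
    then show ?thesis
      using True by (simp add: ext_d_eq_list_d pullback_eq_pull[OF A c A' c'(1) f ext_d_forms[OF A' \<omega>] c'(2)])
  qed (auto simp: ext_d_def pullback_def)
qed

section \<open>Grading, linear structure and products of forms on a manifold\<close>

text \<open>Scalar multiples, components, the grading involution and the even and odd parts are all
  weights, so their closure and pullback properties are proved once.\<close>

definition form_weight :: "(nat \<Rightarrow> real) \<Rightarrow> ('p, 'e) form \<Rightarrow> ('p, 'e) form" where
  "form_weight r \<omega> = (\<lambda>c y vs. r (length vs) * \<omega> c y vs)"

lemma form_scale_eq_weight: "form_scale a = form_weight (\<lambda>_. a)"
  by (simp add: fun_eq_iff form_scale_def form_weight_def)

lemma form_component_eq_weight: "form_component r = form_weight (\<lambda>n. if n = r then 1 else 0)"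
  by (simp add: fun_eq_iff form_component_def form_weight_def)

lemma alternating_zero: "alternating (\<lambda>_. 0)"
  by (simp add: alternating_def linear_iff)

lemma alternating_add: "alternating a \<Longrightarrow> alternating b \<Longrightarrow> alternating (\<lambda>vs. a vs + b vs)"
  by (simp add: alternating_def linear_compose_add)

lemma alternating_weight: 
  assumes "alternating a" 
  shows "alternating (\<lambda>vs. r (length vs) * a vs)"
  unfolding alternating_def
proof (intro conjI allI impI)
  show "linear (\<lambda>v. r (length (us @ v # ws)) * a (us @ v # ws))" for us ws
    \<comment> \<open>The length does not depend on v, so the weight is a constant factor.\<close>
    unfolding length_append list.size
    by (rule linear_mult_left[OF multilinearD[OF alternating_imp_multilinear[OF assms]]])
qed (use assms in \<open>auto simp: alternating_def\<close>)

lemma zero_forms [simp]: "smooth_manifold A \<Longrightarrow> 0 \<in> forms A"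
  by (rule formsI)
    (auto simp: smooth_family_def open_chart_image alternating_zero zero_fun_def pull_def fun_eq_iff)

lemma add_forms:
  assumes "smooth_manifold A" "\<omega> \<in> forms A" "\<eta> \<in> forms A"
  shows "\<omega> + \<eta> \<in> forms A"
proof (rule formsI[OF assms(1)])
  fix c assume c: "c \<in> A"
  note sf = forms_smooth_family[OF assms(2,1) c] forms_smooth_family[OF assms(3,1) c]
  show "smooth_family (chart_image c) ((\<omega> + \<eta>) c)"
    using sf by (auto simp: smooth_family_def plus_fun_def intro!: alternating_add smooth_on_add)
  show "(\<omega> + \<eta>) c y = pull (in_charts c c' id) ((\<omega> + \<eta>) c') y"
    if "c' \<in> A" "y \<in> chart_domain c c' id" for c' y
    using forms_compatible[OF assms(2,1) c that] forms_compatible[OF assms(3,1) c that]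
    by (simp add: plus_fun_def pull_def fun_eq_iff)
qed (use forms_outside[OF assms(2)] forms_outside[OF assms(3)] in \<open>auto simp: plus_fun_def\<close>)

lemma sum_forms:
  assumes "smooth_manifold A" "\<And>i. i \<in> I \<Longrightarrow> \<omega> i \<in> forms A"
  shows "(\<Sum>i\<in>I. \<omega> i) \<in> forms A"
  using assms(2) by (induction I rule: infinite_finite_induct) (auto intro: add_forms[OF assms(1)] zero_forms[OF assms(1)])

lemma weight_forms:
  assumes "smooth_manifold A" "\<omega> \<in> forms A"
  shows "form_weight r \<omega> \<in> forms A"
proof (rule formsI[OF assms(1)])
  fix c assume c: "c \<in> A"
  note sf = forms_smooth_family[OF assms(2,1) c]
  show "smooth_family (chart_image c) (form_weight r \<omega> c)"
    using sf by (auto simp: smooth_family_def form_weight_def intro!: alternating_weight smooth_on_mult)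
  show "form_weight r \<omega> c y = pull (in_charts c c' id) (form_weight r \<omega> c') y"
    if "c' \<in> A" "y \<in> chart_domain c c' id" for c' y
    using forms_compatible[OF assms(2,1) c that]
    by (simp add: form_weight_def pull_def fun_eq_iff)
qed (use forms_outside[OF assms(2)] in \<open>auto simp: form_weight_def\<close>)

lemma list_wedge_map: "list_wedge a b (map L vs) = list_wedge (\<lambda>ws. a (map L ws)) (\<lambda>ws. b (map L ws)) vs"
  by (simp add: list_wedge_def nths_map)

lemma wedge_forms:
  assumes "smooth_manifold A" "\<omega> \<in> forms A" "\<eta> \<in> forms A"
  shows "wedge \<omega> \<eta> \<in> forms A"
proof (rule formsI[OF assms(1)])
  fix c assume c: "c \<in> A"
  note sf = forms_smooth_family[OF assms(2,1) c] forms_smooth_family[OF assms(3,1) c]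
  have "wedge \<omega> \<eta> c = (\<lambda>y. list_wedge (\<omega> c y) (\<eta> c y))" by (simp add: fun_eq_iff wedge_eq_list_wedge)
  then show "smooth_family (chart_image c) (wedge \<omega> \<eta> c)"
    using smooth_family_wedge[OF sf] by simp
  show "wedge \<omega> \<eta> c y = pull (in_charts c c' id) (wedge \<omega> \<eta> c') y"
    if "c' \<in> A" "y \<in> chart_domain c c' id" for c' y
    using forms_compatible[OF assms(2,1) c that] forms_compatible[OF assms(3,1) c that]
    by (intro ext) (simp add: wedge_eq_list_wedge pull_def[of _ "wedge \<omega> \<eta> c'"] list_wedge_map pull_def[abs_def])
qed (use forms_outside[OF assms(2)] in \<open>auto simp: wedge_eq_list_wedge list_wedge_zero_left\<close>)

lemma pullback_zero: "pullback A A' f 0 = 0"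
  by (intro ext) (simp add: pullback_def Let_def)

lemma pullback_add: "pullback A A' f (\<omega> + \<eta>) = pullback A A' f \<omega> + pullback A A' f \<eta>"
  by (intro ext) (simp add: pullback_def Let_def)

lemma pullback_weight: "pullback A A' f (form_weight r \<omega>) = form_weight r (pullback A A' f \<omega>)"
  by (intro ext) (simp add: pullback_def form_weight_def Let_def)

text \<open>At each point the same target chart is chosen on both sides, and selecting arguments
  commutes with mapping them by the derivative.\<close>

lemma pullback_wedge: "pullback A A' f (wedge \<omega> \<eta>) = wedge (pullback A A' f \<omega>) (pullback A A' f \<eta>)"
proof (intro ext)
  fix c y vs
  show "pullback A A' f (wedge \<omega> \<eta>) c y vs = wedge (pullback A A' f \<omega>) (pullback A A' f \<eta>) c y vs"
  proof (cases "c \<in> A \<and> y \<in> chart_image c")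
    case False
    then have "pullback A A' f \<theta> c y = (\<lambda>_. 0)" for \<theta> by (auto simp: pullback_def)
    then show ?thesis by (simp add: wedge_eq_list_wedge list_wedge_zero_left)
  qed (simp add: pullback_def wedge_eq_list_wedge Let_def list_wedge_map)
qed

lemma forms_family_differentiable:
  "\<omega> \<in> forms A \<Longrightarrow> smooth_manifold A \<Longrightarrow> c \<in> A \<Longrightarrow> y \<in> chart_image c \<Longrightarrow> family_differentiable (\<omega> c) y"
  using smooth_family_differentiable[OF forms_smooth_family] .

lemma ext_d_add:
  assumes "smooth_manifold A" "\<omega> \<in> forms A" "\<eta> \<in> forms A"
  shows "ext_d A (\<omega> + \<eta>) = ext_d A \<omega> + ext_d A \<eta>"
proof (intro ext)
  fix c y vs
  show "ext_d A (\<omega> + \<eta>) c y vs = (ext_d A \<omega> + ext_d A \<eta>) c y vs"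
  proof (cases "c \<in> A \<and> y \<in> chart_image c")
    case True
    then have "list_d (\<lambda>x ws. \<omega> c x ws + \<eta> c x ws) y vs = list_d (\<omega> c) y vs + list_d (\<eta> c) y vs"
      by (intro list_d_add forms_family_differentiable) (use assms in auto)
    then show ?thesis using True by (simp add: ext_d_eq_list_d plus_fun_def)
  qed (auto simp: ext_d_def)
qed

lemma ext_d_zero: "ext_d A 0 = 0"
  by (intro ext) (simp add: ext_d_def)

lemma ext_d_sum:
  assumes "smooth_manifold A" "\<And>i. i \<in> I \<Longrightarrow> \<omega> i \<in> forms A"
  shows "ext_d A (\<Sum>i\<in>I. \<omega> i) = (\<Sum>i\<in>I. ext_d A (\<omega> i))"
  using assms(2)
proof (induction I rule: infinite_finite_induct)
  case (insert i I)
  have "ext_d A (\<omega> i + (\<Sum>i\<in>I. \<omega> i)) = ext_d A (\<omega> i) + ext_d A (\<Sum>i\<in>I. \<omega> i)"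
    using insert.prems by (intro ext_d_add sum_forms assms(1)) simp_all
  also have "ext_d A (\<Sum>i\<in>I. \<omega> i) = (\<Sum>i\<in>I. ext_d A (\<omega> i))"
    using insert.prems by (intro insert.IH) simp_all
  finally show ?case by (simp only: sum.insert[OF insert.hyps])
qed (simp_all only: simp_thms sum.infinite sum.empty ext_d_zero)

lemma ext_d_scale:
  assumes "smooth_manifold A" "\<omega> \<in> forms A"
  shows "ext_d A (form_scale r \<omega>) = form_scale r (ext_d A \<omega>)"
proof (intro ext)
  fix c y vs
  show "ext_d A (form_scale r \<omega>) c y vs = form_scale r (ext_d A \<omega>) c y vs"
  proof (cases "c \<in> A \<and> y \<in> chart_image c")
    case True
    then have "list_d (\<lambda>x ws. r * \<omega> c x ws) y vs = r * list_d (\<omega> c) y vs"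
      by (intro list_d_scale forms_family_differentiable) (use assms in auto)
    then show ?thesis using True by (simp add: ext_d_eq_list_d form_scale_def)
  qed (auto simp: ext_d_def form_scale_def)
qed

definition form_twist :: "('p, 'e) form \<Rightarrow> ('p, 'e) form" where
  "form_twist \<omega> = form_weight (\<lambda>n. (-1) ^ n) \<omega>"

lemma form_twist_eq: "form_twist \<omega> c y = twist (\<omega> c y)"
  by (simp add: form_twist_def form_weight_def twist_def)

lemma ext_d_wedge:
  assumes "smooth_manifold A" "\<omega> \<in> forms A" "\<eta> \<in> forms A"
  shows "ext_d A (wedge \<omega> \<eta>) = wedge (ext_d A \<omega>) \<eta> + wedge (form_twist \<omega>) (ext_d A \<eta>)"
proof (intro ext)
  fix c y vs
  show "ext_d A (wedge \<omega> \<eta>) c y vs = (wedge (ext_d A \<omega>) \<eta> + wedge (form_twist \<omega>) (ext_d A \<eta>)) c y vs"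
  proof (cases "c \<in> A \<and> y \<in> chart_image c")
    case True
    have "wedge \<omega> \<eta> c = (\<lambda>y. list_wedge (\<omega> c y) (\<eta> c y))" by (simp add: fun_eq_iff wedge_eq_list_wedge)
    moreover have "list_d (\<lambda>x. list_wedge (\<omega> c x) (\<eta> c x)) y vs =
        list_wedge (list_d (\<omega> c) y) (\<eta> c y) vs + list_wedge (twist (\<omega> c y)) (list_d (\<eta> c) y) vs"
      using True by (intro list_d_list_wedge forms_family_differentiable) (use assms in auto)
    ultimately show ?thesis using True
      by (simp add: ext_d_eq_list_d wedge_eq_list_wedge form_twist_eq)
  next
    case False
    then have "ext_d A \<omega> c y = (\<lambda>_. 0)" for \<omega> by (auto simp: ext_d_def)
    then show ?thesis by (simp add: wedge_eq_list_wedge list_wedge_zero_left list_wedge_zero_right)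
  qed
qed

lemma wedge_add_left: "wedge (\<omega> + \<omega>') \<eta> = wedge \<omega> \<eta> + wedge \<omega>' \<eta>"
  and wedge_add_right: "wedge \<omega> (\<eta> + \<eta>') = wedge \<omega> \<eta> + wedge \<omega> \<eta>'"
  and wedge_zero_left: "wedge 0 \<eta> = 0"
  and wedge_zero_right: "wedge \<omega> 0 = 0"
  and wedge_scale_left: "wedge (form_scale r \<omega>) \<eta> = form_scale r (wedge \<omega> \<eta>)"
  and wedge_scale_right: "wedge \<omega> (form_scale r \<eta>) = form_scale r (wedge \<omega> \<eta>)"
  by (intro ext, simp add: wedge_def form_scale_def algebra_simps sum.distrib sum_distrib_left)+

lemma wedge_sum_left: "wedge (\<Sum>i\<in>I. \<omega> i) \<eta> = (\<Sum>i\<in>I. wedge (\<omega> i) \<eta>)"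
  and wedge_sum_right: "wedge \<eta> (\<Sum>i\<in>I. \<omega> i) = (\<Sum>i\<in>I. wedge \<eta> (\<omega> i))"
  by (induction I rule: infinite_finite_induct)
    (simp_all only: simp_thms not_False_eq_True sum.infinite sum.empty sum.insert wedge_zero_left wedge_zero_right wedge_add_left wedge_add_right)


subsection \<open>Constructions of manifolds and smooth maps\<close>

text \<open>The rational combinations form a countable set; its density gives second countability of
  the model spaces.\<close>

lemma ex_near_rational_combination:
  fixes y :: "'a::fin_dim_inner"
  assumes "\<delta> > 0"
  shows "\<exists>q\<in>PiE basis (\<lambda>_. \<rat>). dist (\<Sum>b\<in>basis. q b *\<^sub>R b) y < \<delta>"
proof -
  let ?B = "basis :: 'a set"
  \<comment> \<open>The summand 1 makes K positive even for an empty \<open>basis\<close>, and the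
    final estimate \<delta> / K * (K - 1) < \<delta> strict.\<close>
  define K where "K = 1 + (\<Sum>b\<in>?B. norm b)"
  have K: "K > 0" unfolding K_def by (simp add: add_pos_nonneg sum_nonneg)
  have "\<exists>r\<in>\<rat>. coord b y < r \<and> r < coord b y + \<delta> / K" for b
    using assms K by (intro Rats_dense_in_real) simp
  then obtain r where r: "\<And>b. r b \<in> \<rat>" "\<And>b. coord b y < r b" "\<And>b. r b < coord b y + \<delta> / K" by metis
  have "dist (\<Sum>b\<in>?B. restrict r ?B b *\<^sub>R b) y = norm (\<Sum>b\<in>?B. (r b - coord b y) *\<^sub>R b)"
  proof -
    have "(\<Sum>b\<in>?B. (r b - coord b y) *\<^sub>R b) = (\<Sum>b\<in>?B. r b *\<^sub>R b) - y"
      using basis_expansion[of y] by (simp add: scaleR_diff_left sum_subtractf)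
    then show ?thesis by (simp add: dist_norm)
  qed
  also have "\<dots> \<le> (\<Sum>b\<in>?B. norm ((r b - coord b y) *\<^sub>R b))" by (rule norm_sum)
  also have "\<dots> \<le> (\<Sum>b\<in>?B. \<delta> / K * norm b)"
  proof (rule sum_mono)
    fix b
    have "\<bar>r b - coord b y\<bar> \<le> \<delta> / K" using r(2)[of b] r(3)[of b] by linarith
    then show "norm ((r b - coord b y) *\<^sub>R b) \<le> \<delta> / K * norm b"
      unfolding norm_scaleR by (rule mult_right_mono) simp
  qed
  also have "\<dots> = \<delta> / K * (K - 1)" by (simp add: K_def sum_distrib_left)
  also have "\<dots> < \<delta>" using assms K by (simp add: field_simps)
  finally show ?thesis using r(1) by (intro bexI[of _ "restrict r ?B"]) auto
qed

text \<open>\<open>smooth_manifold\<close> asks for points of a second countable Hausdorff type; by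
  this instance it can be stated for \<open>euclidean_atlas\<close>.\<close>

instance fin_dim_inner \<subseteq> second_countable_topology
proof
  define D where "D = (\<lambda>q. \<Sum>b\<in>basis. q b *\<^sub>R b) ` PiE (basis :: 'a set) (\<lambda>_. \<rat>)"
  define B where "B = (\<lambda>(x, n). ball x (1 / real (Suc n))) ` (D \<times> UNIV)"
  have "countable D" unfolding D_def
    by (intro countable_image countable_PiE) (simp_all add: countable_rat)
  then have "countable B" unfolding B_def by auto
  moreover have "open S \<longleftrightarrow> generate_topology B S" for S
  proof
    assume S: "open S"
    have "\<exists>b\<in>B. y \<in> b \<and> b \<subseteq> S" if y: "y \<in> S" for y
    proof -
      obtain e where e: "e > 0" "ball y e \<subseteq> S" using S y by (rule openE)
      obtain n where n: "1 / real (Suc n) < e / 2"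
        using e(1) nat_approx_posE[of "e / 2"] by auto
      obtain x where x: "x \<in> D" "dist x y < 1 / real (Suc n)"
        using ex_near_rational_combination[of "1 / real (Suc n)" y] unfolding D_def by auto
      have "ball x (1 / real (Suc n)) \<subseteq> ball y e"
      proof
        fix z assume "z \<in> ball x (1 / real (Suc n))"
        then have "dist y z < 1 / real (Suc n) + 1 / real (Suc n)"
          using x(2) dist_triangle[of y z x] by (simp add: dist_commute)
        then show "z \<in> ball y e" using n by simp
      qed
      then show ?thesis using e x unfolding B_def by (intro bexI[of _ "ball x (1 / real (Suc n))"]) auto
    qed
    then have "S = \<Union> {b \<in> B. b \<subseteq> S}" by blast
    moreover have "generate_topology B (\<Union> {b \<in> B. b \<subseteq> S})"
      by (rule generate_topology.UN) (auto intro: generate_topology.Basis)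
    ultimately show "generate_topology B S" by metis
  next
    assume "generate_topology B S"
    then show "open S" by (induction rule: generate_topology.induct) (auto simp: B_def)
  qed
  ultimately show "\<exists>B :: 'a set set. countable B \<and> open = generate_topology B" by blast
qed

section \<open>Smooth maps on subsets of manifolds\<close>

lemma smooth_on_transform:
  "smooth_on T g \<Longrightarrow> open T \<Longrightarrow> (\<And>x. x \<in> T \<Longrightarrow> f x = g x) \<Longrightarrow> smooth_on T f"
  using smooth_on_cong[of T f g] by blast

lemma smooth_mapE:
  assumes "smooth_map A A' S f" "z \<in> S"
  obtains W g where "z \<in> W" "smooth_on_open A A' W g" "\<And>w. w \<in> S \<Longrightarrow> w \<in> W \<Longrightarrow> g w = f w"
proof -
  have "\<exists>W g. z \<in> W \<and> smooth_on_open A A' W g \<and> (\<forall>w\<in>S \<inter> W. g w = f w)"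
    using assms by (simp add: smooth_map_def)
  then show ?thesis using that by auto
qed

lemma smooth_on_open_imp_smooth_map:
  assumes f: "smooth_on_open A A' W f"
  shows "smooth_map A A' W f"
  unfolding smooth_map_def
proof (intro conjI ballI)
  show "W \<subseteq> carrier_of A" "f ` W \<subseteq> carrier_of A'"
    using f openin_subset unfolding smooth_on_open_def by fastforce+
  show "\<exists>V g. z \<in> V \<and> smooth_on_open A A' V g \<and> (\<forall>w\<in>W \<inter> V. g w = f w)" if "z \<in> W" for z
    using that f by (intro exI[of _ W] exI[of _ f]) simp
qed

lemma smooth_map_subset:
  assumes f: "smooth_map A A' S f" and T: "T \<subseteq> S"
  shows "smooth_map A A' T f"
  unfolding smooth_map_def
proof (intro conjI ballI)
  show "T \<subseteq> carrier_of A" "f ` T \<subseteq> carrier_of A'" using f T unfolding smooth_map_def by auto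
  fix z assume "z \<in> T"
  with T have "z \<in> S" by blast
  then obtain W g where "z \<in> W" "smooth_on_open A A' W g" "\<forall>w\<in>S \<inter> W. g w = f w"
    using f unfolding smooth_map_def by blast
  then show "\<exists>W g. z \<in> W \<and> smooth_on_open A A' W g \<and> (\<forall>w\<in>T \<inter> W. g w = f w)"
    using T by (intro exI[of _ W] exI[of _ g]) auto
qed

lemma smooth_map_continuous_on:
  fixes f :: "'p::t2_space \<Rightarrow> 'q::topological_space"
  assumes "smooth_map A A' S f"
  shows "continuous_on S f"
  unfolding continuous_on_eq_continuous_within
proof
  fix z assume z: "z \<in> S"
  then obtain W g where W: "z \<in> W" "smooth_on_open A A' W g" "\<forall>w\<in>S \<inter> W. g w = f w"
    using assms unfolding smooth_map_def by blast
  have S: "S \<subseteq> carrier_of A" using assms by (simp add: smooth_map_def)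
  obtain U where U: "open U" "W = carrier_of A \<inter> U"
    using W(2) by (auto simp: smooth_on_open_def openin_open)
  have sub: "S \<inter> U \<subseteq> S \<inter> W" using S U by blast
  have "continuous_on (S \<inter> U) g"
    by (rule continuous_on_subset[of W]) (use W(2) sub in \<open>auto simp: smooth_on_open_def\<close>)
  then have "continuous_on (S \<inter> U) f"
    by (rule continuous_on_eq) (use W(3) sub in blast)
  then have "continuous (at z within S \<inter> U) f"
    using z W(1) U(2) by (simp add: continuous_on_eq_continuous_within)
  moreover have "at z within S = at z within S \<inter> U"
    by (rule at_within_nhd[of z U]) (use W(1) U in auto)
  ultimately show "continuous (at z within S) f" by simp
qed

lemma smooth_on_open_preimage:
  assumes "smooth_on_open A A' W f" "openin (top_of_set (carrier_of A')) V"
  shows "openin (top_of_set (carrier_of A)) {z \<in> W. f z \<in> V}"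
proof -
  have "openin (top_of_set W) (W \<inter> f -` V)"
    by (rule continuous_openin_preimage) (use assms in \<open>auto simp: smooth_on_open_def\<close>)
  then have "openin (top_of_set (carrier_of A)) (W \<inter> f -` V)"
    using assms(1) openin_trans by (auto simp: smooth_on_open_def)
  then show ?thesis by (simp add: Int_def vimage_def)
qed

text \<open>The image of W need not lie in one chart of the middle manifold, so smoothness is
  checked near each point with a chart around its image.\<close>

lemma smooth_on_open_comp:
  assumes A: "smooth_manifold A" and A': "smooth_manifold A'" and A'': "smooth_manifold A''"
    and f: "smooth_on_open A A' W f" and g: "smooth_on_open A' A'' V g"
  shows "smooth_on_open A A'' {z \<in> W. f z \<in> V} (g \<circ> f)"
  unfolding smooth_on_open_def
proof (intro conjI ballI)
  let ?W = "{z \<in> W. f z \<in> V}"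
  have V: "openin (top_of_set (carrier_of A')) V" using g by (simp add: smooth_on_open_def)
  show "openin (top_of_set (carrier_of A)) ?W"
    by (rule smooth_on_open_preimage[OF f V])
  show "continuous_on ?W (g \<circ> f)"
    using f g by (intro continuous_on_compose) (auto simp: smooth_on_open_def elim: continuous_on_subset)
  show "(g \<circ> f) ` ?W \<subseteq> carrier_of A''" using g by (auto simp: smooth_on_open_def)
  fix c c'' assume c: "c \<in> A" and c'': "c'' \<in> A''"
  show "smooth_on (snd c ` {z \<in> fst c \<inter> ?W. (g \<circ> f) z \<in> fst c''}) (in_charts c c'' (g \<circ> f))"
  proof (rule smooth_on_local)
    fix y assume "y \<in> snd c ` {z \<in> fst c \<inter> ?W. (g \<circ> f) z \<in> fst c''}"
    then obtain z where z: "z \<in> fst c" "z \<in> W" "f z \<in> V" "g (f z) \<in> fst c''" "y = snd c z" by auto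
    have "f z \<in> carrier_of A'" using f z by (auto simp: smooth_on_open_def)
    then obtain c' where c': "c' \<in> A'" "f z \<in> fst c'" by (rule carrier_ofE)
    \<comment> \<open>The points of the middle chart at which the chart expression of g makes sense;
      T is the matching open set in the source chart.\<close>
    define V' where "V' = fst c' \<inter> {w \<in> V. g w \<in> fst c''}"
    define T where "T = snd c ` (fst c \<inter> {z \<in> W. f z \<in> V'})"
    let ?F = "in_charts c c' f" and ?G = "in_charts c' c'' g"
    have "openin (top_of_set (carrier_of A')) V'" unfolding V'_def
      by (intro openin_Int chart_openin[OF A' c'(1)] smooth_on_open_preimage[OF g chart_openin[OF A'' c'']])
    then have T: "open T" unfolding T_def
      by (intro open_chart_image_Int[OF A c] smooth_on_open_preimage[OF f])
    have "smooth_on (snd c' ` {w \<in> fst c' \<inter> V. g w \<in> fst c''}) ?G"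
      using g c'(1) c'' by (auto simp: smooth_on_open_def)
    moreover have "{w \<in> fst c' \<inter> V. g w \<in> fst c''} = V'" by (auto simp: V'_def)
    ultimately have G: "smooth_on (snd c' ` V') ?G" by simp
    have "smooth_on (snd c ` {z \<in> fst c \<inter> W. f z \<in> fst c'}) ?F"
      using f c c'(1) by (auto simp: smooth_on_open_def)
    then have F: "smooth_on T ?F"
      by (rule smooth_on_subset) (auto simp: T_def V'_def)
    have FT: "?F ` T \<subseteq> snd c' ` V'"
      using A c by (auto simp: T_def in_charts_def)
    have eq: "in_charts c c'' (g \<circ> f) x = ?G (?F x)" if "x \<in> T" for x
      using that A c A' c' by (auto simp: T_def V'_def in_charts_def)
    have "smooth_on T (in_charts c c'' (g \<circ> f))"
      by (rule smooth_on_transform[OF smooth_on_compose[OF T FT G F] T eq])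
    moreover have "y \<in> T" using z c' by (auto simp: T_def V'_def)
    ultimately show "\<exists>T. open T \<and> y \<in> T \<and> smooth_on T (in_charts c c'' (g \<circ> f))"
      using T by (intro exI[of _ T]) simp
  qed
qed

lemma smooth_map_comp:
  assumes A: "smooth_manifold A" and A': "smooth_manifold A'" and A'': "smooth_manifold A''"
    and f: "smooth_map A A' S f" and g: "smooth_map A' A'' S' g" and S': "f ` S \<subseteq> S'"
  shows "smooth_map A A'' S (g \<circ> f)"
  unfolding smooth_map_def
proof (intro conjI ballI)
  have "g ` S' \<subseteq> carrier_of A''" using g by (simp add: smooth_map_def)
  then show "S \<subseteq> carrier_of A" "(g \<circ> f) ` S \<subseteq> carrier_of A''"
    using f S' by (auto simp: smooth_map_def image_subset_iff)
  fix z assume z: "z \<in> S"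
  obtain W f' where W: "z \<in> W" "smooth_on_open A A' W f'" "\<And>w. w \<in> S \<Longrightarrow> w \<in> W \<Longrightarrow> f' w = f w"
    using smooth_mapE[OF f z] by metis
  have "f z \<in> S'" using S' z by blast
  then obtain V g' where V: "f z \<in> V" "smooth_on_open A' A'' V g'" "\<And>w. w \<in> S' \<Longrightarrow> w \<in> V \<Longrightarrow> g' w = g w"
    using smooth_mapE[OF g] by metis
  let ?W = "{z \<in> W. f' z \<in> V}"
  have "z \<in> ?W" using W(1,3) V(1) z by simp
  moreover have "smooth_on_open A A'' ?W (g' \<circ> f')"
    by (rule smooth_on_open_comp[OF A A' A'' W(2) V(2)])
  moreover have "\<forall>w\<in>S \<inter> ?W. (g' \<circ> f') w = (g \<circ> f) w" using W(3) V(3) S' by auto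
  ultimately show "\<exists>W ga. z \<in> W \<and> smooth_on_open A A'' W ga \<and> (\<forall>w\<in>S \<inter> W. ga w = (g \<circ> f) w)"
    by (intro exI[of _ ?W] exI[of _ "g' \<circ> f'"] conjI)
qed

section \<open>Restricted atlases\<close>

lemma restrict_atlas_iff: "c \<in> restrict_atlas S A \<longleftrightarrow> (\<exists>d\<in>A. c = (fst d \<inter> S, snd d))"
  by (auto simp: restrict_atlas_def image_iff split: prod.splits) force+

lemma carrier_of_restrict_atlas: "carrier_of (restrict_atlas S A) = carrier_of A \<inter> S"
  by (auto simp: carrier_of_def restrict_atlas_def)

lemma restrict_atlas_UNIV [simp]: "restrict_atlas UNIV A = A"
  by (auto simp: restrict_atlas_def)

text \<open>\<open>chart_inv\<close> is an inverse on the chart domain and changes with it; on the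
  smaller image both inverses agree by injectivity.\<close>

lemma chart_inv_restrict:
  assumes "smooth_manifold A" "d \<in> A" "y \<in> snd d ` (fst d \<inter> S)"
  shows "chart_inv (fst d \<inter> S, snd d) y = chart_inv d y"
proof -
  obtain z where z: "z \<in> fst d \<inter> S" "y = snd d z" using assms(3) by blast
  have "inj_on (snd d) (fst d)"
    by (rule inj_on_inverseI[of _ "chart_inv d"]) (rule chart_inv_snd[OF assms(1,2)])
  then have "inj_on (snd d) (fst d \<inter> S)" by (rule inj_on_subset) blast
  then have "chart_inv (fst d \<inter> S, snd d) y = z"
    using z by (simp add: chart_inv_def)
  then show ?thesis using z assms by simp
qed

text \<open>The passage from \<open>smooth_map\<close>, defined by local extensions, to chart
  expressions: on an open set an extension agrees with f near each point. The choice S' = UNIV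
  leaves the target atlas unrestricted.\<close>

lemma manifold_map_restrict:
  assumes A: "smooth_manifold A" and A': "smooth_manifold A'"
    and f: "smooth_map A A' (carrier_of A \<inter> S) f"
    and S: "openin (top_of_set (carrier_of A)) (carrier_of A \<inter> S)"
    and S': "f ` (carrier_of A \<inter> S) \<subseteq> S'"
  shows "manifold_map (restrict_atlas S A) (restrict_atlas S' A') f"
  unfolding manifold_map_def
proof (intro conjI ballI)
  let ?S = "carrier_of A \<inter> S"
  show "f ` carrier_of (restrict_atlas S A) \<subseteq> carrier_of (restrict_atlas S' A')"
    using f S' by (auto simp: carrier_of_restrict_atlas smooth_map_def)
  fix c c' assume "c \<in> restrict_atlas S A" "c' \<in> restrict_atlas S' A'"
  then obtain d d' where d: "d \<in> A" "c = (fst d \<inter> S, snd d)" and d': "d' \<in> A'" "c' = (fst d' \<inter> S', snd d')"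
    by (auto simp: restrict_atlas_iff)
  have dS: "fst d \<inter> S = fst d \<inter> ?S" using chart_subset_carrier[OF d(1)] by blast
  have dom: "chart_domain c c' f = snd d ` (fst d \<inter> {z \<in> ?S. f z \<in> fst d'})"
    using S' dS by (auto simp: chart_domain_def d(2) d'(2))
  have "openin (top_of_set ?S) (?S \<inter> f -` fst d')"
    by (rule continuous_openin_preimage[OF smooth_map_continuous_on[OF f] _ chart_openin[OF A' d'(1)]])
      (use f in \<open>auto simp: smooth_map_def\<close>)
  then have "openin (top_of_set (carrier_of A)) (?S \<inter> f -` fst d')" using S by (rule openin_trans)
  moreover have "?S \<inter> f -` fst d' = {z \<in> ?S. f z \<in> fst d'}" by blast
  ultimately have op: "openin (top_of_set (carrier_of A)) {z \<in> ?S. f z \<in> fst d'}" by simp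
  show "open (chart_domain c c' f)"
    unfolding dom by (rule open_chart_image_Int[OF A d(1) op])
  have eq: "in_charts c c' f y = in_charts d d' f y" if "y \<in> chart_domain c c' f" for y
  proof -
    have "y \<in> snd d ` (fst d \<inter> S)" using that by (auto simp: dom)
    from chart_inv_restrict[OF A d(1) this] show ?thesis by (simp add: in_charts_def d(2) d'(2))
  qed
  show "smooth_on (chart_domain c c' f) (in_charts c c' f)"
  proof (rule smooth_on_local)
    fix y assume y: "y \<in> chart_domain c c' f"
    then obtain z where z: "z \<in> fst d" "z \<in> ?S" "f z \<in> fst d'" "y = snd d z" by (auto simp: dom)
    obtain W g where W: "z \<in> W" "smooth_on_open A A' W g" "\<And>w. w \<in> ?S \<Longrightarrow> w \<in> W \<Longrightarrow> g w = f w"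
      using smooth_mapE[OF f z(2)] by metis
    \<comment> \<open>The open part of the chart on which the extension g coincides with f and f
      maps into the target chart.\<close>
    define T where "T = snd d ` (fst d \<inter> ({z \<in> ?S. f z \<in> fst d'} \<inter> W))"
    have T: "open T" unfolding T_def
      by (intro open_chart_image_Int[OF A d(1)] openin_Int op) (use W(2) in \<open>simp add: smooth_on_open_def\<close>)
    have "smooth_on (snd d ` {z \<in> fst d \<inter> W. g z \<in> fst d'}) (in_charts d d' g)"
      using W(2) d(1) d'(1) by (auto simp: smooth_on_open_def)
    then have sm: "smooth_on T (in_charts d d' g)"
      by (rule smooth_on_subset) (use W(3) in \<open>auto simp: T_def\<close>)
    have "in_charts c c' f x = in_charts d d' g x" if "x \<in> T" for x
    proof -
      have "x \<in> chart_domain c c' f" using that by (auto simp: T_def dom)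
      moreover have "in_charts d d' f x = in_charts d d' g x"
        using that W(3) A d(1) by (auto simp: T_def in_charts_def)
      ultimately show ?thesis using eq by simp
    qed
    then have "smooth_on T (in_charts c c' f)" by (rule smooth_on_transform[OF sm T])
    moreover have "y \<in> T" using z W(1) by (auto simp: T_def)
    ultimately show "\<exists>T. open T \<and> y \<in> T \<and> smooth_on T (in_charts c c' f)"
      using T by (intro exI[of _ T]) simp
  qed
qed

lemma smooth_map_id:
  assumes "smooth_manifold A" "S \<subseteq> carrier_of A"
  shows "smooth_map A A S id"
proof -
  have "smooth_on (snd c ` {z \<in> fst c \<inter> carrier_of A. id z \<in> fst c'}) (in_charts c c' id)"
    if "c \<in> A" "c' \<in> A" for c c'
  proof -
    have "{z \<in> fst c \<inter> carrier_of A. id z \<in> fst c'} = {z \<in> fst c. id z \<in> fst c'}"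
      using chart_subset_carrier[OF that(1)] by auto
    then show ?thesis
      using manifold_mapD(2)[OF manifold_map_id[OF assms(1)] that] by (simp add: chart_domain_def)
  qed
  then have "smooth_on_open A A (carrier_of A) id"
    by (auto simp: smooth_on_open_def intro: continuous_on_id)
  then show ?thesis
    using smooth_map_subset[OF smooth_on_open_imp_smooth_map assms(2)] by blast
qed

lemma smooth_manifold_restrict:
  assumes A: "smooth_manifold A" and S: "openin (top_of_set (carrier_of A)) (carrier_of A \<inter> S)"
  shows "smooth_manifold (restrict_atlas S A)"
  unfolding smooth_manifold_def
proof (intro conjI ballI)
  \<comment> \<open>The coordinate changes of the restricted atlas are chart expressions of
    \<open>id\<close>.\<close>
  have id: "manifold_map (restrict_atlas S A) (restrict_atlas S A) id"
    by (rule manifold_map_restrict[OF A A smooth_map_id[OF A] S]) auto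
  fix c assume c: "c \<in> restrict_atlas S A"
  then obtain d where d: "d \<in> A" "c = (fst d \<inter> S, snd d)" by (auto simp: restrict_atlas_iff)
  obtain O' where O': "open O'" "fst d = carrier_of A \<inter> O'"
    using chart_openin[OF A d(1)] by (auto simp: openin_open)
  then have "fst c = (carrier_of A \<inter> S) \<inter> O'" using d by auto
  then show "openin (top_of_set (carrier_of (restrict_atlas S A))) (fst c)"
    using O'(1) by (auto simp: carrier_of_restrict_atlas openin_open)
  have dS: "fst c = fst d \<inter> (carrier_of A \<inter> S)" using chart_subset_carrier[OF d(1)] d(2) by auto
  then show "open (chart_image c)"
    using open_chart_image_Int[OF A d(1) S] d(2) by (simp add: chart_image_def)
  have "homeomorphism (fst c) (chart_image c) (snd d) (chart_inv d)"
    by (rule homeomorphism_of_subsets[OF chart_homeomorphism[OF A d(1)], of _ "{}"]) (auto simp: d(2) chart_image_def)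
  then show "homeomorphism (fst c) (chart_image c) (snd c) (chart_inv c)"
    by (rule homeomorphism_cong)
      (use chart_inv_restrict[OF A d(1), of _ S] in \<open>auto simp: d(2) chart_image_def\<close>)
  fix c' assume c': "c' \<in> restrict_atlas S A"
  have "snd c ` (fst c \<inter> fst c') = chart_domain c c' id" by (auto simp: chart_domain_def)
  then show "smooth_on (snd c ` (fst c \<inter> fst c')) (in_charts c c' id)"
    using manifold_mapD(2)[OF id c c'] by simp
qed

section \<open>Model spaces as manifolds\<close>

lemma carrier_of_euclidean_atlas [simp]: "carrier_of euclidean_atlas = UNIV"
  by (simp add: carrier_of_def euclidean_atlas_def)

lemma chart_inv_UNIV [simp]: "chart_inv (UNIV, id) = id"
  by (simp add: chart_inv_def)

lemma smooth_manifold_euclidean: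
  "smooth_manifold (euclidean_atlas :: ('e::fin_dim_inner, 'e) atlas)"
  unfolding smooth_manifold_def
proof (intro conjI ballI)
  fix c c' :: "('e, 'e) chart" assume "c \<in> euclidean_atlas" "c' \<in> euclidean_atlas"
  then have c: "c = (UNIV, id)" "c' = (UNIV, id)" by (simp_all add: euclidean_atlas_def)
  show "openin (top_of_set (carrier_of euclidean_atlas)) (fst c)" "open (chart_image c)"
    by (simp_all add: c chart_image_def)
  show "homeomorphism (fst c) (chart_image c) (snd c) (chart_inv c)"
    unfolding c chart_inv_UNIV by (rule homeomorphismI) (auto simp: chart_image_def continuous_on_id)
  show "smooth_on (snd c ` (fst c \<inter> fst c')) (in_charts c c' id)"
    using smooth_on_id[folded id_def] by (simp add: c in_charts_def)
qed

lemma smooth_map_euclidean: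
  assumes f: "smooth_map euclidean_atlas euclidean_atlas T f" and T: "open T"
  shows "smooth_on T f"
proof (rule smooth_on_local)
  fix x assume x: "x \<in> T"
  then obtain W g where W: "x \<in> W" "smooth_on_open euclidean_atlas euclidean_atlas W g" "\<And>w. w \<in> T \<Longrightarrow> w \<in> W \<Longrightarrow> g w = f w"
    using smooth_mapE[OF f x] by metis
  have op: "open W" using W(2) by (simp add: smooth_on_open_def)
  have sm: "smooth_on W g"
    using W(2) by (simp add: smooth_on_open_def in_charts_def) (simp add: euclidean_atlas_def)
  have TW: "open (T \<inter> W)" using op T by blast
  have "smooth_on (T \<inter> W) g" by (rule smooth_on_subset[OF sm]) blast
  then have "smooth_on (T \<inter> W) f"
    by (rule smooth_on_transform[OF _ TW]) (simp add: W(3))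
  then show "\<exists>T. open T \<and> x \<in> T \<and> smooth_on T f"
    using TW x W(1) by (intro exI[of _ "T \<inter> W"]) simp
qed

section \<open>Product manifolds and their projections\<close>

lemma prod_atlas_eq:
  "prod_atlas A A' = (\<lambda>(d, d'). (fst d \<times> fst d', map_prod (snd d) (snd d'))) ` (A \<times> A')"
  unfolding prod_atlas_def by (rule image_cong) auto

lemma prod_atlas_iff: "c \<in> prod_atlas A A' \<longleftrightarrow> (\<exists>d\<in>A. \<exists>d'\<in>A'. c = (fst d \<times> fst d', map_prod (snd d) (snd d')))"
  unfolding prod_atlas_eq image_iff by (simp add: Bex_def)

lemma carrier_of_prod_atlas: "carrier_of (prod_atlas A A') = carrier_of A \<times> carrier_of A'"
proof -
  have "fst ` prod_atlas A A' = (\<lambda>(d, d'). fst d \<times> fst d') ` (A \<times> A')"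
    unfolding prod_atlas_eq image_image by (rule image_cong) auto
  then have "(x, y) \<in> carrier_of (prod_atlas A A') \<longleftrightarrow> (\<exists>d\<in>A. \<exists>d'\<in>A'. x \<in> fst d \<and> y \<in> fst d')" for x y
    unfolding carrier_of_def by (simp add: Bex_def) blast
  moreover have "(x, y) \<in> carrier_of A \<times> carrier_of A' \<longleftrightarrow> (\<exists>d\<in>A. x \<in> fst d) \<and> (\<exists>d'\<in>A'. y \<in> fst d')" for x y
    unfolding carrier_of_def by (simp add: Bex_def)
  ultimately show ?thesis by (intro set_eqI) (metis surj_pair)
qed

text \<open>Puts a product with a restricted factor into the form that
  \<open>manifold_map_restrict\<close> and \<open>smooth_manifold_restrict\<close> accept.\<close>

lemma restrict_prod_atlas: "prod_atlas (restrict_atlas S A) A' = restrict_atlas (S \<times> UNIV) (prod_atlas A A')"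
proof (rule set_eqI)
  fix c
  have "c \<in> prod_atlas (restrict_atlas S A) A' \<longleftrightarrow>
      (\<exists>d\<in>A. \<exists>d'\<in>A'. c = ((fst d \<inter> S) \<times> fst d', map_prod (snd d) (snd d')))"
    unfolding prod_atlas_iff by (metis fst_conv snd_conv restrict_atlas_iff)
  moreover have "c \<in> restrict_atlas (S \<times> UNIV) (prod_atlas A A') \<longleftrightarrow>
      (\<exists>d\<in>A. \<exists>d'\<in>A'. c = (fst d \<times> fst d' \<inter> S \<times> UNIV, map_prod (snd d) (snd d')))"
    unfolding restrict_atlas_iff by (metis fst_conv snd_conv prod_atlas_iff)
  ultimately show "c \<in> prod_atlas (restrict_atlas S A) A' \<longleftrightarrow> c \<in> restrict_atlas (S \<times> UNIV) (prod_atlas A A')"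
    by (simp add: Times_Int_Times)
qed

lemma chart_inv_prod:
  assumes "smooth_manifold A" "d \<in> A" "smooth_manifold A'" "d' \<in> A'" "y \<in> chart_image d" "y' \<in> chart_image d'"
  shows "chart_inv (fst d \<times> fst d', map_prod (snd d) (snd d')) (y, y') = (chart_inv d y, chart_inv d' y')"
proof -
  have inj: "inj_on (snd d) (fst d)" "inj_on (snd d') (fst d')"
    by (rule inj_on_inverseI, rule chart_inv_snd[OF assms(1,2)], assumption,
      rule inj_on_inverseI, rule chart_inv_snd[OF assms(3,4)])
  then have "inj_on (map_prod (snd d) (snd d')) (fst d \<times> fst d')" by (rule map_prod_inj_on)
  moreover have "(y, y') = map_prod (snd d) (snd d') (chart_inv d y, chart_inv d' y')"
    using assms by (simp add: snd_chart_inv)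
  moreover have "(chart_inv d y, chart_inv d' y') \<in> fst d \<times> fst d'"
    using assms(5,6) by (simp add: chart_inv_into)
  ultimately show ?thesis
    unfolding chart_inv_def[of "(fst d \<times> fst d', _)"] fst_conv snd_conv by (simp only: inv_into_f_f)
qed

lemma smooth_manifold_prod:
  assumes A: "smooth_manifold A" and A': "smooth_manifold A'"
  shows "smooth_manifold (prod_atlas A A')"
  unfolding smooth_manifold_def
proof (intro conjI ballI)
  fix c assume "c \<in> prod_atlas A A'"
  then obtain d d' where d: "d \<in> A" "d' \<in> A'" "c = (fst d \<times> fst d', map_prod (snd d) (snd d'))"
    by (auto simp: prod_atlas_iff)
  have im: "chart_image c = chart_image d \<times> chart_image d'"
    by (simp add: d(3) chart_image_def map_prod_surj_on)
  have inv: "chart_inv c y = (chart_inv d (fst y), chart_inv d' (snd y))" if "y \<in> chart_image c" for y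
  proof -
    have "fst y \<in> chart_image d" "snd y \<in> chart_image d'" using that unfolding im by auto
    from chart_inv_prod[OF A d(1) A' d(2) this] show ?thesis by (simp add: d(3))
  qed
  show "openin (top_of_set (carrier_of (prod_atlas A A'))) (fst c)"
    using openin_Times[OF chart_openin[OF A d(1)] chart_openin[OF A' d(2)]] by (simp add: d(3) carrier_of_prod_atlas)
  show "open (chart_image c)"
    unfolding im by (rule open_Times[OF open_chart_image[OF A d(1)] open_chart_image[OF A' d(2)]])
  note h = chart_homeomorphism[OF A d(1)] chart_homeomorphism[OF A' d(2)]
  show "homeomorphism (fst c) (chart_image c) (snd c) (chart_inv c)"
  proof (rule homeomorphismI)
    have "continuous_on (fst d \<times> fst d') (\<lambda>x. (snd d (fst x), snd d' (snd x)))"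
      by (intro continuous_on_Pair continuous_on_compose2[OF homeomorphism_cont1[OF h(1)] continuous_on_fst]
          continuous_on_compose2[OF homeomorphism_cont1[OF h(2)] continuous_on_snd] continuous_on_id) auto
    then show "continuous_on (fst c) (snd c)" by (simp add: d(3) map_prod_def case_prod_unfold)
    have "continuous_on (chart_image d \<times> chart_image d') (\<lambda>x. (chart_inv d (fst x), chart_inv d' (snd x)))"
      by (intro continuous_on_Pair continuous_on_compose2[OF homeomorphism_cont2[OF h(1)] continuous_on_fst]
          continuous_on_compose2[OF homeomorphism_cont2[OF h(2)] continuous_on_snd] continuous_on_id) auto
    then show "continuous_on (chart_image c) (chart_inv c)"
      unfolding im[symmetric] by (rule continuous_on_eq) (simp add: inv)
    show "snd c ` fst c \<subseteq> chart_image c" by (simp add: chart_image_def)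
    show "chart_inv c ` chart_image c \<subseteq> fst c" by (auto intro: chart_inv_into)
    show "snd c (chart_inv c y) = y" if "y \<in> chart_image c" for y by (rule snd_chart_inv[OF that])
    fix x assume x: "x \<in> fst c"
    then have "snd c x \<in> chart_image c" by (rule snd_in_chart_image)
    from inv[OF this] show "chart_inv c (snd c x) = x" using x A A' d(1,2) unfolding d(3) by auto
  qed
  fix c1 assume "c1 \<in> prod_atlas A A'"
  then obtain e e' where e: "e \<in> A" "e' \<in> A'" "c1 = (fst e \<times> fst e', map_prod (snd e) (snd e'))"
    by (auto simp: prod_atlas_iff)
  let ?U = "chart_domain d e id" and ?U' = "chart_domain d' e' id"
  note U = manifold_mapD[OF manifold_map_id[OF A] d(1) e(1)] and U' = manifold_mapD[OF manifold_map_id[OF A'] d(2) e(2)]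
  have dom: "snd c ` (fst c \<inter> fst c1) = ?U \<times> ?U'"
  proof -
    have "fst c \<inter> fst c1 = {z \<in> fst d. id z \<in> fst e} \<times> {z \<in> fst d'. id z \<in> fst e'}"
      by (auto simp: d(3) e(3))
    then show ?thesis by (simp add: d(3) chart_domain_def map_prod_surj_on)
  qed
  have op: "open (?U \<times> ?U')" using U(1) U'(1) by (rule open_Times)
  have eq: "in_charts c c1 id y = (in_charts d e id (fst y), in_charts d' e' id (snd y))" if "y \<in> ?U \<times> ?U'" for y
  proof -
    have "y \<in> chart_image c" using that chart_domain_subset[of d e id] chart_domain_subset[of d' e' id] unfolding im by auto
    then show ?thesis by (simp add: in_charts_def inv e(3))
  qed
  have "smooth_on (?U \<times> ?U') (\<lambda>y. (in_charts d e id (fst y), in_charts d' e' id (snd y)))"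
    by (intro smooth_on_Pair op smooth_on_compose[OF op _ U(2) smooth_on_fst[OF op smooth_on_id]]
        smooth_on_compose[OF op _ U'(2) smooth_on_snd[OF op smooth_on_id]]) auto
  then show "smooth_on (snd c ` (fst c \<inter> fst c1)) (in_charts c c1 id)"
    unfolding dom by (rule smooth_on_transform[OF _ op eq])
qed

lemma smooth_map_fst:
  assumes A: "smooth_manifold A" and A': "smooth_manifold A'"
  shows "smooth_map (prod_atlas A A') A (carrier_of A \<times> carrier_of A') fst"
proof -
  have "smooth_on (snd c ` {z \<in> fst c \<inter> carrier_of A \<times> carrier_of A'. fst z \<in> fst c'}) (in_charts c c' fst)"
    if c: "c \<in> prod_atlas A A'" "c' \<in> A" for c c'
  proof -
    obtain d d' where d: "d \<in> A" "d' \<in> A'" "c = (fst d \<times> fst d', map_prod (snd d) (snd d'))"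
      using c(1) by (auto simp: prod_atlas_iff)
    let ?U = "chart_domain d c' id"
    note U = manifold_mapD[OF manifold_map_id[OF A] d(1) c(2)]
    have "{z \<in> fst c \<inter> carrier_of A \<times> carrier_of A'. fst z \<in> fst c'} = {z \<in> fst d. id z \<in> fst c'} \<times> fst d'"
      using chart_subset_carrier[OF d(1)] chart_subset_carrier[OF d(2)] by (auto simp: d(3))
    then have dom: "snd c ` {z \<in> fst c \<inter> carrier_of A \<times> carrier_of A'. fst z \<in> fst c'} = ?U \<times> chart_image d'"
      by (simp add: d(3) chart_domain_def chart_image_def map_prod_surj_on)
    have op: "open (?U \<times> chart_image d')" using U(1) open_chart_image[OF A' d(2)] by (rule open_Times)
    have eq: "in_charts c c' fst y = in_charts d c' id (fst y)" if "y \<in> ?U \<times> chart_image d'" for y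
      using chart_inv_prod[OF A d(1) A' d(2), of "fst y" "snd y"] that chart_domain_subset[of d c' id]
      by (auto simp: in_charts_def d(3))
    have "smooth_on (?U \<times> chart_image d') (\<lambda>y. in_charts d c' id (fst y))"
      by (rule smooth_on_compose[OF op _ U(2) smooth_on_fst[OF op smooth_on_id]]) auto
    then show ?thesis unfolding dom by (rule smooth_on_transform[OF _ op eq])
  qed
  then have "smooth_on_open (prod_atlas A A') A (carrier_of A \<times> carrier_of A') fst"
    by (auto simp: smooth_on_open_def carrier_of_prod_atlas intro: continuous_on_fst continuous_on_id)
  then show ?thesis by (rule smooth_on_open_imp_smooth_map)
qed

lemma smooth_map_snd:
  assumes A: "smooth_manifold A" and A': "smooth_manifold A'"
  shows "smooth_map (prod_atlas A A') A' (carrier_of A \<times> carrier_of A') snd"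
proof -
  have "smooth_on (snd c ` {z \<in> fst c \<inter> carrier_of A \<times> carrier_of A'. snd z \<in> fst c'}) (in_charts c c' snd)"
    if c: "c \<in> prod_atlas A A'" "c' \<in> A'" for c c'
  proof -
    obtain d d' where d: "d \<in> A" "d' \<in> A'" "c = (fst d \<times> fst d', map_prod (snd d) (snd d'))"
      using c(1) by (auto simp: prod_atlas_iff)
    let ?U = "chart_domain d' c' id"
    note U = manifold_mapD[OF manifold_map_id[OF A'] d(2) c(2)]
    have "{z \<in> fst c \<inter> carrier_of A \<times> carrier_of A'. snd z \<in> fst c'} = fst d \<times> {z \<in> fst d'. id z \<in> fst c'}"
      using chart_subset_carrier[OF d(1)] chart_subset_carrier[OF d(2)] by (auto simp: d(3))
    then have dom: "snd c ` {z \<in> fst c \<inter> carrier_of A \<times> carrier_of A'. snd z \<in> fst c'} = chart_image d \<times> ?U"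
      by (simp add: d(3) chart_domain_def chart_image_def map_prod_surj_on)
    have op: "open (chart_image d \<times> ?U)" using open_chart_image[OF A d(1)] U(1) by (rule open_Times)
    have eq: "in_charts c c' snd y = in_charts d' c' id (snd y)" if "y \<in> chart_image d \<times> ?U" for y
      using chart_inv_prod[OF A d(1) A' d(2), of "fst y" "snd y"] that chart_domain_subset[of d' c' id]
      by (auto simp: in_charts_def d(3))
    have "smooth_on (chart_image d \<times> ?U) (\<lambda>y. in_charts d' c' id (snd y))"
      by (rule smooth_on_compose[OF op _ U(2) smooth_on_snd[OF op smooth_on_id]]) auto
    then show ?thesis unfolding dom by (rule smooth_on_transform[OF _ op eq])
  qed
  then have "smooth_on_open (prod_atlas A A') A' (carrier_of A \<times> carrier_of A') snd"
    by (auto simp: smooth_on_open_def carrier_of_prod_atlas intro: continuous_on_snd continuous_on_id)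
  then show ?thesis by (rule smooth_on_open_imp_smooth_map)
qed

section \<open>Induced smooth structures on subsets\<close>

lemma carrier_of_submanifold_atlas: "carrier_of (submanifold_atlas A S) \<subseteq> S"
  unfolding carrier_of_def submanifold_atlas_def using openin_subset by fastforce

text \<open>This holds for any subset S: a coordinate change runs from the model space into the
  ambient manifold and back to the model space, and both maps are smooth by definition of the
  charts.\<close>

lemma smooth_manifold_submanifold:
  fixes A :: "('p::{t2_space,second_countable_topology}, 'e::fin_dim_inner) atlas"
  assumes A: "smooth_manifold A"
  shows "smooth_manifold (submanifold_atlas A S :: ('p, 'h::fin_dim_inner) atlas)"
    (is "smooth_manifold ?L")
proof -
  have L: "openin (top_of_set S) (fst c)" "open (chart_image c)"
    "smooth_map A euclidean_atlas (fst c) (snd c)" "smooth_map euclidean_atlas A (chart_image c) (chart_inv c)"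
    "inj_on (snd c) (fst c)" if "c \<in> ?L" for c
    using that by (auto simp: submanifold_atlas_def diffeomorphism_def chart_inv_def bij_betw_def)
  have inv: "chart_inv c (snd c z) = z" if "c \<in> ?L" "z \<in> fst c" for c z
    using L(5)[OF that(1)] that(2) by (simp add: chart_inv_def)
  have homeo: "homeomorphism (fst c) (chart_image c) (snd c) (chart_inv c)" if c: "c \<in> ?L" for c
  proof (rule homeomorphismI)
    show "continuous_on (fst c) (snd c)" "continuous_on (chart_image c) (chart_inv c)"
      by (rule smooth_map_continuous_on[OF L(3)[OF c]], rule smooth_map_continuous_on[OF L(4)[OF c]])
  qed (auto simp: snd_in_chart_image snd_chart_inv inv[OF c] intro: chart_inv_into)
  show ?thesis
    unfolding smooth_manifold_def
  proof (intro conjI ballI)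
    fix c assume c: "c \<in> ?L"
    show "openin (top_of_set (carrier_of ?L)) (fst c)"
      by (rule openin_subset_trans[OF L(1)[OF c] chart_subset_carrier[OF c] carrier_of_submanifold_atlas])
    show "open (chart_image c)" by (rule L(2)[OF c])
    show "homeomorphism (fst c) (chart_image c) (snd c) (chart_inv c)" by (rule homeo[OF c])
    fix c' assume c': "c' \<in> ?L"
    let ?D = "snd c ` (fst c \<inter> fst c')"
    have "openin (top_of_set (fst c)) (fst c \<inter> fst c')"
      using L(1)[OF c'] openin_subset[OF L(1)[OF c]] by (auto simp: openin_open)
    then have "openin (top_of_set (chart_image c)) ?D"
      by (rule homeomorphism_imp_open_map[OF homeo[OF c]])
    then have D: "open ?D" "?D \<subseteq> chart_image c" using L(2)[OF c] by (auto simp: openin_open_eq)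
    have "smooth_map euclidean_atlas euclidean_atlas ?D (snd c' \<circ> chart_inv c)"
      by (rule smooth_map_comp[OF smooth_manifold_euclidean A smooth_manifold_euclidean
            smooth_map_subset[OF L(4)[OF c] D(2)] L(3)[OF c']]) (use inv[OF c] in auto)
    then show "smooth_on ?D (in_charts c c' id)"
      using smooth_map_euclidean[OF _ D(1)] by (simp add: in_charts_def)
  qed
qed


subsection \<open>Subcomplexes closed under products\<close>

lemma form_component_apply: "form_component r \<omega> c y vs = (if length vs = r then \<omega> c y vs else 0)"
  by (simp add: form_component_def)

lemma wedge_assoc: "wedge (wedge \<omega> \<eta>) \<theta> = wedge \<omega> (wedge \<eta> \<theta>)"
proof -
  have "wedge \<alpha> \<beta> = (\<lambda>c y. list_wedge (\<alpha> c y) (\<beta> c y))" for \<alpha> \<beta> :: "('a, 'b) form"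
    by (intro ext) (simp add: wedge_eq_list_wedge)
  then show ?thesis by (simp add: list_wedge_assoc)
qed

lemma wedge_commute_even:
  assumes "\<And>c y vs. odd (length vs) \<Longrightarrow> \<eta> c y vs = 0"
  shows "wedge \<omega> \<eta> = wedge \<eta> \<omega>"
  by (intro ext) (simp add: wedge_eq_list_wedge list_wedge_commute_even assms)

lemma wedge_commute_odd:
  assumes "\<And>c y vs. even (length vs) \<Longrightarrow> \<eta> c y vs = 0"
  shows "wedge \<omega> \<eta> = wedge \<eta> (form_twist \<omega>)"
  by (intro ext) (simp add: wedge_eq_list_wedge form_twist_eq list_wedge_commute_odd assms)

text \<open>A splitting by parity takes the place of a degree, as forms may be
  inhomogeneous.\<close>

definition even_part :: "('p, 'e) form \<Rightarrow> ('p, 'e) form" where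
  "even_part = form_weight (\<lambda>n. if even n then 1 else 0)"

definition odd_part :: "('p, 'e) form \<Rightarrow> ('p, 'e) form" where
  "odd_part = form_weight (\<lambda>n. if odd n then 1 else 0)"

lemma even_part_plus_odd_part: "even_part \<omega> + odd_part \<omega> = \<omega>"
  by (intro ext) (simp add: even_part_def odd_part_def form_weight_def)

text \<open>Brings the two outer left factors together and the two right factors together. Moving
  \<gamma> past the even part of \<omega>' gives no sign, moving it past the odd part twists
  \<gamma>.\<close>

lemma wedge_wedge_exchange:
  "wedge (wedge \<omega> \<gamma>) (wedge \<omega>' \<gamma>') =
     wedge (wedge \<omega> (even_part \<omega>')) (wedge \<gamma> \<gamma>') +
     wedge (wedge \<omega> (odd_part \<omega>')) (wedge (form_twist \<gamma>) \<gamma>')"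
proof -
  have "wedge (wedge \<omega> \<gamma>) (wedge \<omega>' \<gamma>') = wedge \<omega> (wedge (wedge \<gamma> \<omega>') \<gamma>')"
    by (simp only: wedge_assoc)
  also have "wedge \<gamma> \<omega>' = wedge \<gamma> (even_part \<omega>') + wedge \<gamma> (odd_part \<omega>')"
    by (simp only: wedge_add_right[symmetric] even_part_plus_odd_part)
  also have "wedge \<gamma> (even_part \<omega>') = wedge (even_part \<omega>') \<gamma>"
    by (rule wedge_commute_even) (simp add: even_part_def form_weight_def)
  also have "wedge \<gamma> (odd_part \<omega>') = wedge (odd_part \<omega>') (form_twist \<gamma>)"
    by (rule wedge_commute_odd) (simp add: odd_part_def form_weight_def)
  finally show ?thesis by (simp only: wedge_add_left wedge_add_right wedge_assoc)
qed

lemma form_component_wedge: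
  "form_component r (wedge \<omega> \<eta>) = (\<Sum>a\<le>r. wedge (form_component a \<omega>) (form_component (r - a) \<eta>))"
proof (intro ext)
  fix c y vs
  let ?t = "\<lambda>S. shuffle_sign (length vs) S * \<omega> c y (nths vs S) * \<eta> c y (nths vs (- S))"
  have app: "(\<Sum>a\<in>I. F a) c y vs = (\<Sum>a\<in>I. F a c y vs)" for F :: "nat \<Rightarrow> ('a, 'b) form" and I
    by (induction I rule: infinite_finite_induct) auto
  have inner: "(\<Sum>a\<le>r. shuffle_sign (length vs) S * form_component a \<omega> c y (nths vs S) *
      form_component (r - a) \<eta> c y (nths vs (- S))) = (if length vs = r then ?t S else 0)" for S
  proof -
    \<comment> \<open>For given S only the summand where a is the length of the first block can be
      nonzero, and it requires the two blocks to have total length r.\<close>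
    have "(\<Sum>a\<le>r. shuffle_sign (length vs) S * form_component a \<omega> c y (nths vs S) *
        form_component (r - a) \<eta> c y (nths vs (- S))) =
        (\<Sum>a\<le>r. if a = length (nths vs S) then (if length vs = r then ?t S else 0) else 0)"
      using length_nths_Compl[of vs S] by (intro sum.cong) (auto simp: form_component_apply)
    also have "\<dots> = (if length vs = r then ?t S else 0)"
      using length_nths_Compl[of vs S] by auto
    finally show ?thesis .
  qed
  have "(\<Sum>a\<le>r. wedge (form_component a \<omega>) (form_component (r - a) \<eta>)) c y vs =
      (\<Sum>a\<le>r. \<Sum>S\<in>Pow {..<length vs}. shuffle_sign (length vs) S * form_component a \<omega> c y (nths vs S) *
        form_component (r - a) \<eta> c y (nths vs (- S)))"
    by (simp only: app wedge_def)
  also have "\<dots> = (\<Sum>S\<in>Pow {..<length vs}. if length vs = r then ?t S else 0)"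
    by (subst sum.swap) (simp only: inner)
  also have "\<dots> = form_component r (wedge \<omega> \<eta>) c y vs"
    by (simp add: form_component_apply wedge_def)
  finally show "form_component r (wedge \<omega> \<eta>) c y vs =
      (\<Sum>a\<le>r. wedge (form_component a \<omega>) (form_component (r - a) \<eta>)) c y vs" ..
qed

text \<open>The shape of the finite sums in \<open>ft_forms\<close>. Scalars are not part of it;
  they are absorbed by the factors from \<open>M\<close>.\<close>

definition wedge_sums :: "('p, 'e) form set \<Rightarrow> ('p, 'e) form set \<Rightarrow> ('p, 'e) form set" where
  "wedge_sums M N = {\<Sum>j<(l::nat). wedge (f j) (g j) | l f g. \<forall>j<l. f j \<in> M \<and> g j \<in> N}"

lemma wedge_sumsE:
  assumes "\<omega> \<in> wedge_sums M N"
  obtains l :: nat and f g where "\<omega> = (\<Sum>j<l. wedge (f j) (g j))"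
    "\<And>j. j < l \<Longrightarrow> f j \<in> M" "\<And>j. j < l \<Longrightarrow> g j \<in> N"
  using assms by (auto simp: wedge_sums_def)

lemma wedge_sums_zero: "0 \<in> wedge_sums M N"
  unfolding wedge_sums_def mem_Collect_eq by (rule exI[of _ 0]) simp

lemma wedge_sums_add_wedge:
  assumes "\<omega> \<in> wedge_sums M N" "f \<in> M" "g \<in> N"
  shows "\<omega> + wedge f g \<in> wedge_sums M N"
proof -
  obtain l :: nat and F G where *: "\<omega> = (\<Sum>j<l. wedge (F j) (G j))" "\<And>j. j < l \<Longrightarrow> F j \<in> M" "\<And>j. j < l \<Longrightarrow> G j \<in> N"
    using assms(1) by (rule wedge_sumsE) blast
  let ?F = "F(l := f)" and ?G = "G(l := g)"
  have "\<omega> + wedge f g = (\<Sum>j<Suc l. wedge (?F j) (?G j))"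
    unfolding sum.lessThan_Suc *(1) by (rule arg_cong2[where f="(+)"]) (auto intro: sum.cong)
  moreover have "\<forall>j<Suc l. ?F j \<in> M \<and> ?G j \<in> N" using * assms by (auto simp: less_Suc_eq)
  ultimately show ?thesis unfolding wedge_sums_def by blast
qed

lemma wedge_sums_wedge: "f \<in> M \<Longrightarrow> g \<in> N \<Longrightarrow> wedge f g \<in> wedge_sums M N"
  using wedge_sums_add_wedge[OF wedge_sums_zero, of f M g N] by simp

lemma wedge_sums_add:
  assumes "\<omega> \<in> wedge_sums M N" "\<eta> \<in> wedge_sums M N"
  shows "\<omega> + \<eta> \<in> wedge_sums M N"
proof -
  obtain l :: nat and f g where *: "\<eta> = (\<Sum>j<l. wedge (f j) (g j))" "\<And>j. j < l \<Longrightarrow> f j \<in> M" "\<And>j. j < l \<Longrightarrow> g j \<in> N"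
    using assms(2) by (rule wedge_sumsE) blast
  have "n \<le> l \<Longrightarrow> \<omega> + (\<Sum>j<n. wedge (f j) (g j)) \<in> wedge_sums M N" for n
  proof (induction n)
    case 0
    show ?case using assms(1) by (simp only: lessThan_0 sum.empty add_0_right)
  next
    case (Suc n)
    then have n: "n \<le> l" "n < l" by simp_all
    show ?case
      unfolding sum.lessThan_Suc add.assoc[symmetric]
      by (rule wedge_sums_add_wedge[OF Suc.IH[OF n(1)] *(2)[OF n(2)] *(3)[OF n(2)]])
  qed
  then show ?thesis using * by blast
qed

lemma wedge_sums_sum: "(\<And>i. i \<in> I \<Longrightarrow> \<omega> i \<in> wedge_sums M N) \<Longrightarrow> (\<Sum>i\<in>I. \<omega> i) \<in> wedge_sums M N"
proof (induction I rule: infinite_finite_induct)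
  case (insert i I)
  then show ?case unfolding sum.insert[OF insert.hyps] by (intro wedge_sums_add) simp_all
qed (simp_all only: simp_thms sum.infinite sum.empty wedge_sums_zero)

lemma weight_add: "form_weight r (\<omega> + \<eta>) = form_weight r \<omega> + form_weight r \<eta>"
  by (intro ext) (simp add: form_weight_def algebra_simps)

lemma weight_zero: "form_weight r 0 = 0"
  by (intro ext) (simp add: form_weight_def)

lemma weight_sum: "form_weight r (\<Sum>i\<in>I. \<omega> i) = (\<Sum>i\<in>I. form_weight r (\<omega> i))"
  by (induction I rule: infinite_finite_induct)
    (simp_all only: simp_thms not_False_eq_True sum.infinite sum.empty sum.insert weight_zero weight_add)

text \<open>M is meant for base forms and N for fibre forms. M is stable under all weights because
  the Leibniz rule twists the first factor and regrouping a product takes parity parts of a base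
  form. The twisted product in N arises when a fibre form passes an odd base form.\<close>

lemma sub_dga_wedge_sums:
  assumes A: "smooth_manifold A"
    and M: "M \<subseteq> forms A" "\<And>f r. f \<in> M \<Longrightarrow> form_weight r f \<in> M" "\<And>f. f \<in> M \<Longrightarrow> ext_d A f \<in> M"
      "\<And>f f'. f \<in> M \<Longrightarrow> f' \<in> M \<Longrightarrow> wedge f f' \<in> M"
    and N: "N \<subseteq> forms A" "\<And>g r. g \<in> N \<Longrightarrow> form_component r g \<in> N" "\<And>g. g \<in> N \<Longrightarrow> ext_d A g \<in> N"
      "\<And>g g'. g \<in> N \<Longrightarrow> g' \<in> N \<Longrightarrow> wedge g g' \<in> N"
      "\<And>g g'. g \<in> N \<Longrightarrow> g' \<in> N \<Longrightarrow> wedge (form_twist g) g' \<in> N"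
  shows "sub_dga A (wedge_sums M N)"
  unfolding sub_dga_def
proof (intro conjI ballI allI subsetI)
  show "0 \<in> wedge_sums M N" by (rule wedge_sums_zero)
  show "\<omega> + \<eta> \<in> wedge_sums M N" if "\<omega> \<in> wedge_sums M N" "\<eta> \<in> wedge_sums M N" for \<omega> \<eta>
    using that by (rule wedge_sums_add)
  fix \<omega> assume "\<omega> \<in> wedge_sums M N"
  then obtain l :: nat and f g where \<omega>: "\<omega> = (\<Sum>j<l. wedge (f j) (g j))"
    and f: "\<And>j. j < l \<Longrightarrow> f j \<in> M" and g: "\<And>j. j < l \<Longrightarrow> g j \<in> N"
    by (rule wedge_sumsE) blast
  have forms: "wedge (f j) (g j) \<in> forms A" if "j < l" for j
    using f[OF that] g[OF that] M(1) N(1) by (intro wedge_forms[OF A]) blast+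
  then show "\<omega> \<in> forms A" unfolding \<omega> by (intro sum_forms[OF A]) simp
  show "form_scale a \<omega> \<in> wedge_sums M N" for a
    unfolding form_scale_eq_weight \<omega> weight_sum
    unfolding form_scale_eq_weight[symmetric] wedge_scale_left[symmetric]
    by (intro wedge_sums_sum wedge_sums_wedge g) (simp_all add: form_scale_eq_weight M f)
  show "form_component r \<omega> \<in> wedge_sums M N" for r
    unfolding form_component_eq_weight \<omega> weight_sum
    unfolding form_component_eq_weight[symmetric] form_component_wedge
    by (intro wedge_sums_sum wedge_sums_wedge N(2) g) (simp_all add: form_component_eq_weight M f)
  have "ext_d A (wedge (f j) (g j)) \<in> wedge_sums M N" if "j < l" for j
  proof -
    have "f j \<in> forms A" "g j \<in> forms A" using f[OF that] g[OF that] M(1) N(1) by blast+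
    then show ?thesis
      unfolding ext_d_wedge[OF A \<open>f j \<in> forms A\<close> \<open>g j \<in> forms A\<close>] form_twist_def
      by (intro wedge_sums_add wedge_sums_wedge M N f g that)
  qed
  then show "ext_d A \<omega> \<in> wedge_sums M N"
    unfolding \<omega> using forms by (subst ext_d_sum[OF A]) (auto intro: wedge_sums_sum)
  fix \<eta> assume "\<eta> \<in> wedge_sums M N"
  then obtain l' :: nat and f' g' where \<eta>: "\<eta> = (\<Sum>j<l'. wedge (f' j) (g' j))"
    and f': "\<And>j. j < l' \<Longrightarrow> f' j \<in> M" and g': "\<And>j. j < l' \<Longrightarrow> g' j \<in> N"
    by (rule wedge_sumsE) blast
  have "wedge (wedge (f i) (g i)) (wedge (f' j) (g' j)) \<in> wedge_sums M N" if "i < l" "j < l'" for i j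
  proof -
    note fg = f[OF that(1)] g[OF that(1)] and fg' = f'[OF that(2)] g'[OF that(2)]
    show ?thesis
      by (subst wedge_wedge_exchange, unfold even_part_def odd_part_def)
        (rule wedge_sums_add[OF wedge_sums_wedge[OF M(4)[OF fg(1) M(2)[OF fg'(1)]] N(4)[OF fg(2) fg'(2)]]
            wedge_sums_wedge[OF M(4)[OF fg(1) M(2)[OF fg'(1)]] N(5)[OF fg(2) fg'(2)]]])
  qed
  then show "wedge \<omega> \<eta> \<in> wedge_sums M N"
    unfolding \<omega> \<eta> wedge_sum_left wedge_sum_right by (intro wedge_sums_sum) simp
qed

text \<open>Pullbacks commute with all operations, so the operation applied to \<eta> is a witness
  for the operation applied to \<omega>. The instances are f = \<open>id\<close> with g a
  trivialization, and f the collar with g = \<open>snd\<close>.\<close>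

lemma sub_dga_pullback:
  assumes B: "smooth_manifold B" and A: "smooth_manifold A" and A': "smooth_manifold A'"
    and f: "manifold_map B A f" and g: "manifold_map B A' g" and C: "sub_dga A' C"
  shows "sub_dga A {\<omega> \<in> forms A. \<exists>\<eta>\<in>C. pullback B A f \<omega> = pullback B A' g \<eta>}"
    (is "sub_dga A ?D")
  unfolding sub_dga_def
proof (intro conjI ballI allI)
  have CI: "\<eta> \<in> forms A'" if "\<eta> \<in> C" for \<eta> using C that by (auto simp: sub_dga_def)
  have D: "\<omega> \<in> ?D" if "\<omega> \<in> forms A" "\<eta> \<in> C" "pullback B A f \<omega> = pullback B A' g \<eta>" for \<omega> \<eta>
    using that by blast
  show "?D \<subseteq> forms A" by blast
  show "0 \<in> ?D"
    by (rule D[of _ 0]) (use A C in \<open>simp_all only: zero_forms pullback_zero sub_dga_def\<close>)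
  fix \<omega> assume "\<omega> \<in> ?D"
  then obtain \<eta> where \<omega>: "\<omega> \<in> forms A" "\<eta> \<in> C" "pullback B A f \<omega> = pullback B A' g \<eta>" by blast
  show "form_scale a \<omega> \<in> ?D" for a
    by (rule D[of _ "form_scale a \<eta>"])
      (use \<omega> A C in \<open>simp_all only: form_scale_eq_weight weight_forms pullback_weight sub_dga_def\<close>)
  show "form_component r \<omega> \<in> ?D" for r
    by (rule D[of _ "form_component r \<eta>"])
      (use \<omega> A C in \<open>simp_all only: form_component_eq_weight weight_forms pullback_weight sub_dga_def\<close>)
  show "ext_d A \<omega> \<in> ?D"
  proof (rule D[of _ "ext_d A' \<eta>"])
    show "ext_d A \<omega> \<in> forms A" by (rule ext_d_forms[OF A \<omega>(1)])
    show "ext_d A' \<eta> \<in> C" using C \<omega>(2) by (simp add: sub_dga_def)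
    show "pullback B A f (ext_d A \<omega>) = pullback B A' g (ext_d A' \<eta>)"
      using ext_d_pullback[OF B A f \<omega>(1)] ext_d_pullback[OF B A' g CI[OF \<omega>(2)]] \<omega>(3) by metis
  qed
  fix \<omega>' assume "\<omega>' \<in> ?D"
  then obtain \<eta>' where \<omega>': "\<omega>' \<in> forms A" "\<eta>' \<in> C" "pullback B A f \<omega>' = pullback B A' g \<eta>'" by blast
  show "\<omega> + \<omega>' \<in> ?D"
    by (rule D[of _ "\<eta> + \<eta>'"])
      (use \<omega> \<omega>' A C in \<open>simp_all only: add_forms pullback_add sub_dga_def\<close>)
  show "wedge \<omega> \<omega>' \<in> ?D"
    by (rule D[of _ "wedge \<eta> \<eta>'"])
      (use \<omega> \<omega>' A C in \<open>simp_all only: wedge_forms pullback_wedge sub_dga_def\<close>)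
qed

lemma sub_dga_forms: "smooth_manifold A \<Longrightarrow> sub_dga A (forms A)"
  unfolding sub_dga_def form_scale_eq_weight form_component_eq_weight
  by (intro conjI ballI allI subset_refl zero_forms add_forms weight_forms ext_d_forms wedge_forms)

lemma sub_dgaD:
  assumes "sub_dga A C"
  shows sub_dga_subset: "C \<subseteq> forms A"
    and sub_dga_zero: "0 \<in> C"
    and sub_dga_add: "\<omega> \<in> C \<Longrightarrow> \<eta> \<in> C \<Longrightarrow> \<omega> + \<eta> \<in> C"
    and sub_dga_scale: "\<omega> \<in> C \<Longrightarrow> form_scale a \<omega> \<in> C"
    and sub_dga_component: "\<omega> \<in> C \<Longrightarrow> form_component r \<omega> \<in> C"
    and sub_dga_ext_d: "\<omega> \<in> C \<Longrightarrow> ext_d A \<omega> \<in> C"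
    and sub_dga_wedge: "\<omega> \<in> C \<Longrightarrow> \<eta> \<in> C \<Longrightarrow> wedge \<omega> \<eta> \<in> C"
  using assms by (simp_all only: sub_dga_def)

text \<open>Intersecting within \<open>forms A\<close> gives the right meaning for empty
  \<open>I\<close>.\<close>

lemma sub_dga_INT:
  assumes A: "smooth_manifold A" and D: "\<And>i. i \<in> I \<Longrightarrow> sub_dga A (D i)"
  shows "sub_dga A {\<omega> \<in> forms A. \<forall>i\<in>I. \<omega> \<in> D i}"
  unfolding sub_dga_def mem_Collect_eq
proof (intro conjI ballI allI; (unfold mem_Collect_eq)?; (intro conjI ballI)?; (elim conjE)?)
  show "{\<omega> \<in> forms A. \<forall>i\<in>I. \<omega> \<in> D i} \<subseteq> forms A" by blast
qed (simp_all add: sub_dgaD[OF sub_dga_forms[OF A]] sub_dgaD[OF D] del: plus_fun_apply)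

subsection \<open>The cotruncation\<close>

lemma codifferential_zero: "codifferential A G k 0 = 0"
proof -
  have "hodge_star G 0 = 0" by (intro ext) (simp add: hodge_star_def Let_def)
  moreover have "form_scale a 0 = 0" for a by (intro ext) (simp add: form_scale_def)
  ultimately show ?thesis by (simp only: codifferential_def ext_d_zero)
qed

lemma cotruncationI:
  assumes "\<gamma> \<in> forms A" "\<And>c y vs. length vs \<le> k \<Longrightarrow> \<gamma> c y vs = 0"
  shows "\<gamma> \<in> cotruncation A G k"
proof -
  have "form_component r \<gamma> = 0" if "r \<le> k" for r
    using that assms(2) by (intro ext) (simp add: form_component_apply)
  then show ?thesis using assms(1) codifferential_zero unfolding cotruncation_def by simp
qed

lemma cotruncation_vanishes:
  assumes "\<gamma> \<in> cotruncation A G k" "length vs < k"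
  shows "\<gamma> c y vs = 0"
proof -
  have "form_component (length vs) \<gamma> = 0" using assms by (simp add: cotruncation_def)
  from fun_cong[OF fun_cong[OF fun_cong[OF this]], of c y vs] show ?thesis
    by (simp add: form_component_apply)
qed

lemma cotruncation_component:
  assumes "smooth_manifold A" "\<gamma> \<in> cotruncation A G k"
  shows "form_component r \<gamma> \<in> cotruncation A G k"
proof -
  have 0: "form_component s 0 = 0" for s by (intro ext) (simp add: form_component_apply)
  \<comment> \<open>In degree k the component is either that of \<gamma>, which is coclosed by
    assumption, or 0.\<close>
  have *: "form_component s (form_component r \<gamma>) = (if s = r then form_component r \<gamma> else 0)" for s
    by (intro ext) (simp add: form_component_apply)
  show ?thesis
    using assms codifferential_zero weight_forms[of A \<gamma>] unfolding cotruncation_def mem_Collect_eq *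
    by (auto simp: form_component_eq_weight)
qed

lemma cotruncation_ext_d:
  assumes A: "smooth_manifold A" and \<gamma>: "\<gamma> \<in> cotruncation A G k" and k: "k \<ge> 1"
  shows "ext_d A \<gamma> \<in> cotruncation A G k"
proof (rule cotruncationI)
  show "ext_d A \<gamma> \<in> forms A" using A \<gamma> by (intro ext_d_forms) (simp_all add: cotruncation_def)
  show "ext_d A \<gamma> c y vs = 0" if vs: "length vs \<le> k" for c y vs
  proof -
    \<comment> \<open>Omitting one of at most k arguments leaves fewer than k.\<close>
    have "\<gamma> c x (take i vs @ drop (Suc i) vs) = 0" if "i < length vs" for x i
      by (rule cotruncation_vanishes[OF \<gamma>]) (use that vs in auto)
    then show ?thesis by (simp add: ext_d_def)
  qed
qed

lemma cotruncation_wedge: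
  assumes A: "smooth_manifold A" and \<gamma>: "\<gamma> \<in> cotruncation A G k" "\<gamma>' \<in> cotruncation A G k" and k: "k \<ge> 1"
  shows "wedge (form_weight r \<gamma>) \<gamma>' \<in> cotruncation A G k"
proof (rule cotruncationI)
  show "wedge (form_weight r \<gamma>) \<gamma>' \<in> forms A"
    using A \<gamma> by (intro wedge_forms weight_forms) (simp_all add: cotruncation_def)
  show "wedge (form_weight r \<gamma>) \<gamma>' c y vs = 0" if vs: "length vs \<le> k" for c y vs
  proof -
    have "form_weight r \<gamma> c y (nths vs S) = 0 \<or> \<gamma>' c y (nths vs (- S)) = 0" for S
    proof -
      \<comment> \<open>Two blocks of length at least k would give 2 * k \<le> k; this is where k
        \<ge> 1 enters.\<close>
      have "length (nths vs S) < k \<or> length (nths vs (- S)) < k"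
        using length_nths_Compl[of vs S] vs k by linarith
      then show ?thesis
        using cotruncation_vanishes[OF \<gamma>(1), of _ c y] cotruncation_vanishes[OF \<gamma>(2), of _ c y]
        by (auto simp: form_weight_def)
    qed
    then show ?thesis unfolding wedge_def by (intro sum.neutral) auto
  qed
qed


subsection \<open>The cup product on the cohomology of a sub-DGA\<close>

lemma homogeneous_vanishes: "homogeneous r \<omega> \<Longrightarrow> length vs \<noteq> r \<Longrightarrow> \<omega> c y vs = 0"
  unfolding homogeneous_def by (metis form_component_apply)

lemma homogeneousI: "(\<And>c y vs. length vs \<noteq> r \<Longrightarrow> \<omega> c y vs = 0) \<Longrightarrow> homogeneous r \<omega>"
  unfolding homogeneous_def by (intro ext) (simp add: form_component_apply)

lemma homogeneous_add: "homogeneous r \<omega> \<Longrightarrow> homogeneous r \<eta> \<Longrightarrow> homogeneous r (\<omega> + \<eta>)"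
  by (rule homogeneousI) (simp add: homogeneous_vanishes)

lemma homogeneous_scale: "homogeneous r \<omega> \<Longrightarrow> homogeneous r (form_scale a \<omega>)"
  by (rule homogeneousI) (simp add: homogeneous_vanishes form_scale_def)

lemma homogeneous_zero: "homogeneous r 0"
  by (rule homogeneousI) simp

lemma homogeneous_wedge:
  assumes "homogeneous r \<omega>" "homogeneous s \<eta>"
  shows "homogeneous (r + s) (wedge \<omega> \<eta>)"
proof (rule homogeneousI)
  fix c y and vs :: "'b list" assume len: "length vs \<noteq> r + s"
  have "\<omega> c y (nths vs S) = 0 \<or> \<eta> c y (nths vs (- S)) = 0" for S
    using length_nths_Compl[of vs S] len homogeneous_vanishes[OF assms(1), of "nths vs S"]
      homogeneous_vanishes[OF assms(2), of "nths vs (- S)"] by fastforce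
  then show "wedge \<omega> \<eta> c y vs = 0" unfolding wedge_def by (intro sum.neutral) auto
qed

text \<open>On homogeneous forms the involution becomes the classical scalar sign.\<close>

lemma form_twist_homogeneous: "homogeneous r \<omega> \<Longrightarrow> form_twist \<omega> = form_scale ((-1) ^ r) \<omega>"
proof (intro ext)
  fix c y vs assume "homogeneous r \<omega>"
  then show "form_twist \<omega> c y vs = form_scale ((-1) ^ r) \<omega> c y vs"
    by (cases "length vs = r") (simp_all add: form_twist_def form_weight_def form_scale_def homogeneous_vanishes)
qed

lemma form_scale_add: "form_scale a (\<omega> + \<eta>) = form_scale a \<omega> + form_scale a \<eta>"
  by (intro ext) (simp add: form_scale_def algebra_simps)

lemma form_scale_zero_right: "form_scale a 0 = 0"
  by (intro ext) (simp add: form_scale_def)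

context
  fixes A :: "('p::{t2_space,second_countable_topology}, 'e::fin_dim_inner) atlas" and C :: "('p, 'e) form set"
  assumes A: "smooth_manifold A" and C: "sub_dga A C"
begin

private lemma in_forms: "\<omega> \<in> C \<Longrightarrow> \<omega> \<in> forms A"
  using sub_dga_subset[OF C] by blast

private lemma cocyclesD:
  assumes "\<omega> \<in> cocycles A C r"
  shows "\<omega> \<in> C" "homogeneous r \<omega>" "ext_d A \<omega> = 0" "\<omega> \<in> forms A"
  using assms in_forms by (auto simp: cocycles_def)

private lemma ext_d_coboundary:
  assumes "\<theta> \<in> C" "homogeneous q \<theta>"
  shows "ext_d A \<theta> \<in> coboundaries A C (Suc q)"
  unfolding coboundaries_def nat.case using assms by (intro imageI CollectI conjI)

lemma coboundaries_zero: "0 \<in> coboundaries A C r"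
proof (cases r)
  case (Suc q)
  have "ext_d A 0 \<in> coboundaries A C r"
    unfolding Suc by (rule ext_d_coboundary[OF sub_dga_zero[OF C] homogeneous_zero])
  then show ?thesis by (simp only: ext_d_zero)
qed (simp add: coboundaries_def)

lemma coboundaries_add:
  assumes "\<beta> \<in> coboundaries A C r" "\<beta>' \<in> coboundaries A C r"
  shows "\<beta> + \<beta>' \<in> coboundaries A C r"
proof (cases r)
  case 0
  then show ?thesis using assms by (simp add: coboundaries_def)
next
  case (Suc q)
  then obtain \<theta> \<theta>' where "\<theta> \<in> C" "homogeneous q \<theta>" "\<beta> = ext_d A \<theta>" "\<theta>' \<in> C" "homogeneous q \<theta>'" "\<beta>' = ext_d A \<theta>'"
    using assms by (auto simp: coboundaries_def)
  then have "\<beta> + \<beta>' = ext_d A (\<theta> + \<theta>')" "\<theta> + \<theta>' \<in> C" "homogeneous q (\<theta> + \<theta>')"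
    using ext_d_add[OF A in_forms in_forms] sub_dga_add[OF C] homogeneous_add by metis+
  then show ?thesis using ext_d_coboundary unfolding Suc by metis
qed

lemma coboundaries_scale:
  assumes "\<beta> \<in> coboundaries A C r"
  shows "form_scale a \<beta> \<in> coboundaries A C r"
proof (cases r)
  case 0
  then show ?thesis using assms by (simp add: coboundaries_def form_scale_zero_right)
next
  case (Suc q)
  then obtain \<theta> where "\<theta> \<in> C" "homogeneous q \<theta>" "\<beta> = ext_d A \<theta>"
    using assms by (auto simp: coboundaries_def)
  then have "form_scale a \<beta> = ext_d A (form_scale a \<theta>)" "form_scale a \<theta> \<in> C" "homogeneous q (form_scale a \<theta>)"
    using ext_d_scale[OF A in_forms] sub_dga_scale[OF C] homogeneous_scale by metis+
  then show ?thesis using ext_d_coboundary unfolding Suc by metis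
qed

lemma cocycles_add: "\<omega> \<in> cocycles A C r \<Longrightarrow> \<eta> \<in> cocycles A C r \<Longrightarrow> \<omega> + \<eta> \<in> cocycles A C r"
  using ext_d_add[OF A cocyclesD(4) cocyclesD(4)] sub_dga_add[OF C] homogeneous_add
  unfolding cocycles_def mem_Collect_eq by (metis (no_types, lifting) add_0 cocyclesD(4) in_forms ext_d_add[OF A])

lemma cocycles_scale: "\<omega> \<in> cocycles A C r \<Longrightarrow> form_scale a \<omega> \<in> cocycles A C r"
  unfolding cocycles_def mem_Collect_eq
  using sub_dga_scale[OF C] homogeneous_scale ext_d_scale[OF A in_forms] form_scale_zero_right by metis

lemma cocycles_wedge:
  assumes "\<omega> \<in> cocycles A C r" "\<omega>' \<in> cocycles A C s"
  shows "wedge \<omega> \<omega>' \<in> cocycles A C (r + s)"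
proof -
  have "ext_d A (wedge \<omega> \<omega>') = 0"
    unfolding ext_d_wedge[OF A cocyclesD(4)[OF assms(1)] cocyclesD(4)[OF assms(2)]]
      cocyclesD(3)[OF assms(1)] cocyclesD(3)[OF assms(2)] wedge_zero_left wedge_zero_right by (rule add_0_right)
  moreover have "wedge \<omega> \<omega>' \<in> C"
    by (rule sub_dga_wedge[OF C cocyclesD(1)[OF assms(1)] cocyclesD(1)[OF assms(2)]])
  moreover have "homogeneous (r + s) (wedge \<omega> \<omega>')"
    by (rule homogeneous_wedge[OF cocyclesD(2)[OF assms(1)] cocyclesD(2)[OF assms(2)]])
  ultimately show ?thesis unfolding cocycles_def by blast
qed

text \<open>d\<theta> \<and> \<omega> = d (\<theta> \<and> \<omega>), because d\<omega> = 0. In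
  degree 0 the only coboundary is 0.\<close>

lemma coboundaries_wedge_left:
  assumes "\<beta> \<in> coboundaries A C r" "\<omega> \<in> cocycles A C s"
  shows "wedge \<beta> \<omega> \<in> coboundaries A C (r + s)"
proof (cases r)
  case 0
  then have "\<beta> = 0" using assms(1) by (simp add: coboundaries_def)
  then show ?thesis by (simp only: wedge_zero_left coboundaries_zero)
next
  case (Suc q)
  then obtain \<theta> where \<theta>: "\<theta> \<in> C" "homogeneous q \<theta>" "\<beta> = ext_d A \<theta>"
    using assms by (auto simp: coboundaries_def)
  have "ext_d A (wedge \<theta> \<omega>) = wedge \<beta> \<omega>"
    unfolding ext_d_wedge[OF A in_forms[OF \<theta>(1)] cocyclesD(4)[OF assms(2)]] \<theta>(3)
      cocyclesD(3)[OF assms(2)] wedge_zero_right by (rule add_0_right)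
  moreover have "wedge \<theta> \<omega> \<in> C" by (rule sub_dga_wedge[OF C \<theta>(1) cocyclesD(1)[OF assms(2)]])
  moreover have "homogeneous (q + s) (wedge \<theta> \<omega>)"
    by (rule homogeneous_wedge[OF \<theta>(2) cocyclesD(2)[OF assms(2)]])
  ultimately show ?thesis using ext_d_coboundary unfolding Suc add_Suc by metis
qed

lemma coboundaries_wedge_right:
  assumes "\<omega> \<in> cocycles A C r" "\<beta> \<in> coboundaries A C s"
  shows "wedge \<omega> \<beta> \<in> coboundaries A C (r + s)"
proof (cases s)
  case 0
  then have "\<beta> = 0" using assms(2) by (simp add: coboundaries_def)
  then show ?thesis by (simp only: wedge_zero_right coboundaries_zero)
next
  case (Suc q)
  then obtain \<theta> where \<theta>: "\<theta> \<in> C" "homogeneous q \<theta>" "\<beta> = ext_d A \<theta>"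
    using assms by (auto simp: coboundaries_def)
  \<comment> \<open>The Leibniz rule twists the first factor by (-1)^r; the scalar compensates this,
    so that d (?\<omega> \<and> \<theta>) is \<omega> \<and> d\<theta>.\<close>
  let ?\<omega> = "form_scale ((-1) ^ r) \<omega>"
  have \<omega>: "?\<omega> \<in> cocycles A C r" by (rule cocycles_scale[OF assms(1)])
  have "form_twist ?\<omega> = \<omega>"
    unfolding form_twist_homogeneous[OF cocyclesD(2)[OF \<omega>]]
    by (intro ext) (simp add: form_scale_def power_mult_distrib[symmetric] mult.assoc[symmetric])
  then have "ext_d A (wedge ?\<omega> \<theta>) = wedge \<omega> \<beta>"
    unfolding ext_d_wedge[OF A cocyclesD(4)[OF \<omega>] in_forms[OF \<theta>(1)]] \<theta>(3)
      cocyclesD(3)[OF \<omega>] wedge_zero_left by (simp only: add_0_left)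
  moreover have "wedge ?\<omega> \<theta> \<in> C" by (rule sub_dga_wedge[OF C cocyclesD(1)[OF \<omega>] \<theta>(1)])
  moreover have "homogeneous (r + q) (wedge ?\<omega> \<theta>)"
    by (rule homogeneous_wedge[OF cocyclesD(2)[OF \<omega>] \<theta>(2)])
  ultimately show ?thesis using ext_d_coboundary unfolding Suc add_Suc_right by metis
qed

lemma coh_class_mem: "\<omega> \<in> coh_class A C r \<omega>"
  unfolding coh_class_def elt_set_plus_def using coboundaries_zero by force

lemma coh_class_add_coboundary:
  assumes \<beta>: "\<beta> \<in> coboundaries A C r"
  shows "coh_class A C r (\<omega> + \<beta>) = coh_class A C r \<omega>"
proof -
  let ?B = "coboundaries A C r"
  \<comment> \<open>The negative of \<beta> is written as a scalar multiple, to which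
    \<open>coboundaries_scale\<close> applies.\<close>
  have neg: "\<beta>' = \<beta> + (\<beta>' + form_scale (-1) \<beta>)" for \<beta>'
    by (intro ext) (simp add: form_scale_def)
  have "(\<exists>b\<in>?B. \<eta> = \<omega> + \<beta> + b) \<longleftrightarrow> (\<exists>b\<in>?B. \<eta> = \<omega> + b)" for \<eta>
  proof
    assume "\<exists>b\<in>?B. \<eta> = \<omega> + \<beta> + b"
    then obtain b where "b \<in> ?B" "\<eta> = \<omega> + (\<beta> + b)" by (auto simp only: add.assoc)
    then show "\<exists>b\<in>?B. \<eta> = \<omega> + b" using coboundaries_add[OF \<beta>] by blast
  next
    assume "\<exists>b\<in>?B. \<eta> = \<omega> + b"
    then obtain b where b: "b \<in> ?B" "\<eta> = \<omega> + b" by blast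
    have "\<eta> = \<omega> + \<beta> + (b + form_scale (-1) \<beta>)" using b(2) neg[of b] by (metis add.assoc)
    then show "\<exists>b\<in>?B. \<eta> = \<omega> + \<beta> + b"
      using coboundaries_add[OF b(1) coboundaries_scale[OF \<beta>]] by blast
  qed
  then show ?thesis unfolding coh_class_def elt_set_plus_def by blast
qed

lemma coh_class_eqE:
  assumes "coh_class A C r \<omega> = coh_class A C r \<eta>"
  obtains \<beta> where "\<beta> \<in> coboundaries A C r" "\<omega> = \<eta> + \<beta>"
  using coh_class_mem[of \<omega> r] unfolding assms unfolding coh_class_def elt_set_plus_def by blast

lemma coh_class_wedge_cong:
  assumes "\<omega>1 \<in> cocycles A C r" "\<omega>2 \<in> cocycles A C r" "\<eta>1 \<in> cocycles A C s" "\<eta>2 \<in> cocycles A C s"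
    and eq: "coh_class A C r \<omega>1 = coh_class A C r \<omega>2" "coh_class A C s \<eta>1 = coh_class A C s \<eta>2"
  shows "coh_class A C (r + s) (wedge \<omega>1 \<eta>1) = coh_class A C (r + s) (wedge \<omega>2 \<eta>2)"
proof -
  obtain \<beta> where \<beta>: "\<beta> \<in> coboundaries A C r" "\<omega>1 = \<omega>2 + \<beta>" using eq(1) by (rule coh_class_eqE)
  obtain \<beta>' where \<beta>': "\<beta>' \<in> coboundaries A C s" "\<eta>1 = \<eta>2 + \<beta>'" using eq(2) by (rule coh_class_eqE)
  have "wedge \<omega>1 \<eta>1 = wedge \<omega>2 \<eta>1 + wedge \<beta> \<eta>1" by (simp only: \<beta>(2) wedge_add_left)
  moreover have "wedge \<omega>2 \<eta>1 = wedge \<omega>2 \<eta>2 + wedge \<omega>2 \<beta>'" by (simp only: \<beta>'(2) wedge_add_right)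
  ultimately show ?thesis
    using coh_class_add_coboundary[OF coboundaries_wedge_left[OF \<beta>(1) assms(3)]]
      coh_class_add_coboundary[OF coboundaries_wedge_right[OF assms(2) \<beta>'(1)]] by metis
qed

text \<open>Cosets are added elementwise, so the point is that the set of coboundaries, which
  contains 0, equals its sum with itself.\<close>

lemma coh_class_plus: "coh_class A C r \<omega> + coh_class A C r \<eta> = coh_class A C r (\<omega> + \<eta>)"
proof -
  have "coboundaries A C r + coboundaries A C r = coboundaries A C r"
  proof (intro equalityI subsetI)
    fix \<beta> assume "\<beta> \<in> coboundaries A C r"
    from set_plus_intro[OF coboundaries_zero this] show "\<beta> \<in> coboundaries A C r + coboundaries A C r"
      by (simp only: add_0_left)
  qed (erule set_plus_elim, simp only: coboundaries_add)
  then show ?thesis unfolding coh_class_def by (simp only: set_plus_rearrange)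
qed

text \<open>For a = 0, scaling the elements of a class leaves only the zero form; the coboundaries
  added in \<open>coh_scale\<close> restore the full coset.\<close>

lemma coh_scale_class: "coh_scale A C r a (coh_class A C r \<omega>) = coh_class A C r (form_scale a \<omega>)"
proof -
  let ?B = "coboundaries A C r"
  have "(\<exists>u\<in>form_scale a ` {c. \<exists>b\<in>?B. c = \<omega> + b}. \<exists>b\<in>?B. \<eta> = u + b) \<longleftrightarrow> (\<exists>b\<in>?B. \<eta> = form_scale a \<omega> + b)" for \<eta>
  proof
    assume "\<exists>u\<in>form_scale a ` {c. \<exists>b\<in>?B. c = \<omega> + b}. \<exists>b\<in>?B. \<eta> = u + b"
    then obtain b b' where b: "b \<in> ?B" "b' \<in> ?B" "\<eta> = form_scale a (\<omega> + b) + b'" by blast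
    then have "\<eta> = form_scale a \<omega> + (form_scale a b + b')" by (simp only: form_scale_add add.assoc)
    then show "\<exists>b\<in>?B. \<eta> = form_scale a \<omega> + b"
      using coboundaries_add[OF coboundaries_scale[OF b(1)] b(2)] by blast
  next
    assume "\<exists>b\<in>?B. \<eta> = form_scale a \<omega> + b"
    then obtain b where b: "b \<in> ?B" "\<eta> = form_scale a \<omega> + b" by blast
    have "\<omega> \<in> {c. \<exists>b\<in>?B. c = \<omega> + b}"
      using coboundaries_zero by (intro CollectI bexI[of _ 0]) (simp_all only: add_0_right)
    then show "\<exists>u\<in>form_scale a ` {c. \<exists>b\<in>?B. c = \<omega> + b}. \<exists>b\<in>?B. \<eta> = u + b" using b by blast
  qed
  then show ?thesis unfolding coh_scale_def coh_class_def elt_set_plus_def set_plus_def by blast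
qed

text \<open>The product is taken on representatives picked by choice, and
  \<open>coh_class_wedge_cong\<close> makes the class independent of them. Values at sets that are
  not classes are harmless, since \<open>coh_bilinear\<close> quantifies over classes.\<close>

theorem ex_cup_product:
  "\<exists>cup. coh_bilinear A C r s (r + s) cup \<and>
     (\<forall>\<omega>\<in>cocycles A C r. \<forall>\<omega>'\<in>cocycles A C s.
        cup (coh_class A C r \<omega>) (coh_class A C s \<omega>') = coh_class A C (r + s) (wedge \<omega> \<omega>'))"
proof -
  define rep where "rep t x = (SOME \<omega>. \<omega> \<in> cocycles A C t \<and> coh_class A C t \<omega> = x)" for t x
  define cup where "cup x y = coh_class A C (r + s) (wedge (rep r x) (rep s y))" for x y
  have rep: "rep t (coh_class A C t \<omega>) \<in> cocycles A C t \<and> coh_class A C t (rep t (coh_class A C t \<omega>)) = coh_class A C t \<omega>"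
    if "\<omega> \<in> cocycles A C t" for t \<omega>
    unfolding rep_def by (rule someI[of _ \<omega>]) (use that in simp)
  have cup: "cup (coh_class A C r \<omega>) (coh_class A C s \<omega>') = coh_class A C (r + s) (wedge \<omega> \<omega>')"
    if "\<omega> \<in> cocycles A C r" "\<omega>' \<in> cocycles A C s" for \<omega> \<omega>'
    unfolding cup_def using rep[OF that(1)] rep[OF that(2)] that by (intro coh_class_wedge_cong) blast+
  have coh: "\<exists>\<omega>\<in>cocycles A C t. x = coh_class A C t \<omega>" if "x \<in> cohomology A C t" for x t
    using that by (auto simp: cohomology_def)
  have "coh_bilinear A C r s (r + s) cup"
    unfolding coh_bilinear_def
  proof (intro conjI ballI allI)
    fix x y assume "x \<in> cohomology A C r" "y \<in> cohomology A C s"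
    then obtain \<omega> \<eta> where x: "\<omega> \<in> cocycles A C r" "x = coh_class A C r \<omega>"
      and y: "\<eta> \<in> cocycles A C s" "y = coh_class A C s \<eta>" using coh by metis
    show "cup x y \<in> cohomology A C (r + s)"
      unfolding x(2) y(2) cup[OF x(1) y(1)] cohomology_def by (intro imageI cocycles_wedge x y)
    show "cup (coh_scale A C r a x) y = coh_scale A C (r + s) a (cup x y)" for a
      unfolding x(2) y(2) coh_scale_class cup[OF x(1) y(1)] cup[OF cocycles_scale[OF x(1)] y(1)]
      by (simp only: wedge_scale_left)
    show "cup x (coh_scale A C s a y) = coh_scale A C (r + s) a (cup x y)" for a
      unfolding x(2) y(2) coh_scale_class cup[OF x(1) y(1)] cup[OF x(1) cocycles_scale[OF y(1)]]
      by (simp only: wedge_scale_right)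
  next
    fix x x' y assume "x \<in> cohomology A C r" "x' \<in> cohomology A C r" "y \<in> cohomology A C s"
    then obtain \<omega> \<omega>' \<eta> where x: "\<omega> \<in> cocycles A C r" "x = coh_class A C r \<omega>"
      and x': "\<omega>' \<in> cocycles A C r" "x' = coh_class A C r \<omega>'"
      and y: "\<eta> \<in> cocycles A C s" "y = coh_class A C s \<eta>" using coh by metis
    show "cup (x + x') y = cup x y + cup x' y"
      unfolding x(2) x'(2) y(2) coh_class_plus cup[OF x(1) y(1)] cup[OF x'(1) y(1)]
        cup[OF cocycles_add[OF x(1) x'(1)] y(1)] by (simp only: wedge_add_left)
  next
    fix x y y' assume "x \<in> cohomology A C r" "y \<in> cohomology A C s" "y' \<in> cohomology A C s"
    then obtain \<omega> \<eta> \<eta>' where x: "\<omega> \<in> cocycles A C r" "x = coh_class A C r \<omega>"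
      and y: "\<eta> \<in> cocycles A C s" "y = coh_class A C s \<eta>"
      and y': "\<eta>' \<in> cocycles A C s" "y' = coh_class A C s \<eta>'" using coh by metis
    show "cup x (y + y') = cup x y + cup x y'"
      unfolding x(2) y(2) y'(2) coh_class_plus cup[OF x(1) y(1)] cup[OF x(1) y'(1)]
        cup[OF x(1) cocycles_add[OF y(1) y'(1)]] by (simp only: wedge_add_right)
  qed
  then show ?thesis using cup by blast
qed

end


subsection \<open>Intersection space forms\<close>

text \<open>
  A point of the boundary cannot lie in an open subset of \<open>M\<close>, because a half-space chart around
  it contains points with negative boundary coordinate.
\<close>

lemma openin_manifold_interior:
  assumes A: "smooth_manifold A" and M: "submanifold_with_boundary A M D"
  shows "openin (top_of_set (carrier_of A)) (M - D)"
proof (subst openin_subopen, intro ballI)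
  fix z assume z: "z \<in> M - D"
  obtain W where W: "openin (top_of_set (carrier_of A)) W" "z \<in> W" "W \<subseteq> M"
    using M z unfolding submanifold_with_boundary_def by blast
  have "w \<notin> D" if w: "w \<in> W" for w
  proof
    assume "w \<in> D"
    then obtain c :: "('a, 'b) chart" and e where c: "w \<in> fst c" "open (chart_image c)"
      "diffeomorphism A (fst c) euclidean_atlas (chart_image c) (snd c)" "e \<noteq> 0"
      "snd c ` (fst c \<inter> M) = chart_image c \<inter> {y. 0 \<le> inner e y}"
      "snd c ` (fst c \<inter> D) = chart_image c \<inter> {y. inner e y = 0}"
      using M unfolding submanifold_with_boundary_def by blast
    have inv: "smooth_map euclidean_atlas A (chart_image c) (chart_inv c)" "inj_on (snd c) (fst c)"
      using c(3) by (auto simp: diffeomorphism_def chart_inv_def bij_betw_def)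
    have "openin (top_of_set (chart_image c)) (chart_image c \<inter> chart_inv c -` W)"
      by (rule continuous_openin_preimage[OF smooth_map_continuous_on[OF inv(1)] _ W(1)])
        (use inv(1) in \<open>auto simp: smooth_map_def\<close>)
    then have "open (chart_image c \<inter> chart_inv c -` W)" using c(2) by (simp add: openin_open_eq)
    moreover have "snd c w \<in> chart_image c \<inter> chart_inv c -` W"
      using c(1) w inv(2) by (simp add: chart_image_def chart_inv_def)
    ultimately obtain d where d: "d > 0" "ball (snd c w) d \<subseteq> chart_image c \<inter> chart_inv c -` W"
      by (rule openE)
    \<comment> \<open>A step of length d / 2 against e: it stays in the ball and makes the inner
      product with e negative.\<close>
    define y where "y = snd c w - (d / (2 * norm e)) *\<^sub>R e"
    have "dist (snd c w) y < d" using d(1) c(4) by (simp add: y_def dist_norm)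
    then have "y \<in> chart_image c" "chart_inv c y \<in> W" using d(2) by auto
    then have "y \<in> snd c ` (fst c \<inter> M)"
      using W(3) chart_inv_into snd_chart_inv by (metis IntI image_eqI subsetD)
    then have "0 \<le> inner e y" unfolding c(5) by simp
    moreover have "snd c w \<in> snd c ` (fst c \<inter> D)" using c(1) \<open>w \<in> D\<close> by blast
    then have "inner e (snd c w) = 0" unfolding c(6) by simp
    ultimately have "d / (2 * norm e) * inner e e \<le> 0" by (simp add: y_def inner_diff_right)
    moreover have "d / (2 * norm e) * inner e e > 0" using d(1) c(4) by simp
    ultimately show False by linarith
  qed
  then show "\<exists>W. openin (top_of_set (carrier_of A)) W \<and> z \<in> W \<and> W \<subseteq> M - D"
    using W by blast
qed

text \<open>Recovers the plain product from the weighted one in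
  \<open>cotruncation_wedge\<close>.\<close>

lemma form_weight_one: "form_weight (\<lambda>_. 1) \<omega> = \<omega>"
  by (intro ext) (simp add: form_weight_def)

text \<open>The shift by 2 reflects the initial value p 2 = 0; afterwards each step adds at most 1.
  It is used with j = m - 1.\<close>

lemma perversity_le: "perversity p \<Longrightarrow> p (j + 2) \<le> j"
proof (induction j)
  case (Suc j)
  have "p (j + 2 + 1) \<le> p (j + 2) + 1"
    using Suc.prems unfolding perversity_def by (metis le_add2)
  then show ?case using Suc by simp
qed (simp add: perversity_def numeral_2_eq_2)

text \<open>Matches the sums in \<open>ft_forms\<close>, where the pullbacks stand inside the
  products, with \<open>wedge_sums\<close> of two sets of pulled back forms.\<close>

lemma wedge_sums_image:
  "wedge_sums (F ` S) (G ` T) =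
     {\<Sum>j<(l::nat). wedge (F (f j)) (G (g j)) | l f g. \<forall>j<l. f j \<in> S \<and> g j \<in> T}" (is "_ = ?R")
proof (intro equalityI subsetI)
  fix \<omega> assume "\<omega> \<in> wedge_sums (F ` S) (G ` T)"
  then obtain l :: nat and f g where *: "\<omega> = (\<Sum>j<l. wedge (f j) (g j))"
    "\<And>j. j < l \<Longrightarrow> f j \<in> F ` S" "\<And>j. j < l \<Longrightarrow> g j \<in> G ` T"
    by (rule wedge_sumsE) blast
  have "\<forall>j<l. \<exists>s\<in>S. f j = F s" "\<forall>j<l. \<exists>t\<in>T. g j = G t" using * by blast+
  then obtain f' g' where f': "\<And>j. j < l \<Longrightarrow> f' j \<in> S \<and> f j = F (f' j)"
    and g': "\<And>j. j < l \<Longrightarrow> g' j \<in> T \<and> g j = G (g' j)" by metis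
  have "\<omega> = (\<Sum>j<l. wedge (F (f' j)) (G (g' j)))"
    unfolding *(1) by (rule sum.cong) (use f' g' in auto)
  then show "\<omega> \<in> ?R" using f' g' by blast
next
  fix \<omega> assume "\<omega> \<in> ?R"
  then obtain l :: nat and f g where *: "\<omega> = (\<Sum>j<l. wedge (F (f j)) (G (g j)))" "\<forall>j<l. f j \<in> S \<and> g j \<in> T"
    by blast
  show "\<omega> \<in> wedge_sums (F ` S) (G ` T)"
    unfolding *(1) by (intro wedge_sums_sum wedge_sums_wedge imageI) (use *(2) in auto)
qed

lemma two_strata_pseudomanifoldD:
  assumes "two_strata_pseudomanifold X"
  shows "smooth_manifold (regular_atlas X)" "smooth_manifold (stratum_atlas X)" "smooth_manifold (link_atlas X)"
    "submanifold_with_boundary (regular_atlas X) (blowup X) (link_total X)"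
    "continuous_on (tube X) (tube_retraction X)" "tube_retraction X ` tube X \<subseteq> stratum X"
  using assms by (auto simp: two_strata_pseudomanifold_def retraction_def)

lemma smooth_manifold_link_total:
  "two_strata_pseudomanifold X \<Longrightarrow> smooth_manifold (link_total_atlas X)"
  unfolding link_total_atlas_def
  by (rule smooth_manifold_submanifold[OF two_strata_pseudomanifoldD(1)])

lemma smooth_collarE:
  assumes "smooth_collar X"
  obtains U where "U \<subseteq> blowup X"
    "diffeomorphism (prod_atlas euclidean_atlas (link_total_atlas X)) ({-2<..1} \<times> link_total X)
       (regular_atlas X) U (collar X)"
    "\<And>x. x \<in> link_total X \<Longrightarrow> collar X (1, x) = x"
proof -
  obtain U where U: "openin (top_of_set (blowup X)) U"
    "diffeomorphism (prod_atlas euclidean_atlas (link_total_atlas X)) ({-2<..1} \<times> link_total X)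
       (regular_atlas X) U (collar X)"
    using assms unfolding smooth_collar_def by blast
  have "U \<subseteq> blowup X" using openin_subset[OF U(1)] by simp
  then show ?thesis
    by (rule that[OF _ U(2)]) (use assms in \<open>simp add: smooth_collar_def\<close>)
qed

text \<open>That charts cover the whole link bundle is read off from the collar:
  \<open>diffeomorphism\<close> places its domain inside the carrier of the product atlas.\<close>

lemma carrier_of_link_total_atlas:
  assumes "smooth_collar X"
  shows "carrier_of (link_total_atlas X) = link_total X"
proof
  show "carrier_of (link_total_atlas X) \<subseteq> link_total X"
    unfolding link_total_atlas_def by (rule carrier_of_submanifold_atlas)
  obtain U where "diffeomorphism (prod_atlas euclidean_atlas (link_total_atlas X)) ({-2<..1} \<times> link_total X)
       (regular_atlas X) U (collar X)"
    using assms by (rule smooth_collarE)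
  then have sub: "{-2<..1::real} \<times> link_total X \<subseteq> UNIV \<times> carrier_of (link_total_atlas X)"
    by (simp add: diffeomorphism_def smooth_map_def carrier_of_prod_atlas)
  show "link_total X \<subseteq> carrier_of (link_total_atlas X)"
  proof
    fix x assume "x \<in> link_total X"
    \<comment> \<open>Any parameter in the collar interval would do in place of 0.\<close>
    then have "(0, x) \<in> {-2<..1::real} \<times> link_total X" by simp
    with sub show "x \<in> carrier_of (link_total_atlas X)" by blast
  qed
qed

text \<open>For each member of the cover the condition is a relation between the pullbacks along the
  inclusion of the preimage and along the trivialization; these conditions are then
  intersected.\<close>

lemma sub_dga_ft_forms:
  fixes X :: "('x::{t2_space,second_countable_topology}, 'n::finite, 'b::fin_dim_inner,
               'f::{t2_space,second_countable_topology}, 'm::{finite,linorder}, 'i) pseudomanifold"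
  assumes X: "two_strata_pseudomanifold X" and flat: "flat_isometric_link_bundle X"
    and collar: "smooth_collar X" and k: "k \<ge> 1"
  shows "sub_dga (link_total_atlas X) (ft_forms X k)"
proof -
  let ?L = "link_total_atlas X" and ?S = "stratum_atlas X" and ?F = "link_atlas X"
  let ?U = "\<lambda>\<alpha>. restrict_atlas (cover X \<alpha>) ?S" and ?V = "\<lambda>\<alpha>. link_preimage X (cover X \<alpha>)"
  let ?P = "\<lambda>\<alpha>. restrict_atlas (?V \<alpha>) ?L" and ?Q = "\<lambda>\<alpha>. prod_atlas (?U \<alpha>) ?F"
  let ?C = "cotruncation ?F (link_metric X) k"
  let ?M = "\<lambda>\<alpha>. pullback (?Q \<alpha>) (?U \<alpha>) fst ` forms (?U \<alpha>)"
  let ?N = "\<lambda>\<alpha>. pullback (?Q \<alpha>) ?F snd ` ?C"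
  let ?D = "\<lambda>\<alpha>. {\<omega> \<in> forms ?L. \<exists>\<eta>\<in>wedge_sums (?M \<alpha>) (?N \<alpha>).
    pullback (?P \<alpha>) ?L id \<omega> = pullback (?P \<alpha>) (?Q \<alpha>) (trivialization X \<alpha>) \<eta>}"
  note S = two_strata_pseudomanifoldD(2)[OF X] and F = two_strata_pseudomanifoldD(3)[OF X]
    and L = smooth_manifold_link_total[OF X]
  have "sub_dga ?L (?D \<alpha>)" if \<alpha>: "\<alpha> \<in> cover_index X" for \<alpha>
  proof -
    have cover: "openin (top_of_set (carrier_of ?S)) (cover X \<alpha>)"
      using flat \<alpha> by (simp add: flat_isometric_link_bundle_def stratum_def)
    have triv: "diffeomorphism ?L (?V \<alpha>) (prod_atlas ?S ?F) (cover X \<alpha> \<times> link X) (trivialization X \<alpha>)"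
      using flat \<alpha> by (simp add: flat_isometric_link_bundle_def)
    have cS: "carrier_of ?S \<inter> cover X \<alpha> = cover X \<alpha>" using openin_subset[OF cover] by auto
    have U: "smooth_manifold (?U \<alpha>)"
      by (rule smooth_manifold_restrict[OF S]) (simp only: cS cover)
    have Q: "smooth_manifold (?Q \<alpha>)" by (rule smooth_manifold_prod[OF U F])
    have cL: "carrier_of ?L \<inter> ?V \<alpha> = ?V \<alpha>"
      by (auto simp: carrier_of_link_total_atlas[OF collar] link_preimage_def)
    \<comment> \<open>The retraction is continuous on the tube, which contains the link bundle. So
      the preimage is cut out of the bundle by an open set of the ambient space.\<close>
    have V: "openin (top_of_set (carrier_of ?L)) (carrier_of ?L \<inter> ?V \<alpha>)"
    proof -
      have "openin (top_of_set (tube X)) (tube X \<inter> tube_retraction X -` cover X \<alpha>)"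
        by (rule continuous_openin_preimage[OF two_strata_pseudomanifoldD(5)[OF X], of "carrier_of ?S"])
          (use two_strata_pseudomanifoldD(6)[OF X] cover in \<open>auto simp: stratum_def\<close>)
      then obtain O' where "open O'" "tube X \<inter> tube_retraction X -` cover X \<alpha> = tube X \<inter> O'"
        by (auto simp: openin_open)
      then have "open O'" "?V \<alpha> = link_total X \<inter> O'"
        by (auto simp: link_preimage_def link_total_def)
      then show ?thesis unfolding cL carrier_of_link_total_atlas[OF collar] openin_open by blast
    qed
    have P: "smooth_manifold (?P \<alpha>)" by (rule smooth_manifold_restrict[OF L V])
    have id: "manifold_map (?P \<alpha>) ?L id"
      using manifold_map_restrict[OF L L smooth_map_id[OF L] V, of UNIV] by simp
    have triv': "manifold_map (?P \<alpha>) (?Q \<alpha>) (trivialization X \<alpha>)"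
      unfolding restrict_prod_atlas
    proof (rule manifold_map_restrict[OF L smooth_manifold_prod[OF S F] _ V])
      show "smooth_map ?L (prod_atlas ?S ?F) (carrier_of ?L \<inter> ?V \<alpha>) (trivialization X \<alpha>)"
        unfolding cL using triv by (simp add: diffeomorphism_def)
      show "trivialization X \<alpha> ` (carrier_of ?L \<inter> ?V \<alpha>) \<subseteq> cover X \<alpha> \<times> UNIV"
        unfolding cL using triv by (auto simp: diffeomorphism_def bij_betw_def)
    qed
    have cQ: "carrier_of (prod_atlas ?S ?F) \<inter> cover X \<alpha> \<times> UNIV = cover X \<alpha> \<times> carrier_of ?F"
      using openin_subset[OF cover] by (auto simp: carrier_of_prod_atlas)
    have openQ: "openin (top_of_set (carrier_of (prod_atlas ?S ?F))) (carrier_of (prod_atlas ?S ?F) \<inter> cover X \<alpha> \<times> UNIV)"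
      unfolding cQ unfolding carrier_of_prod_atlas by (intro openin_Times cover openin_subtopology_self)
    have subQ: "carrier_of (prod_atlas ?S ?F) \<inter> cover X \<alpha> \<times> UNIV \<subseteq> carrier_of ?S \<times> carrier_of ?F"
      by (auto simp: carrier_of_prod_atlas)
    have fst: "manifold_map (?Q \<alpha>) (?U \<alpha>) fst"
      unfolding restrict_prod_atlas
      by (rule manifold_map_restrict[OF smooth_manifold_prod[OF S F] S smooth_map_subset[OF smooth_map_fst[OF S F] subQ] openQ])
        auto
    have snd: "manifold_map (?Q \<alpha>) ?F snd"
      unfolding restrict_prod_atlas
      using manifold_map_restrict[OF smooth_manifold_prod[OF S F] F smooth_map_subset[OF smooth_map_snd[OF S F] subQ] openQ, of UNIV]
      by simp
    have CF: "\<gamma> \<in> forms ?F" if "\<gamma> \<in> ?C" for \<gamma> using that by (simp add: cotruncation_def)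
    \<comment> \<open>Forms on the base are pulled back by \<open>fst\<close>, cotruncated forms on
      the fibre by \<open>snd\<close>. Each closure property is inherited from the factor, since
      pullback commutes with the operation.\<close>
    have dga: "sub_dga (?Q \<alpha>) (wedge_sums (?M \<alpha>) (?N \<alpha>))"
    proof (rule sub_dga_wedge_sums[OF Q]; (elim imageE, clarify)?)
      show "?M \<alpha> \<subseteq> forms (?Q \<alpha>)" using pullback_forms[OF Q U fst] by blast
      show "?N \<alpha> \<subseteq> forms (?Q \<alpha>)" using pullback_forms[OF Q F snd] CF by blast
      fix \<eta> \<eta>' assume \<eta>: "\<eta> \<in> forms (?U \<alpha>)" "\<eta>' \<in> forms (?U \<alpha>)"
      show "form_weight r (pullback (?Q \<alpha>) (?U \<alpha>) fst \<eta>) \<in> ?M \<alpha>" for r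
        unfolding pullback_weight[symmetric] by (intro imageI weight_forms[OF U] \<eta>)
      show "ext_d (?Q \<alpha>) (pullback (?Q \<alpha>) (?U \<alpha>) fst \<eta>) \<in> ?M \<alpha>"
        unfolding ext_d_pullback[OF Q U fst \<eta>(1)] by (intro imageI ext_d_forms[OF U] \<eta>)
      show "wedge (pullback (?Q \<alpha>) (?U \<alpha>) fst \<eta>) (pullback (?Q \<alpha>) (?U \<alpha>) fst \<eta>') \<in> ?M \<alpha>"
        unfolding pullback_wedge[symmetric] by (intro imageI wedge_forms[OF U] \<eta>)
    next
      fix \<gamma> \<gamma>' assume \<gamma>: "\<gamma> \<in> ?C" "\<gamma>' \<in> ?C"
      show "form_component r (pullback (?Q \<alpha>) ?F snd \<gamma>) \<in> ?N \<alpha>" for r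
        unfolding form_component_eq_weight pullback_weight[symmetric]
        unfolding form_component_eq_weight[symmetric] by (intro imageI cotruncation_component[OF F] \<gamma>)
      show "ext_d (?Q \<alpha>) (pullback (?Q \<alpha>) ?F snd \<gamma>) \<in> ?N \<alpha>"
        unfolding ext_d_pullback[OF Q F snd CF[OF \<gamma>(1)]] by (rule imageI[OF cotruncation_ext_d[OF F \<gamma>(1) k]])
      \<comment> \<open>An arbitrary weight covers both products: constant 1 for the plain one,
        (-1)^n for the twisted one.\<close>
      have "wedge (form_weight r (pullback (?Q \<alpha>) ?F snd \<gamma>)) (pullback (?Q \<alpha>) ?F snd \<gamma>') \<in> ?N \<alpha>" for r
        unfolding pullback_weight[symmetric] pullback_wedge[symmetric]
        by (rule imageI[OF cotruncation_wedge[OF F \<gamma> k]])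
      then show "wedge (pullback (?Q \<alpha>) ?F snd \<gamma>) (pullback (?Q \<alpha>) ?F snd \<gamma>') \<in> ?N \<alpha>"
        "wedge (form_twist (pullback (?Q \<alpha>) ?F snd \<gamma>)) (pullback (?Q \<alpha>) ?F snd \<gamma>') \<in> ?N \<alpha>"
        unfolding form_twist_def by (metis form_weight_one)+
    qed
    show ?thesis by (rule sub_dga_pullback[OF P L Q id triv' dga])
  qed
  then have "sub_dga ?L {\<omega> \<in> forms ?L. \<forall>\<alpha>\<in>cover_index X. \<omega> \<in> ?D \<alpha>}"
    by (rule sub_dga_INT[OF L])
  moreover have "ft_forms X k = {\<omega> \<in> forms ?L. \<forall>\<alpha>\<in>cover_index X. \<omega> \<in> ?D \<alpha>}"
    unfolding ft_forms_def Let_def wedge_sums_image by blast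
  ultimately show ?thesis by simp
qed

lemma sub_dga_OmegaI:
  fixes X :: "('x::{t2_space,second_countable_topology}, 'n::finite, 'b::fin_dim_inner,
               'f::{t2_space,second_countable_topology}, 'm::{finite,linorder}, 'i) pseudomanifold"
  assumes X: "two_strata_pseudomanifold X" and flat: "flat_isometric_link_bundle X"
    and collar: "smooth_collar X" and p: "perversity p"
  shows "smooth_manifold (interior_atlas X)" "sub_dga (interior_atlas X) (OmegaI X p)"
proof -
  let ?A = "regular_atlas X" and ?L = "link_total_atlas X" and ?N = "interior_atlas X"
  let ?I = "blowup X - link_total X"
  let ?R = "euclidean_atlas :: (real, real) atlas"
  let ?E = "prod_atlas (restrict_atlas {-1<..<1} ?R) ?L" and ?J = "{-1<..<1::real} \<times> (UNIV :: 'x set)"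
  note A = two_strata_pseudomanifoldD(1)[OF X] and L = smooth_manifold_link_total[OF X]
    and cL = carrier_of_link_total_atlas[OF collar]
  have RL: "smooth_manifold (prod_atlas ?R ?L)" by (rule smooth_manifold_prod[OF smooth_manifold_euclidean L])
  have "?I \<subseteq> carrier_of ?A"
    using two_strata_pseudomanifoldD(4)[OF X] by (auto simp: submanifold_with_boundary_def)
  then have "carrier_of ?A \<inter> ?I = ?I" by blast
  then have I: "openin (top_of_set (carrier_of ?A)) (carrier_of ?A \<inter> ?I)"
    using openin_manifold_interior[OF A two_strata_pseudomanifoldD(4)[OF X]] by simp
  show N: "smooth_manifold ?N"
    unfolding interior_atlas_def by (rule smooth_manifold_restrict[OF A I])
  have cE: "carrier_of (prod_atlas ?R ?L) \<inter> ?J = {-1<..<1} \<times> link_total X"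
    by (auto simp: carrier_of_prod_atlas cL)
  have J: "openin (top_of_set (carrier_of (prod_atlas ?R ?L))) (carrier_of (prod_atlas ?R ?L) \<inter> ?J)"
    unfolding cE unfolding carrier_of_prod_atlas cL by (intro openin_Times openin_subtopology_self) simp
  have E: "smooth_manifold ?E"
    unfolding restrict_prod_atlas by (rule smooth_manifold_restrict[OF RL J])
  obtain U where U: "U \<subseteq> blowup X"
    "diffeomorphism (prod_atlas ?R ?L) ({-2<..1} \<times> link_total X) ?A U (collar X)"
    "\<And>x. x \<in> link_total X \<Longrightarrow> collar X (1, x) = x"
    using collar by (rule smooth_collarE) blast
  have inj: "inj_on (collar X) ({-2<..1} \<times> link_total X)" and im: "collar X ` ({-2<..1} \<times> link_total X) = U"
    using U(2) by (auto simp: diffeomorphism_def bij_betw_def)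
  have sub: "carrier_of (prod_atlas ?R ?L) \<inter> ?J \<subseteq> {-2<..1} \<times> link_total X" unfolding cE by auto
  have "manifold_map ?E ?N (collar X)"
    unfolding restrict_prod_atlas interior_atlas_def
  proof (rule manifold_map_restrict[OF RL A _ J])
    show "smooth_map (prod_atlas ?R ?L) ?A (carrier_of (prod_atlas ?R ?L) \<inter> ?J) (collar X)"
      by (rule smooth_map_subset[OF _ sub]) (use U(2) in \<open>simp add: diffeomorphism_def\<close>)
    show "collar X ` (carrier_of (prod_atlas ?R ?L) \<inter> ?J) \<subseteq> ?I"
    proof
      fix z assume "z \<in> collar X ` (carrier_of (prod_atlas ?R ?L) \<inter> ?J)"
      then obtain t x where tx: "-1 < t" "t < 1" "x \<in> link_total X" "z = collar X (t, x)"
        unfolding cE by auto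
      have "z \<in> blowup X" using tx U(1) im by auto
      moreover have "z \<notin> link_total X"
      proof
        assume z: "z \<in> link_total X"
        \<comment> \<open>A boundary point is also its own collar image at parameter 1, so
          injectivity on the half-open interval forces t = 1. Hence the collar over (-1, 1) lands in
          the interior.\<close>
        then have "collar X (1, z) = collar X (t, x)" using U(3) tx(4) by simp
        then have "(1, z) = (t, x)" by (rule inj_onD[OF inj]) (use z tx in auto)
        then show False using tx(2) by simp
      qed
      ultimately show "z \<in> ?I" by blast
    qed
  qed
  moreover have "manifold_map ?E ?L snd"
  proof -
    have "carrier_of (prod_atlas ?R ?L) \<inter> ?J \<subseteq> carrier_of ?R \<times> carrier_of ?L"
      by (auto simp: carrier_of_prod_atlas)
    from manifold_map_restrict[OF RL L smooth_map_subset[OF smooth_map_snd[OF smooth_manifold_euclidean L] this] J, of UNIV]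
    show ?thesis unfolding restrict_prod_atlas by simp
  qed
  moreover have "sub_dga ?L (ft_forms X (CARD('m) - p (CARD('m) + 1)))"
  proof (rule sub_dga_ft_forms[OF X flat collar])
    have m: "CARD('m) \<ge> 1" by (simp add: Suc_le_eq)
    \<comment> \<open>Rewrites m + 1 in the shifted form of \<open>perversity_le\<close>; m - 1 does
      not truncate because m \<ge> 1.\<close>
    moreover from m have "CARD('m) - 1 + 2 = CARD('m) + 1" by linarith
    then have "p (CARD('m) + 1) \<le> CARD('m) - 1"
      using perversity_le[OF p, of "CARD('m) - 1"] by simp
    ultimately show "1 \<le> CARD('m) - p (CARD('m) + 1)" by linarith
  qed
  ultimately show "sub_dga ?N (OmegaI X p)"
    unfolding OmegaI_def Let_def by (rule sub_dga_pullback[OF E N L])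
qed

theorem theorem10p1:
  fixes X :: "('x::{t2_space,second_countable_topology}, 'n::finite, 'b::fin_dim_inner,
               'f::{t2_space,second_countable_topology}, 'm::{finite,linorder}, 'i) pseudomanifold"
    and p :: "nat \<Rightarrow> nat"
  assumes "two_strata_pseudomanifold X"
    and "flat_isometric_link_bundle X"
    and "smooth_collar X"
    and "perversity p"
  shows "sub_dga (interior_atlas X) (OmegaI X p) \<and>
    (\<forall>r s. \<exists>cup. coh_bilinear (interior_atlas X) (OmegaI X p) r s (r + s) cup \<and>
       (\<forall>\<omega>\<in>cocycles (interior_atlas X) (OmegaI X p) r.
        \<forall>\<omega>'\<in>cocycles (interior_atlas X) (OmegaI X p) s.
          cup (coh_class (interior_atlas X) (OmegaI X p) r \<omega>)
              (coh_class (interior_atlas X) (OmegaI X p) s \<omega>') =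
          coh_class (interior_atlas X) (OmegaI X p) (r + s) (wedge \<omega> \<omega>')))"
  using sub_dga_OmegaI(2)[OF assms] ex_cup_product[OF sub_dga_OmegaI[OF assms]] by blast

end
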